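(* Let $F:\mathbb{D}\to\mathbb{D}$ be an inner function with $F(0)=0$, not a rotation, of finite Lyapunov exponent. For $\xi$-a.e. inverse orbit $\mathbf z=(z_{-i})_{i=0}^\infty\in\widehat{\mathbb{D}}$, the cumulative linear distortion $\widehat\delta(\mathbf z)=\sum_{n=1}^\infty\delta_F(z_{-n})$ is finite. Consequently, $\xi(\widehat{\mathbb{D}}\setminus\widehat{\mathbb{D}}_{\mathrm{lin}})=0$.
   Context: An inner function is a holomorphic self-map of $\mathbb{D}$ with radial boundary values of modulus $1$ a.e. Let $m$ be normalized Lebesgue measure on $\partial\mathbb{D}$ and $|F'(\zeta)|$, $\zeta\in\partial\mathbb{D}$, the modulus of the Carathéodory angular derivative ($+\infty$ if it does not exist); finite Lyapunov exponent means $\int_{\partial\mathbb{D}}\log|F'|\,dm<\infty$. Space of inverse orbits: $\widehat{\mathbb{D}}=\{\mathbf z=(z_i)_{i=-\infty}^0: z_i\in\mathbb{D},\ F(z_i)=z_{i+1}\}\setminus\{\mathbf 0\}$, where $\mathbf 0$ is the constant sequence $0$; $\widehat F$ applies $F$ to each coordinate. Measure $\xi$: let $dA_{\mathrm{hyp}}=\frac{4\,dA}{(1-|z|^2)^2}$. For a measurable set $A$ compactly contained in $\mathbb{D}$ let $\widehat A=\{\mathbf z\in\widehat{\mathbb{D}}:z_0\in A\}$. Then $\xi$ is the $\widehat F$-invariant measure on $\widehat{\mathbb{D}}$ determined by $$\xi(\widehat A)=\lim_{n\to\infty}\frac1{2\pi}\int_{F^{-n}(A)}\log\frac1{|z|}\,dA_{\mathrm{hyp}}(z)$$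 (the integrals are nondecreasing in $n$). Linear distortion: let $v_{\mathrm{rad}}$ be the outward-pointing radial vector field on $\mathbb{D}\setminus\{0\}$ of hyperbolic length $1$ (for the metric $\frac{2|dz|}{1-|z|^2}$). For a holomorphic self-map $G$ of $\mathbb{D}$ and $a$ with $a,G(a)\neq0$, regard the ratio of tangent vectors at $G(a)$ as a complex number: $$\delta_G(a)=\left|1-\frac{G_*v_{\mathrm{rad}}(a)}{v_{\mathrm{rad}}(G(a))}\right|,\qquad \frac{G_*v_{\mathrm{rad}}(a)}{v_{\mathrm{rad}}(G(a))}=\frac{G'(a)\,\frac{a}{|a|}\,(1-|a|^2)}{\frac{G(a)}{|G(a)|}\,(1-|G(a)|^2)}.$$ $\widehat{\mathbb{D}}_{\mathrm{lin}}\subset\widehat{\mathbb{D}}$ is the set of inverse orbits along which backward iteration is asymptotically linear: $\delta_{F^{\circ m}}(z_{-m-n})\to0$ as $m,n\to\infty$. *)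

theory Defs
  imports "HOL-Analysis.Analysis"
begin

text \<open>
  The unit disk is \<open>ball (0::complex) 1\<close>. Self-maps of the disk are total functions
  \<open>complex \<Rightarrow> complex\<close> of which only the values on the disk are used.
\<close>

section \<open>Inner functions and angular derivatives\<close>

definition circle_measure :: "complex measure" where
  "circle_measure = distr (uniform_measure lborel {0..<2 * pi}) borel cis"

definition inner_function :: "(complex \<Rightarrow> complex) \<Rightarrow> bool" where
  "inner_function F \<longleftrightarrow>
     F holomorphic_on ball 0 1 \<and> F ` ball 0 1 \<subseteq> ball 0 1 \<and>
     (AE \<zeta> in circle_measure.
        \<exists>w. norm w = 1 \<and> ((\<lambda>r. F (of_real r * \<zeta>)) \<longlongrightarrow> w) (at_left 1))"

definition is_rotation :: "(complex \<Rightarrow> complex) \<Rightarrow> bool" where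
  "is_rotation F \<longleftrightarrow> (\<exists>c. norm c = 1 \<and> (\<forall>z\<in>ball 0 1. F z = c * z))"

definition stolz_angle :: "complex \<Rightarrow> real \<Rightarrow> complex set" where
  "stolz_angle \<zeta> M = {z \<in> ball 0 1. norm (z - \<zeta>) < M * (1 - norm z)}"

text \<open>
  Angular derivative in the sense of Caratheodory: there is a unimodular \<open>\<omega>\<close>, necessarily
  the nontangential boundary value of \<open>F\<close>, for which the difference quotient has a finite
  nontangential limit.
\<close>

definition has_angular_deriv :: "(complex \<Rightarrow> complex) \<Rightarrow> complex \<Rightarrow> complex \<Rightarrow> bool" where
  "has_angular_deriv F \<zeta> L \<longleftrightarrow>
     (\<exists>\<omega>. norm \<omega> = 1 \<and>
        (\<forall>M>1. ((\<lambda>z. (F z - \<omega>) / (z - \<zeta>)) \<longlongrightarrow> L) (at \<zeta> within stolz_angle \<zeta> M)))"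

definition angular_deriv_modulus :: "(complex \<Rightarrow> complex) \<Rightarrow> complex \<Rightarrow> ennreal" where
  "angular_deriv_modulus F \<zeta> =
     (if \<exists>L. has_angular_deriv F \<zeta> L
      then ennreal (norm (THE L. has_angular_deriv F \<zeta> L)) else \<infinity>)"

definition log_angular_deriv :: "(complex \<Rightarrow> complex) \<Rightarrow> complex \<Rightarrow> ereal" where
  "log_angular_deriv F \<zeta> =
     (if angular_deriv_modulus F \<zeta> = \<infinity> then \<infinity>
      else ereal (ln (enn2real (angular_deriv_modulus F \<zeta>))))"

text \<open>
  By the Schwarz lemma \<open>log |F'|\<close> is bounded below on the circle, and it is nonnegative if
  \<open>F 0 = 0\<close>. So its integral always exists in \<open>(-\<infinity>, \<infinity>]\<close>, and it is finite iff the integral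
  of the positive part, which is what \<open>e2ennreal\<close> takes, is finite.
\<close>

definition finite_lyapunov_exponent :: "(complex \<Rightarrow> complex) \<Rightarrow> bool" where
  "finite_lyapunov_exponent F \<longleftrightarrow>
     (\<integral>\<^sup>+\<zeta>. e2ennreal (log_angular_deriv F \<zeta>) \<partial>circle_measure) < \<infinity>"

section \<open>Inverse orbits\<close>

text \<open>
  An inverse orbit \<open>(z_i)\<close>, \<open>i \<le> 0\<close>, is encoded as a function on the naturals, with
  \<open>z n\<close> standing for the entry of index \<open>-n\<close>.
\<close>

definition inverse_orbits :: "(complex \<Rightarrow> complex) \<Rightarrow> (nat \<Rightarrow> complex) set" where
  "inverse_orbits F =
     {z. (\<forall>n. z n \<in> ball 0 1) \<and> (\<forall>n. F (z (Suc n)) = z n)} - {\<lambda>_. 0}"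

definition shift_map :: "(complex \<Rightarrow> complex) \<Rightarrow> (nat \<Rightarrow> complex) \<Rightarrow> (nat \<Rightarrow> complex)" where
  "shift_map F z = (\<lambda>n. F (z n))"

definition hyp_area :: "complex measure" where
  "hyp_area = density lborel (\<lambda>z. indicator (ball 0 1) z * ennreal (4 / (1 - (norm z)\<^sup>2)\<^sup>2))"

text \<open>
  The defining properties of the measure \<open>\<xi>\<close>, on the Borel sets of the product topology.
  The value of \<open>ln (1 / norm z)\<close> at the single point \<open>z = 0\<close> does not affect the integrals.
\<close>

definition is_inverse_orbit_measure ::
    "(complex \<Rightarrow> complex) \<Rightarrow> (nat \<Rightarrow> complex) measure \<Rightarrow> bool" where
  "is_inverse_orbit_measure F \<xi> \<longleftrightarrow>
     space \<xi> = inverse_orbits F \<and>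
     sets \<xi> = sets (restrict_space borel (inverse_orbits F)) \<and>
     shift_map F \<in> measurable \<xi> \<xi> \<and> distr \<xi> \<xi> (shift_map F) = \<xi> \<and>
     (\<forall>A \<in> sets borel. compact (closure A) \<and> closure A \<subseteq> ball 0 1 \<longrightarrow>
        (\<lambda>n. ennreal (1 / (2 * pi)) *
              (\<integral>\<^sup>+z\<in>{z \<in> ball 0 1. (F ^^ n) z \<in> A}. ennreal (ln (1 / norm z)) \<partial>hyp_area))
          \<longlonglongrightarrow> emeasure \<xi> {z \<in> inverse_orbits F. z 0 \<in> A})"

section \<open>Linear distortion\<close>

definition v_rad :: "complex \<Rightarrow> complex" where
  "v_rad a = of_real ((1 - (norm a)\<^sup>2) / 2) * (a / of_real (norm a))"

lemma v_rad_hyperbolic_length: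
  assumes "a \<in> ball 0 1" "a \<noteq> 0"
  shows "2 * norm (v_rad a) / (1 - (norm a)\<^sup>2) = 1"
proof -
  have "(norm a)\<^sup>2 < 1"
    using assms by (simp add: abs_square_less_1)
  then show ?thesis
    using assms by (simp add: v_rad_def norm_mult norm_divide del: of_real_divide of_real_diff)
qed

text \<open>Meaningful only if \<open>a\<close> and \<open>G a\<close> are nonzero; otherwise the value is 1 by \<open>x / 0 = 0\<close>.\<close>

definition linear_distortion :: "(complex \<Rightarrow> complex) \<Rightarrow> complex \<Rightarrow> real" where
  "linear_distortion G a = norm (1 - deriv G a * v_rad a / v_rad (G a))"

lemma push_forward_v_rad_ratio:
  "deriv G a * v_rad a / v_rad (G a) =
     (deriv G a * (a / of_real (norm a)) * of_real (1 - (norm a)\<^sup>2)) /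
     ((G a / of_real (norm (G a))) * of_real (1 - (norm (G a))\<^sup>2))"
  by (simp add: v_rad_def mult_ac)

text \<open>
  Along an inverse orbit only finitely many entries are 0 if \<open>F 0 = 0\<close>, so the conventional
  value of the distortion at 0 contributes at most finitely many finite terms here and does
  not affect the limit in \<open>linear_inverse_orbits\<close>.
\<close>

definition cumulative_distortion :: "(complex \<Rightarrow> complex) \<Rightarrow> (nat \<Rightarrow> complex) \<Rightarrow> ennreal" where
  "cumulative_distortion F z = (\<Sum>n. ennreal (linear_distortion F (z (Suc n))))"

definition linear_inverse_orbits :: "(complex \<Rightarrow> complex) \<Rightarrow> (nat \<Rightarrow> complex) set" where
  "linear_inverse_orbits F =
     {z \<in> inverse_orbits F.
        ((\<lambda>(m, n). linear_distortion (F ^^ m) (z (m + n))) \<longlongrightarrow> 0) (sequentially \<times>\<^sub>F sequentially)}"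

end

theory Submission
  imports Defs "HOL-Complex_Analysis.Complex_Analysis"
begin

text \<open>
  Let \<open>q = x + i y\<close> be the ratio of the pushed forward radial field to the radial field, so that
  \<open>\<delta>\<^sub>F = |1 - q|\<close>, and \<open>|q| \<le> 1\<close> by the Schwarz-Pick inequality. Let \<open>\<lambda>\<close> be the measure
  \<open>log (1/|z|) dA_hyp\<close> on the disk, whose preimages define \<open>\<xi>\<close>. The proof has three parts.

  \<^bold>\<open>The distortion is \<open>\<lambda>\<close>-integrable\<close> (\<open>linear_distortion_integrable\<close>). Fix a point \<open>\<zeta>\<close> of the circle,
  let \<open>t\<close> be hyperbolic length along the radius to \<open>\<zeta>\<close>, and write \<open>r = |z|\<close>, \<open>B = |F z|\<close>. The function
  \<open>u = log ((1 - B\<^sup>2) / (1 - r\<^sup>2))\<close> starts at 0, increases at the rate \<open>r - B x \<ge> 0\<close>, and stays below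
  \<open>log |F' \<zeta>|\<close>. Hence \<open>B \<ge> 1/2\<close> from some time on that is at most \<open>log |F' \<zeta>|\<close> plus a constant, and from
  then on \<open>1 - x \<le> 2 (r - B x)\<close>. So \<open>\<integral> (1 - x) dt\<close> is at most a constant times \<open>1 + log |F' \<zeta>|\<close>. The
  imaginary part obeys the differential equation \<open>y' = c - coth D \<cdot> x \<cdot> y\<close>, where \<open>D\<close> is the hyperbolic
  distance from 0 to \<open>F z\<close>: geodesics through 0 spread, which damps \<open>y\<close>, and the only forcing term \<open>c\<close>
  measures how the image of the radius bends, for which the Schwarz-Pick inequality of second order gives
  \<open>|c| \<le> 1 - |q|\<^sup>2 \<le> 2 (1 - x)\<close>. So \<open>\<integral> |y| dt\<close> has a bound of the same form. Integrating over
  the circle in polar coordinates gives \<open>\<integral> \<delta>\<^sub>F d\<lambda> < \<infinity>\<close>, because \<open>log |F'|\<close> is integrable.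

  \<^bold>\<open>Backward steps barely lose mass\<close> (\<open>littlewood_green\<close>). A Blaschke product argument gives
  \<open>\<Sum> log (1/|w|) \<le> log (1/|z|)\<close> over the preimages \<open>w\<close> of \<open>z\<close>. With the change of variables formula this
  becomes \<open>\<integral> (g \<circ> F) \<cdot> H d\<lambda> \<le> \<integral> g d\<lambda>\<close> for \<open>g \<ge> 0\<close>, where \<open>H\<close> is the square of the hyperbolic derivative of
  \<open>F\<close>. Moreover \<open>1 - H \<le> 2 \<delta>\<^sub>F\<close>.

  \<^bold>\<open>Wandering sets\<close> (\<open>divergent_null\<close>). If \<open>A = {z. |F z| \<le> s < |z|}\<close>, then the sets \<open>F\<^sup>-\<^sup>m A\<close> are
  disjoint, so \<open>d\<^sub>m = \<integral> \<delta>\<^sub>F d\<lambda>\<close> over \<open>F\<^sup>-\<^sup>m A\<close> is summable in \<open>m\<close>. The inequality above and an induction on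
  \<open>J\<close> give
  \<open>\<integral> min 1 (\<Sum>j<J. \<delta>\<^sub>F (F\<^sup>j w)) d\<lambda> \<le> 3 (\<Sum>j<J. d\<^sub>(\<^sub>m\<^sub>-\<^sub>j\<^sub>))\<close>, the integral being over \<open>F\<^sup>-\<^sup>m A\<close>. For \<open>J = m - N\<close>
  the right side is at most a tail of \<open>\<Sum> d\<^sub>m\<close>, whatever \<open>m\<close> is, so the estimate survives the limit that
  defines \<open>\<xi>\<close>: the orbits in \<open>A\<close> at time \<open>-k\<close> whose distortion before time \<open>-k-N\<close> is at least 1 have small
  \<open>\<xi>\<close>-measure for large \<open>N\<close>. Hence the orbits in \<open>A\<close> at time \<open>-k\<close> with infinite distortion form a null set.
  As \<open>F\<close> is not a rotation, \<open>|F z| < |z|\<close> for \<open>z \<noteq> 0\<close>, and the sets \<open>A\<close> with rational \<open>s\<close> cover the punctured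
  disk, so countably many null sets contain all orbits of infinite distortion.

  Finally \<open>q\<close> is multiplicative along orbits, so that \<open>\<delta>\<close> of an iterate is at most the sum of the
  distortions of the single steps, and finite distortion implies asymptotic linearity
  (\<open>linear_distortion_funpow_le\<close>).
\<close>

section \<open>The Schwarz-Pick inequality of first and second order\<close>

text \<open>
  The Schwarz lemma with \<open>\<le>\<close> in place of \<open><\<close>, which the quotients below require since they may be
  unimodular constants; it follows by scaling \<open>f\<close> by factors below 1.
\<close>
lemma schwarz_quotient:
  assumes f: "f holomorphic_on ball 0 1" and le: "\<And>z. z \<in> ball 0 1 \<Longrightarrow> norm (f z) \<le> 1" and "f 0 = 0"
  obtains g where "g holomorphic_on ball 0 1" "\<And>z. z \<in> ball 0 1 \<Longrightarrow> f z = z * g z"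
    "\<And>z. z \<in> ball 0 1 \<Longrightarrow> norm (g z) \<le> (1::real)"
proof -
  obtain g where g: "g holomorphic_on ball 0 1" "\<And>z. norm z < 1 \<Longrightarrow> f z = z * g z" "deriv f 0 = g 0"
    using Schwarz3[OF f \<open>f 0 = 0\<close>] by metis
  have "norm (g z) \<le> 1" if z: "z \<in> ball 0 1" for z
  proof (rule field_le_mult_one_interval)
    fix t :: real assume t: "0 < t" "t < 1"
    have hol: "(\<lambda>z. of_real t * f z) holomorphic_on ball 0 1"
      using f by (intro holomorphic_intros)
    have lt: "norm (of_real t * f z) < 1" if "norm z < 1" for z
    proof -
      have "norm (of_real t * f z) \<le> t * 1"
        unfolding norm_mult using le[of z] that t by (intro mult_mono) auto
      then show ?thesis using t by simp
    qed
    have *: "norm (of_real t * f z) \<le> norm z" "norm (deriv (\<lambda>z. of_real t * f z) 0) \<le> 1"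
      using Schwarz_Lemma(1,2)[OF hol _ lt, of z] z \<open>f 0 = 0\<close> by auto
    have d: "f field_differentiable at 0"
      using f by (simp add: holomorphic_on_imp_differentiable_at)
    show "t * norm (g z) \<le> 1"
    proof (cases "z = 0")
      case True
      then show ?thesis using * d g(3) t by (simp add: norm_mult)
    next
      case False
      then show ?thesis using *(1) g(2)[of z] z t by (simp add: norm_mult)
    qed
  qed
  then show ?thesis using that g by simp
qed

text \<open>
  A zero in the disk can be divided out by a Blaschke factor without increasing the bound: precompose
  with the disk automorphism that moves the zero to 0.
\<close>
lemma blaschke_quotient:
  assumes f: "f holomorphic_on ball 0 1" and le: "\<And>z. z \<in> ball 0 1 \<Longrightarrow> norm (f z) \<le> 1"
    and w: "w \<in> ball 0 1" and "f w = 0"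
  obtains g where "g holomorphic_on ball 0 1"
    "\<And>z. z \<in> ball 0 1 \<Longrightarrow> f z * (1 - cnj w * z) = g z * (z - w)"
    "\<And>z. z \<in> ball 0 1 \<Longrightarrow> norm (g z) \<le> (1::real)"
proof -
  have ne: "1 - cnj w * z \<noteq> 0" "1 + cnj w * z \<noteq> 0" if "z \<in> ball 0 1" for z
  proof -
    have "norm (cnj w * z) < 1 * 1"
      unfolding norm_mult using w that by (intro mult_strict_mono') auto
    then show "1 - cnj w * z \<noteq> 0" "1 + cnj w * z \<noteq> 0"
      by (metis complex_cnj_cnj less_irrefl mult_1 norm_one right_minus_eq,
          metis add_eq_0_iff less_irrefl mult_1 norm_minus_cancel norm_one)
  qed
  let ?m = "Moebius_function 0 (-w)" and ?n = "Moebius_function 0 w"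
  have m: "?m z \<in> ball 0 1" "?n z \<in> ball 0 1" if "z \<in> ball 0 1" for z
    using that w by (auto intro!: Moebius_function_norm_lt_1)
  have mh: "?m holomorphic_on ball 0 1" "?n holomorphic_on ball 0 1"
    using w by (auto intro!: Moebius_function_holomorphic)
  have mn: "?m (?n z) = z" if "z \<in> ball 0 1" for z
    using that w by (intro Moebius_function_compose) auto
  have fm: "(f \<circ> ?m) holomorphic_on ball 0 1"
    using m by (intro holomorphic_on_compose_gen[OF mh(1) f]) auto
  have 1: "norm ((f \<circ> ?m) z) \<le> 1" if "z \<in> ball 0 1" for z
    using le m that by simp
  have 2: "(f \<circ> ?m) 0 = 0"
    using \<open>f w = 0\<close> by (simp add: Moebius_function_of_zero)
  obtain k where k: "k holomorphic_on ball 0 1" "\<And>z. z \<in> ball 0 1 \<Longrightarrow> f (?m z) = z * k z"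
    "\<And>z. z \<in> ball 0 1 \<Longrightarrow> norm (k z) \<le> (1::real)"
    using schwarz_quotient[OF fm 1 2] by auto
  show ?thesis
  proof (rule that)
    show "(k \<circ> ?n) holomorphic_on ball 0 1"
      using m by (intro holomorphic_on_compose_gen[OF mh(2) k(1)]) auto
    show "norm ((k \<circ> ?n) z) \<le> 1" if "z \<in> ball 0 1" for z
      using k m that by simp
    show "f z * (1 - cnj w * z) = (k \<circ> ?n) z * (z - w)" if z: "z \<in> ball 0 1" for z
    proof -
      have "f z = ?n z * k (?n z)"
        using k(2)[OF m(2)[OF z]] mn[OF z] by simp
      then show ?thesis
        using ne[OF z] by (simp add: Moebius_function_simple)
    qed
  qed
qed

text \<open>
  Both claims say that disk automorphisms map the closed disk to itself, by the identity
  \<open>|1 - w\<^sup>* z|\<^sup>2 - |z - w|\<^sup>2 = (1 - |w|\<^sup>2) (1 - |z|\<^sup>2)\<close>.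
\<close>
lemma norm_denominator_ge:
  assumes "norm w < 1" "norm (z::complex) \<le> 1"
  shows "1 - cnj w * z \<noteq> 0" "norm (z - w) \<le> norm (1 - cnj w * z)"
proof -
  have "norm (cnj w * z) < 1"
    using assms mult_left_le[of "norm z" "norm w"] by (simp add: norm_mult)
  then show "1 - cnj w * z \<noteq> 0"
    by (metis less_irrefl norm_one right_minus_eq)
  have "(norm (1 - cnj w * z))\<^sup>2 - (norm (z - w))\<^sup>2 = (1 - (norm w)\<^sup>2) * (1 - (norm z)\<^sup>2)"
    unfolding cmod_power2 by (simp add: algebra_simps power2_eq_square)
  moreover have "\<dots> \<ge> 0"
    using assms by (intro mult_nonneg_nonneg) (auto simp: abs_square_le_1)
  ultimately have "(norm (z - w))\<^sup>2 \<le> (norm (1 - cnj w * z))\<^sup>2"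
    by linarith
  then show "norm (z - w) \<le> norm (1 - cnj w * z)"
    by (rule power2_le_imp_le) simp
qed

text \<open>
  The hyperbolic difference quotient of \<open>F\<close> at \<open>a\<close>. Its value at \<open>a\<close> is the hyperbolic derivative of \<open>F\<close>
  up to rotation, and as a self-map of the closed disk it obeys the Schwarz-Pick inequality itself,
  which is how bounds on second derivatives arise.
\<close>
lemma schwarz_pick_quotient:
  assumes F: "F holomorphic_on ball 0 1" and le: "\<And>z. z \<in> ball 0 1 \<Longrightarrow> norm (F z) \<le> 1"
    and a: "a \<in> ball 0 1" and Fa: "norm (F a) < (1::real)"
  obtains G where "G holomorphic_on ball 0 1"
    "\<And>z. z \<in> ball 0 1 \<Longrightarrow> (F z - F a) * (1 - cnj a * z) = G z * (z - a) * (1 - cnj (F a) * F z)"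
    "\<And>z. z \<in> ball 0 1 \<Longrightarrow> norm (G z) \<le> (1::real)"
proof -
  have ne: "1 - cnj (F a) * F z \<noteq> 0" and le': "norm (F z - F a) \<le> norm (1 - cnj (F a) * F z)"
    if "z \<in> ball 0 1" for z
    using norm_denominator_ge[of "F a" "F z"] le[OF that] Fa by auto
  let ?f = "\<lambda>z. (F z - F a) / (1 - cnj (F a) * F z)"
  have "?f holomorphic_on ball 0 1"
    using ne F by (intro holomorphic_intros) auto
  moreover have "norm (?f z) \<le> 1" if "z \<in> ball 0 1" for z
    using ne[OF that] le'[OF that] by (simp add: norm_divide divide_le_eq_1)
  ultimately obtain G where G: "G holomorphic_on ball 0 1"
    "\<And>z. z \<in> ball 0 1 \<Longrightarrow> ?f z * (1 - cnj a * z) = G z * (z - a)"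
    "\<And>z. z \<in> ball 0 1 \<Longrightarrow> norm (G z) \<le> (1::real)"
    using blaschke_quotient[of ?f a] a by auto
  show ?thesis
  proof (rule that[OF G(1) _ G(3)])
    show "(F z - F a) * (1 - cnj a * z) = G z * (z - a) * (1 - cnj (F a) * F z)"
      if "z \<in> ball 0 1" for z
      using G(2)[OF that] ne[OF that] by (simp add: divide_simps)
  qed
qed

text \<open>
  Taylor coefficients of the defining identity of the quotient at \<open>a\<close>. The common factor \<open>z - a\<close> is
  cancelled first, so that the second coefficient only takes one differentiation.
\<close>
lemma schwarz_pick_quotient_expand:
  assumes F: "F holomorphic_on ball 0 1" and G: "G holomorphic_on ball 0 1" and a: "a \<in> ball 0 1"
    and eq: "\<And>z. z \<in> ball 0 1 \<Longrightarrow>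
      (F z - F a) * (1 - cnj a * z) = G z * (z - a) * (1 - cnj (F a) * F z)"
  shows "deriv F a * of_real (1 - (norm a)\<^sup>2) = G a * of_real (1 - (norm (F a))\<^sup>2)"
    and "deriv (deriv F) a / 2 * of_real (1 - (norm a)\<^sup>2) - cnj a * deriv F a
       = deriv G a * of_real (1 - (norm (F a))\<^sup>2) - G a * cnj (F a) * deriv F a"
proof -
  \<comment> \<open>the ordinary difference quotient; \<open>deriv (deriv F) a = 2 * deriv K a\<close>\<close>
  define K where "K z = (if z = a then deriv F a else (F z - F a) / (z - a))" for z
  have K: "K holomorphic_on ball 0 1"
    using pole_lemma_open[OF F open_ball, of a] unfolding K_def .
  have FK: "F z = F a + (z - a) * K z" for z
    by (simp add: K_def)
  note D = holomorphic_derivI[OF F open_ball] holomorphic_derivI[OF G open_ball] holomorphic_derivI[OF K open_ball]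
  have eqK: "K z * (1 - cnj a * z) = G z * (1 - cnj (F a) * F z)" if "z \<in> ball 0 1" for z
  proof -
    have 1: "continuous_on (ball 0 1) (\<lambda>z. K z * (1 - cnj a * z) - G z * (1 - cnj (F a) * F z))"
      using holomorphic_on_imp_continuous_on[OF F] holomorphic_on_imp_continuous_on[OF G]
        holomorphic_on_imp_continuous_on[OF K] by (intro continuous_intros)
    have 2: "K z * (1 - cnj a * z) - G z * (1 - cnj (F a) * F z) = 0" if "z \<in> ball 0 1" "z \<noteq> a" for z
      using eq[OF that(1)] that(2) by (simp add: K_def field_simps)
    show ?thesis
    proof (cases "z = a")
      case False then show ?thesis using 2 that by simp
    next
      case True
      let ?g = "\<lambda>z. K z * (1 - cnj a * z) - G z * (1 - cnj (F a) * F z)"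
      have "isCont ?g a"
        using 1 a continuous_on_eq_continuous_at open_ball by blast
      then have "(?g \<longlongrightarrow> ?g a) (at a)" by (simp add: isCont_def)
      moreover have "eventually (\<lambda>z. z \<in> ball 0 1 - {a}) (at a)"
        using a by (intro eventually_at_in_open) auto
      then have "eventually (\<lambda>z. ?g z = 0) (at a)"
        by eventually_elim (use 2 in auto)
      then have "(?g \<longlongrightarrow> 0) (at a)"
        by (rule tendsto_eventually)
      ultimately have "?g a = 0"
        using tendsto_unique[OF trivial_limit_at] by blast
      then show ?thesis using True by simp
    qed
  qed
  have n: "a * cnj a = of_real ((norm a)\<^sup>2)" "F a * cnj (F a) = of_real ((norm (F a))\<^sup>2)"
    by (simp_all only: complex_norm_square)
  have Ka: "K a = deriv F a" by (simp add: K_def)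
  show "deriv F a * of_real (1 - (norm a)\<^sup>2) = G a * of_real (1 - (norm (F a))\<^sup>2)"
    using eqK[OF a] n Ka by (simp add: mult.commute)
  have F': "deriv F z = K z + (z - a) * deriv K z" if "z \<in> ball 0 1" for z
  proof (rule DERIV_unique[OF D(1)[OF that]])
    show "(F has_field_derivative K z + (z - a) * deriv K z) (at z)"
    proof (rule has_field_derivative_transform_within_open[OF _ open_ball that])
      show "((\<lambda>z. F a + (z - a) * K z) has_field_derivative K z + (z - a) * deriv K z) (at z)"
        using that by (auto intro!: derivative_eq_intros D)
    qed (rule FK[symmetric])
  qed
  have K2: "(deriv K has_field_derivative deriv (deriv K) a) (at a)"
    using holomorphic_derivI[OF holomorphic_deriv[OF K open_ball] open_ball a] .
  have "(deriv F has_field_derivative 2 * deriv K a) (at a)"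
  proof (rule has_field_derivative_transform_within_open[OF _ open_ball a])
    show "((\<lambda>z. K z + (z - a) * deriv K z) has_field_derivative 2 * deriv K a) (at a)"
      using a by (auto intro!: derivative_eq_intros D K2)
  qed (simp add: F')
  then have F2: "deriv (deriv F) a = 2 * deriv K a"
    by (rule DERIV_imp_deriv)
  have "((\<lambda>z. K z * (1 - cnj a * z)) has_field_derivative
      deriv K a * (1 - cnj a * a) - cnj a * K a) (at a)"
    using a by (auto intro!: derivative_eq_intros D)
  moreover have "((\<lambda>z. K z * (1 - cnj a * z)) has_field_derivative
      deriv G a * (1 - cnj (F a) * F a) - cnj (F a) * deriv F a * G a) (at a)"
  proof (rule has_field_derivative_transform_within_open[OF _ open_ball a])
    show "((\<lambda>z. G z * (1 - cnj (F a) * F z)) has_field_derivative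
      deriv G a * (1 - cnj (F a) * F a) - cnj (F a) * deriv F a * G a) (at a)"
      using a by (auto intro!: derivative_eq_intros D)
  qed (simp add: eqK)
  ultimately have "deriv K a * (1 - cnj a * a) - cnj a * K a =
      deriv G a * (1 - cnj (F a) * F a) - cnj (F a) * deriv F a * G a"
    by (rule DERIV_unique)
  then show "deriv (deriv F) a / 2 * of_real (1 - (norm a)\<^sup>2) - cnj a * deriv F a
       = deriv G a * of_real (1 - (norm (F a))\<^sup>2) - G a * cnj (F a) * deriv F a"
    using n F2 Ka by (simp add: mult.commute mult.left_commute)
qed

text \<open>
  If \<open>|F a| < 1\<close>, this is the first coefficient of the quotient. For \<open>|F a| = 1\<close> it follows by applying
  this to multiples of \<open>F\<close> with factors below 1.
\<close>
lemma schwarz_pick: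
  assumes F: "F holomorphic_on ball 0 1" and le: "\<And>z. z \<in> ball 0 1 \<Longrightarrow> norm (F z) \<le> (1::real)"
    and a: "a \<in> ball 0 1"
  shows "norm (deriv F a) * (1 - (norm a)\<^sup>2) \<le> 1 - (norm (F a))\<^sup>2"
proof -
  have strict: "norm (deriv F a) * (1 - (norm a)\<^sup>2) \<le> 1 - (norm (F a))\<^sup>2"
    if F: "F holomorphic_on ball 0 1" and le: "\<And>z. z \<in> ball 0 1 \<Longrightarrow> norm (F z) \<le> (1::real)"
    and Fa: "norm (F a) < (1::real)" for F
  proof -
    obtain G where G: "G holomorphic_on ball 0 1"
      "\<And>z. z \<in> ball 0 1 \<Longrightarrow> (F z - F a) * (1 - cnj a * z) = G z * (z - a) * (1 - cnj (F a) * F z)"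
      "\<And>z. z \<in> ball 0 1 \<Longrightarrow> norm (G z) \<le> (1::real)"
      using schwarz_pick_quotient[OF F le a Fa] by blast
    have 1: "deriv F a * of_real (1 - (norm a)\<^sup>2) = G a * of_real (1 - (norm (F a))\<^sup>2)"
      by (rule schwarz_pick_quotient_expand(1)[OF F G(1) a G(2)])
    have p: "1 - (norm a)\<^sup>2 \<ge> 0" "1 - (norm (F a))\<^sup>2 \<ge> 0"
      using a Fa by (auto simp: abs_square_le_1)
    have "norm (deriv F a) * (1 - (norm a)\<^sup>2) = norm (G a) * (1 - (norm (F a))\<^sup>2)"
      using arg_cong[OF 1, of norm] p unfolding norm_mult norm_of_real by simp
    also have "\<dots> \<le> 1 * (1 - (norm (F a))\<^sup>2)"
      using G(3)[OF a] p by (intro mult_right_mono) auto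
    finally show ?thesis by simp
  qed
  have scaled: "t * (norm (deriv F a) * (1 - (norm a)\<^sup>2)) \<le> 1 - (t * norm (F a))\<^sup>2"
    if t: "0 < t" "t < 1" for t
  proof -
    have lt: "norm (of_real t * F z) \<le> t" if "z \<in> ball 0 1" for z
      unfolding norm_mult using le[OF that] t by (simp add: mult_left_le)
    have "norm (deriv (\<lambda>z. of_real t * F z) a) * (1 - (norm a)\<^sup>2) \<le> 1 - (norm (of_real t * F a))\<^sup>2"
    proof (rule strict)
      show "(\<lambda>z. of_real t * F z) holomorphic_on ball 0 1"
        using F by (intro holomorphic_intros)
      show "norm (of_real t * F z) \<le> 1" if "z \<in> ball 0 1" for z
        using lt[OF that] t by simp
      show "norm (of_real t * F a) < 1"
        using lt[OF a] t by simp
    qed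
    moreover have "F field_differentiable at a"
      using F a by (simp add: holomorphic_on_imp_differentiable_at)
    ultimately show ?thesis
      using t by (simp add: norm_mult mult.assoc)
  qed
  show ?thesis
  proof (rule tendsto_le)
    show "at_left (1::real) \<noteq> bot" by simp
    show "((\<lambda>t. 1 - (t * norm (F a))\<^sup>2) \<longlongrightarrow> 1 - (norm (F a))\<^sup>2) (at_left 1)"
      by (auto intro!: tendsto_eq_intros)
    show "((\<lambda>t. t * (norm (deriv F a) * (1 - (norm a)\<^sup>2))) \<longlongrightarrow>
        norm (deriv F a) * (1 - (norm a)\<^sup>2)) (at_left 1)"
      by (auto intro!: tendsto_eq_intros)
    show "\<forall>\<^sub>F t in at_left 1. t * (norm (deriv F a) * (1 - (norm a)\<^sup>2)) \<le> 1 - (t * norm (F a))\<^sup>2"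
      using eventually_at_left_real[OF zero_less_one] by eventually_elim (auto intro!: scaled)
  qed
qed

text \<open>
  The Schwarz-Pick inequality for the hyperbolic difference quotient. After composition with disk
  automorphisms taking \<open>a\<close> and \<open>F a\<close> to 0, it becomes the bound \<open>|f'' 0| / 2 \<le> 1 - |f' 0|\<^sup>2\<close> for
  self-maps with \<open>f 0 = 0\<close>. It bounds how fast the image of a geodesic through \<open>a\<close> bends there.
\<close>
lemma second_order_schwarz_pick:
  assumes F: "F holomorphic_on ball 0 1" and lt: "\<And>z. z \<in> ball 0 1 \<Longrightarrow> norm (F z) < (1::real)"
    and a: "a \<in> ball 0 1"
  defines "h \<equiv> deriv F a * of_real ((1 - (norm a)\<^sup>2) / (1 - (norm (F a))\<^sup>2))"
  shows "norm ((deriv (deriv F) a / 2 * of_real (1 - (norm a)\<^sup>2) - cnj a * deriv F a) *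
      of_real ((1 - (norm a)\<^sup>2) / (1 - (norm (F a))\<^sup>2)) + h\<^sup>2 * cnj (F a)) \<le> 1 - (norm h)\<^sup>2"
    (is "norm ?c \<le> _")
proof -
  have le: "norm (F z) \<le> 1" if "z \<in> ball 0 1" for z using lt[OF that] by simp
  obtain G where G: "G holomorphic_on ball 0 1"
    "\<And>z. z \<in> ball 0 1 \<Longrightarrow> (F z - F a) * (1 - cnj a * z) = G z * (z - a) * (1 - cnj (F a) * F z)"
    "\<And>z. z \<in> ball 0 1 \<Longrightarrow> norm (G z) \<le> (1::real)"
    using schwarz_pick_quotient[OF F le a lt[OF a]] by blast
  define s where "s = 1 - (norm a)\<^sup>2"
  define t where "t = 1 - (norm (F a))\<^sup>2"
  have p: "s > 0" "t > 0"
    using a lt[OF a] by (auto simp: s_def t_def abs_square_less_1)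
  note E = schwarz_pick_quotient_expand[OF F G(1) a G(2), folded s_def t_def]
  have h: "h = G a"
    using E(1) p by (simp add: h_def s_def[symmetric] t_def[symmetric] field_simps)
  have h': "deriv F a * of_real s = h * of_real t"
    using E(1) h by simp
  have "?c = (deriv G a * of_real t - h * cnj (F a) * deriv F a) * of_real (s / t) + h\<^sup>2 * cnj (F a)"
    using E(2) h by (simp add: s_def t_def)
  also have "\<dots> = deriv G a * of_real s"
  proof -
    have "h * cnj (F a) * deriv F a * of_real (s / t) = h * cnj (F a) * (deriv F a * of_real s) / of_real t"
      by simp
    also have "\<dots> = h\<^sup>2 * cnj (F a)"
      unfolding h' using p by (simp add: power2_eq_square)
    finally show ?thesis
      unfolding left_diff_distrib using p by simp
  qed
  finally have "norm ?c = norm (deriv G a) * s"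
    using p by (simp add: norm_mult)
  also have "\<dots> \<le> 1 - (norm h)\<^sup>2"
    unfolding s_def h by (rule schwarz_pick[OF G(1,3) a])
  finally show ?thesis .
qed

section \<open>Change of variables for injective holomorphic functions\<close>

lemma pred_in_disk [measurable (raw)]:
  assumes "f \<in> borel_measurable M"
  shows "Measurable.pred M (\<lambda>x. f x \<in> ball (0::complex) 1)"
  using assms unfolding mem_ball_0 by measurable

text \<open>
  This function and its inverse are isometries; they transfer the change of variables theorem from
  \<^typ>\<open>real^2\<close> to \<^typ>\<open>complex\<close>.
\<close>
definition complex_of_vec :: "real^2 \<Rightarrow> complex" where
  "complex_of_vec v = Complex (v$1) (v$2)"

definition vec_of_complex :: "complex \<Rightarrow> real^2" where
  "vec_of_complex z = vector [Re z, Im z]"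

lemma vec_complex_inverse [simp]:
  "complex_of_vec (vec_of_complex z) = z" "vec_of_complex (complex_of_vec v) = v"
  by (simp_all add: complex_of_vec_def vec_of_complex_def vec_eq_iff forall_2)

lemma bounded_linear_vec_of_complex: "bounded_linear vec_of_complex"
proof (rule linear_linear[THEN iffD2])
  show "linear vec_of_complex"
    by (rule linearI) (simp_all add: vec_of_complex_def vec_eq_iff forall_2)
qed

lemma bounded_linear_complex_of_vec: "bounded_linear complex_of_vec"
proof (rule linear_linear[THEN iffD2])
  show "linear complex_of_vec"
    by (rule linearI) (simp_all add: complex_of_vec_def complex_eq_iff)
qed

lemma measurable_complex_of_vec [measurable]: "complex_of_vec \<in> borel_measurable borel"
  by (intro borel_measurable_continuous_onI linear_continuous_on bounded_linear_complex_of_vec)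

lemma lborel_complex_eq_distr: "(lborel :: complex measure) = distr lborel borel complex_of_vec"
proof (rule lborel_eqI)
  fix l u :: complex assume lu: "\<And>b. b \<in> Basis \<Longrightarrow> l \<bullet> b \<le> u \<bullet> b"
  have le: "Re l \<le> Re u" "Im l \<le> Im u"
    using lu[of 1] lu[of \<i>] by (simp_all add: Basis_complex_def)
  have eq: "complex_of_vec -` box l u = box (vec_of_complex l) (vec_of_complex u)"
    by (auto simp: complex_of_vec_def vec_of_complex_def in_box_complex_iff mem_box_cart forall_2)
  have B: "(Basis :: (real^2) set) = {axis 1 1, axis 2 1}"
    by (auto simp: Basis_vec_def UNIV_2)
  have ne: "axis 1 1 \<noteq> (axis 2 1 :: real^2)" by (simp add: axis_eq_axis)
  have "emeasure (distr lborel borel complex_of_vec) (box l u)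
      = emeasure lborel (box (vec_of_complex l) (vec_of_complex u))"
    by (subst emeasure_distr) (auto simp: eq)
  also have "\<dots> = (\<Prod>b\<in>Basis. (vec_of_complex u - vec_of_complex l) \<bullet> b)"
    using le by (subst emeasure_lborel_box) (auto simp: B vec_of_complex_def inner_axis)
  also have "\<dots> = (\<Prod>b\<in>Basis. (u - l) \<bullet> b)"
    using ne unfolding B by (simp add: Basis_complex_def vec_of_complex_def inner_axis)
  finally show "emeasure (distr lborel borel complex_of_vec) (box l u) = (\<Prod>b\<in>Basis. (u - l) \<bullet> b)" .
qed simp

lemma nn_integral_lborel_complex:
  assumes [measurable]: "f \<in> borel_measurable borel"
  shows "(\<integral>\<^sup>+z. f z \<partial>(lborel :: complex measure)) = (\<integral>\<^sup>+v. f (complex_of_vec v) \<partial>lborel)"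
  by (subst lborel_complex_eq_distr, subst nn_integral_distr) auto

lemma emeasure_lborel_complex:
  assumes [measurable]: "A \<in> sets borel"
  shows "emeasure (lborel :: complex measure) A = emeasure lborel (complex_of_vec -` A)"
  by (subst lborel_complex_eq_distr, subst emeasure_distr) auto

lemma det_complex_mult:
  "det (matrix (\<lambda>v. vec_of_complex (c * complex_of_vec v))) = (norm c)\<^sup>2"
  unfolding cmod_power2
  by (simp add: det_2 matrix_def vec_of_complex_def complex_of_vec_def axis_def power2_eq_square)

text \<open>
  The Jacobian determinant of a holomorphic function is the squared modulus of its derivative. Both
  sides may be infinite; each is finite if the other is.
\<close>
lemma emeasure_image_injective_holomorphic:
  fixes f :: "complex \<Rightarrow> complex"
  assumes f: "f holomorphic_on U" "open U" "inj_on f U" and S: "S \<subseteq> U"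
    and [measurable]: "S \<in> sets borel" "f ` S \<in> sets borel"
    and meas: "(\<lambda>w. (norm (deriv f w))\<^sup>2 * indicator S w) \<in> borel_measurable borel"
  shows "emeasure lborel (f ` S) = (\<integral>\<^sup>+w. ennreal ((norm (deriv f w))\<^sup>2) * indicator S w \<partial>lborel)"
proof -
  define S' where "S' = complex_of_vec -` S"
  define g where "g = vec_of_complex \<circ> f \<circ> complex_of_vec"
  define J where "J v = (norm (deriv f (complex_of_vec v)))\<^sup>2" for v
  have [measurable]: "S' \<in> sets borel"
    using measurable_sets[OF measurable_complex_of_vec, of S] by (simp add: S'_def)
  have img: "g ` S' = complex_of_vec -` (f ` S)"
  proof (intro set_eqI iffI)
    fix v assume "v \<in> complex_of_vec -` (f ` S)"
    then obtain w where "w \<in> S" "complex_of_vec v = f w" by auto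
    then have "v = g (vec_of_complex w)" "vec_of_complex w \<in> S'"
      by (simp_all add: g_def S'_def) (metis vec_complex_inverse(2))
    then show "v \<in> g ` S'" by blast
  qed (auto simp: g_def S'_def)
  have img_meas: "g ` S' \<in> sets borel"
    using measurable_sets[OF measurable_complex_of_vec, of "f ` S"] by (simp add: img)
  have inj: "inj_on g S'"
  proof (rule inj_onI)
    fix v w assume "v \<in> S'" "w \<in> S'" "g v = g w"
    then have "f (complex_of_vec v) = f (complex_of_vec w)"
      by (metis comp_apply g_def vec_complex_inverse(1))
    then have "complex_of_vec v = complex_of_vec w"
      using f(3) S \<open>v \<in> S'\<close> \<open>w \<in> S'\<close> by (auto simp: S'_def dest: inj_onD)
    then show "v = w" by (metis vec_complex_inverse(2))
  qed
  have der: "(g has_derivative (\<lambda>h. vec_of_complex (deriv f (complex_of_vec v) * complex_of_vec h))) (at v within S')"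
    if "v \<in> S'" for v
  proof -
    have "(f has_field_derivative deriv f (complex_of_vec v)) (at (complex_of_vec v))"
      using that S f by (auto simp: S'_def intro!: holomorphic_derivI)
    then have "(f has_derivative (*) (deriv f (complex_of_vec v))) (at (complex_of_vec v))"
      by (simp add: has_field_derivative_def)
    then have "(f has_derivative (*) (deriv f (complex_of_vec v))) (at (complex_of_vec v) within complex_of_vec ` S')"
      by (rule has_derivative_at_withinI)
    from diff_chain_within[OF bounded_linear_imp_has_derivative[OF bounded_linear_complex_of_vec] this]
    have "((f \<circ> complex_of_vec) has_derivative (\<lambda>h. deriv f (complex_of_vec v) * complex_of_vec h)) (at v within S')"
      by (simp add: o_def)
    from bounded_linear.has_derivative[OF bounded_linear_vec_of_complex this]
    show ?thesis by (simp add: g_def o_def)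
  qed
  have key: "g ` S' \<in> lmeasurable \<and> measure lebesgue (g ` S') = m \<longleftrightarrow> (J has_integral m) S'" for m
    using has_measure_differentiable_image[OF _ der inj, of m] by (simp add: det_complex_mult J_def[abs_def])
  have e1: "emeasure lborel (f ` S) = emeasure lborel (g ` S')"
    by (simp add: emeasure_lborel_complex img)
  have J_meas: "(\<lambda>w. ennreal ((norm (deriv f w))\<^sup>2) * indicator S w) \<in> borel_measurable borel"
  proof -
    have "(\<lambda>w. ennreal ((norm (deriv f w))\<^sup>2 * indicator S w)) \<in> borel_measurable borel"
      using meas by measurable
    moreover have "(\<lambda>w. ennreal ((norm (deriv f w))\<^sup>2 * indicator S w)) = (\<lambda>w. ennreal ((norm (deriv f w))\<^sup>2) * indicator S w)"
      by (auto simp: indicator_def fun_eq_iff)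
    ultimately show ?thesis by (simp only:)
  qed
  have e2: "(\<integral>\<^sup>+w. ennreal ((norm (deriv f w))\<^sup>2) * indicator S w \<partial>lborel) = (\<integral>\<^sup>+v. ennreal (J v) * indicator S' v \<partial>lborel)"
    unfolding nn_integral_lborel_complex[OF J_meas] by (simp add: J_def S'_def indicator_def)
  show ?thesis
  proof (cases "(\<integral>\<^sup>+v. ennreal (J v) * indicator S' v \<partial>lborel) < \<infinity>")
    case True
    define m where "m = enn2real (\<integral>\<^sup>+v. ennreal (J v) * indicator S' v \<partial>lborel)"
    have Jm: "(\<lambda>v. J v * indicator S' v) \<in> borel_measurable borel"
      using measurable_compose[OF measurable_complex_of_vec meas] by (simp add: J_def S'_def indicator_def)
    have "((\<lambda>v. J v * indicator S' v) has_integral m) UNIV"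
    proof (rule nn_integral_has_integral)
      show "(\<lambda>v. J v * indicator S' v) \<in> borel_measurable borel" by (rule Jm)
      show "0 \<le> J v * indicator S' v" for v by (simp add: J_def)
      show "(\<integral>\<^sup>+v. ennreal (J v * indicator S' v) \<partial>lborel) = ennreal m"
        using True by (auto simp: m_def indicator_def intro!: nn_integral_cong)
    qed (simp add: m_def)
    moreover have "(\<lambda>v. J v * indicator S' v) = (\<lambda>v. if v \<in> S' then J v else 0)"
      by (auto simp: fun_eq_iff)
    ultimately have "(J has_integral m) S'"
      by (simp only: has_integral_restrict_UNIV)
    then have "g ` S' \<in> lmeasurable" "measure lebesgue (g ` S') = m"
      using key[of m] by auto
    then have "emeasure lebesgue (g ` S') = ennreal m"
      by (simp add: emeasure_eq_measure2 fmeasurableD2)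
    then have "emeasure lborel (g ` S') = ennreal m"
      using img_meas by simp
    then show ?thesis using e1 e2 True by (simp add: m_def)
  next
    case False
    have "\<not> emeasure lborel (g ` S') < \<infinity>"
    proof
      assume "emeasure lborel (g ` S') < \<infinity>"
      then have "g ` S' \<in> lmeasurable" using img_meas by (auto simp: fmeasurable_def)
      then have "(J has_integral measure lebesgue (g ` S')) S'" using key by blast
      then have "(\<integral>\<^sup>+v. ennreal (J v) * indicator S' v \<partial>lborel) = ennreal (measure lebesgue (g ` S'))"
        by (rule nn_integral_has_integral_lebesgue'[rotated]) (simp add: J_def)
      then show False using False by simp
    qed
    then show ?thesis using e1 e2 False by (simp add: less_top[symmetric])
  qed
qed

text \<open>
  The image under \<open>f\<close> of the measure with density \<open>|f'|\<^sup>2\<close> on \<open>U\<close> is Lebesgue measure on \<open>f ` U\<close>.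
\<close>
theorem nn_integral_injective_holomorphic:
  fixes f :: "complex \<Rightarrow> complex"
  assumes f: "f holomorphic_on U" "open U" "inj_on f U" and h[measurable]: "h \<in> borel_measurable borel"
  shows "(\<integral>\<^sup>+w. h (f w) * ennreal ((norm (deriv f w))\<^sup>2) * indicator U w \<partial>lborel)
       = (\<integral>\<^sup>+z. h z * indicator (f ` U) z \<partial>lborel)"
proof -
  define f0 where "f0 = (\<lambda>w. if w \<in> U then f w else 0)"
  define d0 where "d0 = (\<lambda>w. if w \<in> U then deriv f w else 0)"
  have [measurable]: "U \<in> sets borel" using f(2) by simp
  have imgU[measurable]: "f ` U \<in> sets borel"
    using open_mapping_thm3[OF f] by simp
  have [measurable]: "f0 \<in> borel_measurable borel" "d0 \<in> borel_measurable borel"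
    unfolding f0_def d0_def
    using holomorphic_on_imp_continuous_on[OF f(1)] f(2)
      holomorphic_on_imp_continuous_on[OF holomorphic_deriv[OF f(1,2)]]
    by (auto intro!: borel_measurable_continuous_on_if)
  let ?\<mu> = "density lborel (\<lambda>w. ennreal ((norm (d0 w))\<^sup>2) * indicator U w)"
  have "distr ?\<mu> borel f0 = density lborel (indicator (f ` U))"
  proof (rule measure_eqI)
    fix B assume "B \<in> sets (distr ?\<mu> borel f0)"
    then have [measurable]: "B \<in> sets borel" by simp
    define S where "S = U \<inter> f0 -` B"
    have [measurable]: "S \<in> sets borel"
      unfolding S_def using measurable_sets_borel[of f0 borel B] by auto
    have img: "f ` S = f ` U \<inter> B" by (auto simp: S_def f0_def)
    have "emeasure (distr ?\<mu> borel f0) B = emeasure ?\<mu> (f0 -` B)"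
      by (subst emeasure_distr) auto
    also have "\<dots> = (\<integral>\<^sup>+w. ennreal ((norm (d0 w))\<^sup>2) * indicator U w * indicator (f0 -` B) w \<partial>lborel)"
      using measurable_sets_borel[of f0 borel B] by (subst emeasure_density) auto
    also have "\<dots> = (\<integral>\<^sup>+w. ennreal ((norm (deriv f w))\<^sup>2) * indicator S w \<partial>lborel)"
      by (intro nn_integral_cong) (auto simp: S_def d0_def indicator_def)
    also have "\<dots> = emeasure lborel (f ` S)"
    proof (rule emeasure_image_injective_holomorphic[OF f, symmetric])
      have "(\<lambda>w. (norm (d0 w))\<^sup>2 * indicator S w) \<in> borel_measurable borel" by measurable
      then show "(\<lambda>w. (norm (deriv f w))\<^sup>2 * indicator S w) \<in> borel_measurable borel"
        by (rule measurable_cong[THEN iffD1, rotated]) (auto simp: S_def d0_def indicator_def)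
    qed (auto simp: img S_def[symmetric], auto simp: S_def)
    also have "\<dots> = emeasure (density lborel (indicator (f ` U))) B"
      unfolding img by (subst emeasure_density) (auto simp: indicator_inter_arith[symmetric])
    finally show "emeasure (distr ?\<mu> borel f0) B = emeasure (density lborel (indicator (f ` U))) B" .
  qed simp
  then have "(\<integral>\<^sup>+z. h z \<partial>distr ?\<mu> borel f0) = (\<integral>\<^sup>+z. h z \<partial>density lborel (indicator (f ` U)))"
    by simp
  moreover have "(\<integral>\<^sup>+z. h z \<partial>distr ?\<mu> borel f0) = (\<integral>\<^sup>+w. ennreal ((norm (d0 w))\<^sup>2) * indicator U w * h (f0 w) \<partial>lborel)"
    by (simp add: nn_integral_distr nn_integral_density)
  moreover have "\<dots> = (\<integral>\<^sup>+w. h (f w) * ennreal ((norm (deriv f w))\<^sup>2) * indicator U w \<partial>lborel)"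
    by (intro nn_integral_cong) (auto simp: f0_def d0_def indicator_def mult_ac)
  moreover have "(\<integral>\<^sup>+z. h z \<partial>density lborel (indicator (f ` U))) = (\<integral>\<^sup>+z. h z * indicator (f ` U) z \<partial>lborel)"
    by (subst nn_integral_density) (auto simp: mult.commute)
  ultimately show ?thesis by simp
qed


lemma nn_integral_lborel_complex_iterated:
  assumes f: "f \<in> borel_measurable borel"
  shows "(\<integral>\<^sup>+z. f z \<partial>(lborel :: complex measure)) = (\<integral>\<^sup>+y. \<integral>\<^sup>+x. f (Complex x y) \<partial>lborel \<partial>lborel)"
proof -
  have m[measurable]: "(\<lambda>p. Complex (snd p) (fst p)) \<in> borel_measurable (borel :: (real \<times> real) measure)"
    unfolding Complex_eq by (intro borel_measurable_continuous_onI continuous_intros)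
  have D: "(lborel :: complex measure) = distr (lborel :: (real \<times> real) measure) borel (\<lambda>p. Complex (snd p) (fst p))"
  proof (rule lborel_eqI)
    fix l u :: complex assume lu: "\<And>b. b \<in> Basis \<Longrightarrow> l \<bullet> b \<le> u \<bullet> b"
    have le: "Re l \<le> Re u" "Im l \<le> Im u"
      using lu[of 1] lu[of \<i>] by (simp_all add: Basis_complex_def)
    have eq: "(\<lambda>p. Complex (snd p) (fst p)) -` box l u = box (Im l) (Im u) \<times> box (Re l) (Re u)"
      by (auto simp: in_box_complex_iff box_real)
    show "emeasure (distr (lborel :: (real \<times> real) measure) borel (\<lambda>p. Complex (snd p) (fst p))) (box l u)
        = (\<Prod>b\<in>Basis. (u - l) \<bullet> b)"
      using le by (subst emeasure_distr[OF _ box_borel], (simp add: m)[1])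
        (simp add: eq lborel_prod[symmetric] lborel.emeasure_pair_measure_Times Basis_complex_def
          ennreal_mult[symmetric] mult.commute)
  qed simp
  have "(\<integral>\<^sup>+z. f z \<partial>(lborel :: complex measure)) = (\<integral>\<^sup>+p. f (Complex (snd p) (fst p)) \<partial>(lborel :: (real \<times> real) measure))"
    by (subst D, subst nn_integral_distr) (use f m in auto)
  also have "\<dots> = (\<integral>\<^sup>+p. f (Complex (snd p) (fst p)) \<partial>(lborel \<Otimes>\<^sub>M lborel))"
    by (simp add: lborel_prod)
  also have "\<dots> = (\<integral>\<^sup>+y. \<integral>\<^sup>+x. f (Complex x y) \<partial>lborel \<partial>lborel)"
  proof (subst lborel.nn_integral_fst[symmetric])
    show "(\<lambda>p. f (Complex (snd p) (fst p))) \<in> borel_measurable (lborel \<Otimes>\<^sub>M lborel)"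
      using measurable_compose[OF m f] by (simp add: lborel_prod)
  qed simp
  finally show ?thesis .
qed

text \<open>
  Substitution on \<open>{-n..n}\<close> gives the integral of \<open>k\<close> over \<open>{exp (-n)..exp n}\<close>; these intervals exhaust
  the positive axis only, whence the inequality.
\<close>
lemma nn_integral_exp_substitution_le:
  fixes k :: "real \<Rightarrow> ennreal"
  assumes [measurable]: "k \<in> borel_measurable borel"
  shows "(\<integral>\<^sup>+s. k (exp s) * ennreal (exp s) \<partial>lborel) \<le> (\<integral>\<^sup>+r. k r \<partial>lborel)"
proof -
  let ?I = "\<lambda>n::nat. {- real (Suc n)..real (Suc n)}"
  have "(SUP n. indicator (?I n) s :: ennreal) = 1" for s
  proof (rule antisym)
    obtain n where "\<bar>s\<bar> < real n" using reals_Archimedean2 by blast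
    then have "s \<in> ?I n" by auto
    then show "1 \<le> (SUP n. indicator (?I n) s :: ennreal)" by (intro SUP_upper2[of n]) auto
  qed (auto intro!: SUP_least simp: indicator_def)
  then have "(\<integral>\<^sup>+s. k (exp s) * ennreal (exp s) \<partial>lborel)
      = (\<integral>\<^sup>+s. (SUP n. k (exp s) * ennreal (exp s) * indicator (?I n) s) \<partial>lborel)"
    by (simp add: SUP_mult_left_ennreal[symmetric])
  also have "\<dots> = (SUP n. \<integral>\<^sup>+s. k (exp s) * ennreal (exp s) * indicator (?I n) s \<partial>lborel)"
    by (rule nn_integral_monotone_convergence_SUP)
       (auto simp: incseq_def le_fun_def indicator_def intro!: mult_left_mono)
  also have "\<dots> \<le> (\<integral>\<^sup>+r. k r \<partial>lborel)"
  proof (rule SUP_least)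
    fix n
    have "(\<integral>\<^sup>+s. k (exp s) * ennreal (exp s) * indicator (?I n) s \<partial>lborel)
        = (\<integral>\<^sup>+r. k r * indicator {exp (- real (Suc n))..exp (real (Suc n))} r \<partial>lborel)"
      by (rule nn_integral_substitution_aux[symmetric])
         (auto intro!: derivative_eq_intros continuous_intros)
    also have "\<dots> \<le> (\<integral>\<^sup>+r. k r \<partial>lborel)"
      by (intro nn_integral_mono) (auto simp: indicator_def)
    finally show "(\<integral>\<^sup>+s. k (exp s) * ennreal (exp s) * indicator (?I n) s \<partial>lborel) \<le> (\<integral>\<^sup>+r. k r \<partial>lborel)" .
  qed
  finally show ?thesis .
qed

text \<open>
  Polar coordinates, obtained from the holomorphic change of variables \<open>z = exp (s + i \<theta>)\<close> on the strip
  \<open>0 < \<theta> < 2 \<pi>\<close> and the substitution \<open>r = exp s\<close>. The image of the strip misses only a null set, as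
  the real axis is one.
\<close>
lemma nn_integral_disk_polar_le:
  fixes h :: "complex \<Rightarrow> ennreal"
  assumes [measurable]: "h \<in> borel_measurable borel"
  shows "(\<integral>\<^sup>+z. h z * indicator (ball 0 1) z \<partial>lborel)
    \<le> (\<integral>\<^sup>+\<theta>. (\<integral>\<^sup>+r. h (of_real r * cis \<theta>) * ennreal r * indicator {0<..<1} r \<partial>lborel) * indicator {0<..<2 * pi} \<theta> \<partial>lborel)"
proof -
  define U where "U = {w::complex. 0 < Im w} \<inter> {w. Im w < 2 * pi}"
  have U: "open U"
    unfolding U_def by (intro open_Int open_halfspace_Im_gt open_halfspace_Im_lt)
  have inj: "inj_on exp U"
    by (rule inj_onI, rule exp_complex_eqI) (auto simp: U_def)
  have real_null: "AE z in lborel. Im z \<noteq> 0"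
  proof -
    have "(\<integral>\<^sup>+z. indicator {z. Im z = 0} z \<partial>lborel) = (\<integral>\<^sup>+y. \<integral>\<^sup>+x. indicator {0::real} y \<partial>(lborel :: real measure) \<partial>lborel)"
      by (subst nn_integral_lborel_complex_iterated) (auto simp: indicator_def intro!: nn_integral_cong)
    also have "\<dots> = (\<integral>\<^sup>+y. \<infinity> * indicator {0::real} y \<partial>lborel)"
      by (intro nn_integral_cong) (auto simp: indicator_def)
    also have "\<dots> = 0" by (subst nn_integral_cmult_indicator) auto
    finally have "emeasure lborel {z::complex. Im z = 0} = 0"
      by (subst (asm) nn_integral_indicator) auto
    then show ?thesis by (intro AE_I[of _ _ "{z. Im z = 0}"]) auto
  qed
  have "(\<integral>\<^sup>+z. h z * indicator (ball 0 1) z \<partial>lborel) \<le> (\<integral>\<^sup>+z. (h z * indicator (ball 0 1) z) * indicator (exp ` U) z \<partial>lborel)"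
  proof (rule nn_integral_mono_AE, use real_null in eventually_elim)
    fix z :: complex assume z: "Im z \<noteq> 0"
    have "z \<in> exp ` U"
    proof
      have nz: "z \<noteq> 0" using z by auto
      have "z = of_real (norm z) * exp (\<i> * of_real (Arg2pi z))" by (rule Arg2pi_eq)
      then show "z = exp (Complex (ln (norm z)) (Arg2pi z))"
        using nz by (simp add: Complex_eq exp_add exp_of_real)
      have "Arg2pi z \<noteq> 0"
        using z Arg2pi_eq_0 by (auto simp: complex_is_Real_iff)
      then show "Complex (ln (norm z)) (Arg2pi z) \<in> U"
        using Arg2pi_ge_0[of z] Arg2pi_lt_2pi[of z] by (simp add: U_def)
    qed
    then show "h z * indicator (ball 0 1) z \<le> h z * indicator (ball 0 1) z * indicator (exp ` U) z"
      by simp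
  qed
  also have "\<dots> = (\<integral>\<^sup>+w. (h (exp w) * indicator (ball 0 1) (exp w)) * ennreal ((norm (deriv exp w))\<^sup>2) * indicator U w \<partial>lborel)"
  proof (rule nn_integral_injective_holomorphic[symmetric, OF _ U inj])
    show "exp holomorphic_on U" by (intro holomorphic_intros)
    show "(\<lambda>z. h z * indicator (ball 0 1) z) \<in> borel_measurable borel"
      by measurable
  qed
  also have "\<dots> = (\<integral>\<^sup>+w. (h (exp w) * indicator (ball 0 1) (exp w)) * ennreal ((norm (exp w))\<^sup>2) * indicator U w \<partial>lborel)"
  proof -
    have "deriv exp = (exp :: complex \<Rightarrow> complex)"
      by (intro ext DERIV_imp_deriv DERIV_exp)
    then show ?thesis by (simp only:)
  qed
  also have "\<dots> = (\<integral>\<^sup>+\<theta>. \<integral>\<^sup>+s. (h (exp (Complex s \<theta>)) * indicator (ball 0 1) (exp (Complex s \<theta>)))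
        * ennreal ((norm (exp (Complex s \<theta>)))\<^sup>2) * indicator U (Complex s \<theta>) \<partial>lborel \<partial>lborel)"
  proof (rule nn_integral_lborel_complex_iterated)
    have [measurable]: "U \<in> sets borel" using U by simp
    show "(\<lambda>w. (h (exp w) * indicator (ball 0 1) (exp w)) * ennreal ((norm (exp w))\<^sup>2) * indicator U w) \<in> borel_measurable borel"
      by measurable
  qed
  also have "\<dots> \<le> (\<integral>\<^sup>+\<theta>. (\<integral>\<^sup>+r. h (of_real r * cis \<theta>) * ennreal r * indicator {0<..<1} r \<partial>lborel) * indicator {0<..<2 * pi} \<theta> \<partial>lborel)"
  proof (rule nn_integral_mono)
    fix \<theta> :: real
    let ?k = "\<lambda>r. h (of_real r * cis \<theta>) * ennreal r * indicator {0<..<1} r"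
    have e: "exp (Complex s \<theta>) = of_real (exp s) * cis \<theta>" for s
      by (simp add: Complex_eq exp_add exp_of_real cis_conv_exp)
    have "(\<integral>\<^sup>+s. (h (exp (Complex s \<theta>)) * indicator (ball 0 1) (exp (Complex s \<theta>)))
        * ennreal ((norm (exp (Complex s \<theta>)))\<^sup>2) * indicator U (Complex s \<theta>) \<partial>lborel)
      = (\<integral>\<^sup>+s. ?k (exp s) * ennreal (exp s) * indicator {0<..<2 * pi} \<theta> \<partial>lborel)"
    proof (rule nn_integral_cong)
      fix s :: real
      have n: "norm (exp (Complex s \<theta>)) = exp s" by (simp add: e norm_mult)
      have 2: "ennreal ((exp s)\<^sup>2) = ennreal (exp s) * ennreal (exp s)"
        by (simp add: power2_eq_square ennreal_mult)
      show "(h (exp (Complex s \<theta>)) * indicator (ball 0 1) (exp (Complex s \<theta>)))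
        * ennreal ((norm (exp (Complex s \<theta>)))\<^sup>2) * indicator U (Complex s \<theta>)
        = ?k (exp s) * ennreal (exp s) * indicator {0<..<2 * pi} \<theta>"
        unfolding n 2 by (simp add: indicator_def n U_def e norm_mult mult_ac)
    qed
    also have "\<dots> = (\<integral>\<^sup>+s. ?k (exp s) * ennreal (exp s) \<partial>lborel) * indicator {0<..<2 * pi} \<theta>"
      by (subst nn_integral_multc) auto
    also have "\<dots> \<le> (\<integral>\<^sup>+r. ?k r \<partial>lborel) * indicator {0<..<2 * pi} \<theta>"
      by (intro mult_right_mono nn_integral_exp_substitution_le) auto
    finally show "(\<integral>\<^sup>+s. (h (exp (Complex s \<theta>)) * indicator (ball 0 1) (exp (Complex s \<theta>)))
        * ennreal ((norm (exp (Complex s \<theta>)))\<^sup>2) * indicator U (Complex s \<theta>) \<partial>lborel)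
       \<le> (\<integral>\<^sup>+r. ?k r \<partial>lborel) * indicator {0<..<2 * pi} \<theta>" .
  qed
  finally show ?thesis .
qed

section \<open>Growth and distortion along a radius\<close>

locale disk_self_map =
  fixes F :: "complex \<Rightarrow> complex"
  assumes hol: "F holomorphic_on ball 0 1"
    and norm_lt_1: "\<And>z. norm z < 1 \<Longrightarrow> norm (F z) < 1"
    and fixes_0: "F 0 = 0"
begin

lemma schwarz: "norm z < 1 \<Longrightarrow> norm (F z) \<le> norm z"
  by (rule Schwarz_Lemma(1)[OF hol fixes_0 norm_lt_1])

lemma schwarz_pick': "norm a < 1 \<Longrightarrow> norm (deriv F a) * (1 - (norm a)\<^sup>2) \<le> 1 - (norm (F a))\<^sup>2"
  using norm_lt_1 by (intro schwarz_pick[OF hol]) (auto intro: less_imp_le)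

end

lemma one_minus_square_pos: "norm z < 1 \<Longrightarrow> 0 < 1 - (norm (z::complex))\<^sup>2"
  by (simp add: abs_square_less_1)

lemma has_real_derivative_Re_Im:
  assumes "(f has_vector_derivative (f'::complex)) F"
  shows "((\<lambda>r. Re (f r)) has_vector_derivative Re f') F" "((\<lambda>r. Im (f r)) has_vector_derivative Im f') F"
  using bounded_linear.has_vector_derivative[OF bounded_linear_Re assms]
    bounded_linear.has_vector_derivative[OF bounded_linear_Im assms] .

lemma has_vector_derivative_radial:
  assumes "(f has_field_derivative f') (at (of_real r * \<zeta>))"
  shows "((\<lambda>r. f (of_real r * \<zeta>)) has_vector_derivative (\<zeta> * f')) (at r)"
proof -
  have "((\<lambda>z. f (z * \<zeta>)) has_field_derivative f' * (1 * \<zeta>)) (at (of_real r))"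
    by (rule DERIV_chain'[where g = f]) (use assms in \<open>auto intro!: derivative_eq_intros\<close>)
  then show ?thesis
    using has_vector_derivative_real_field by (fastforce simp: mult.commute)
qed

text \<open>
  For \<open>f\<^sub>1 + i f\<^sub>2 = F z\<close> and \<open>g\<^sub>1 + i g\<^sub>2 = \<zeta> F' z\<close> at \<open>z = r \<zeta>\<close>, this is the imaginary part of the ratio
  \<open>q\<close>. It is kept in real coordinates because it is differentiated with respect to \<open>r\<close>.
\<close>
definition angle_defect :: "real \<Rightarrow> real \<Rightarrow> real \<Rightarrow> real \<Rightarrow> real \<Rightarrow> real" where
  "angle_defect r f1 f2 g1 g2 = (f1 * g2 - f2 * g1) * (1 - r\<^sup>2) / (sqrt (f1\<^sup>2 + f2\<^sup>2) * (1 - (f1\<^sup>2 + f2\<^sup>2)))"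

text \<open>
  Here \<open>p + i q\<close> is the conjugate of \<open>F z\<close> times \<open>\<zeta> F' z\<close>, so the last two factors are \<open>x\<close> and \<open>y\<close>.
  The bracket divided by \<open>B\<close> is the curvature term \<open>c\<close> of \<open>second_order_schwarz_pick\<close>, and
  \<open>(1 + Q) / (2 B) = (1 + B\<^sup>2) / (2 B) = coth D\<close>. The factor \<open>2 / (1 - r\<^sup>2)\<close> converts to hyperbolic length.
\<close>
lemma angle_defect_derivative:
  fixes f1 f2 g1 g2 :: "real \<Rightarrow> real"
  assumes f: "(f1 has_real_derivative g1 r) (at r)" "(f2 has_real_derivative g2 r) (at r)"
    and g: "(g1 has_real_derivative h1) (at r)" "(g2 has_real_derivative h2) (at r)"
    and Q: "Q = (f1 r)\<^sup>2 + (f2 r)\<^sup>2" "0 < Q" "Q < 1" and r: "r\<^sup>2 < 1"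
    and B: "B = sqrt Q" and p: "p = f1 r * g1 r + f2 r * g2 r" and q: "q = f1 r * g2 r - f2 r * g1 r"
  shows "((\<lambda>r. angle_defect r (f1 r) (f2 r) (g1 r) (g2 r)) has_real_derivative
     2 / (1 - r\<^sup>2) * (((f1 r * h2 - f2 r * h1) * (1 - r\<^sup>2)\<^sup>2 / (2 * (1 - Q)) - r * (1 - r\<^sup>2) * q / (1 - Q)
         + 2 * p * q * (1 - r\<^sup>2)\<^sup>2 / (1 - Q)\<^sup>2) / B
       - (1 + Q) / (2 * B) * (p * (1 - r\<^sup>2) / (B * (1 - Q))) * (q * (1 - r\<^sup>2) / (B * (1 - Q))))) (at r)"
proof -
  define s where "s = 1 - r\<^sup>2"
  define m where "m = f1 r * h2 - f2 r * h1"
  have nz: "B > 0" "1 - Q > 0" "s > 0" "B\<^sup>2 = Q"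
    using Q r B by (auto simp: s_def)
  let ?N = "\<lambda>r. (f1 r * g2 r - f2 r * g1 r) * (1 - r\<^sup>2)"
  let ?M = "\<lambda>r. sqrt ((f1 r)\<^sup>2 + (f2 r)\<^sup>2) * (1 - ((f1 r)\<^sup>2 + (f2 r)\<^sup>2))"
  have N: "(?N has_real_derivative (m * s - q * (2 * r))) (at r)"
    by (auto intro!: derivative_eq_intros f g simp: m_def q s_def algebra_simps)
  have QD: "((\<lambda>r. (f1 r)\<^sup>2 + (f2 r)\<^sup>2) has_real_derivative 2 * p) (at r)"
    by (auto intro!: derivative_eq_intros f simp: p algebra_simps)
  have M: "(?M has_real_derivative (inverse B / 2 * (2 * p)) * (1 - Q) - B * (2 * p)) (at r)"
  proof -
    have "((\<lambda>r. sqrt ((f1 r)\<^sup>2 + (f2 r)\<^sup>2)) has_real_derivative (inverse B / 2 * (2 * p))) (at r)"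
      using Q B by (intro DERIV_chain2[OF _ QD]) (auto intro: DERIV_real_sqrt)
    note DERIV_mult[OF this DERIV_diff[OF DERIV_const[of 1] QD]]
    then show ?thesis
      by (rule back_subst[of "\<lambda>D. (?M has_real_derivative D) (at r)"]) (simp add: Q B)
  qed
  have "?M r = B * (1 - Q)" "?N r = q * s"
    by (simp_all add: B Q q s_def)
  then have D: "((\<lambda>r. ?N r / ?M r) has_real_derivative
    ((m * s - q * (2 * r)) * (B * (1 - Q)) - (q * s) * ((inverse B / 2 * (2 * p)) * (1 - Q) - B * (2 * p)))
      / (B * (1 - Q) * (B * (1 - Q)))) (at r)"
    using DERIV_divide[OF N M] nz by simp
  have eq: "((m * s - q * (2 * r)) * (B * (1 - Q)) - (q * s) * ((inverse B / 2 * (2 * p)) * (1 - Q) - B * (2 * p)))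
      / (B * (1 - Q) * (B * (1 - Q)))
    = 2 / s * ((m * s\<^sup>2 / (2 * (1 - Q)) - r * s * q / (1 - Q) + 2 * p * q * s\<^sup>2 / (1 - Q)\<^sup>2) / B
       - (1 + Q) / (2 * B) * (p * s / (B * (1 - Q))) * (q * s / (B * (1 - Q))))"
  proof -
    define d where "d = 1 - Q"
    have d: "d > 0" "1 + Q = d + 2 * B\<^sup>2" using nz by (simp_all add: d_def)
    have "((m * s - q * (2 * r)) * (B * d) - (q * s) * ((inverse B / 2 * (2 * p)) * d - B * (2 * p))) / (B * d * (B * d))
       = (m * s - q * (2 * r)) / (B * d) - p * q * s / (B^3 * d) + 2 * p * q * s / (B * d\<^sup>2)"
      using nz(1) d(1) by (simp add: field_simps power2_eq_square power3_eq_cube)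
    also have "\<dots> = 2 / s * ((m * s\<^sup>2 / (2 * d) - r * s * q / d + 2 * p * q * s\<^sup>2 / d\<^sup>2) / B
       - (d + 2 * B\<^sup>2) / (2 * B) * (p * s / (B * d)) * (q * s / (B * d)))"
      using nz(1,3) d(1) by (simp add: field_simps power2_eq_square power3_eq_cube)
    finally show ?thesis unfolding d(2) unfolding d_def .
  qed
  show ?thesis
    using D unfolding eq by (simp add: angle_defect_def s_def m_def)
qed

text \<open>
  If \<open>y' = c - coth D x y\<close> with respect to hyperbolic length, then the first term on the right side is the
  derivative of \<open>- sqrt (\<epsilon>\<^sup>2 + y\<^sup>2)\<close>, a smooth substitute for \<open>- |y|\<close>. Damping dominates where \<open>x\<close> is close to 1,
  and where it does not, \<open>1 - x\<close> is bounded below. Therefore \<open>|1 - q|\<close> is at most this derivative plus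
  a multiple of \<open>r - B x\<close>, and both have bounded integrals.
\<close>
lemma distortion_differential_inequality:
  fixes x y B r c \<epsilon> :: real
  assumes B: "1/2 \<le> B" "B \<le> r" "r < 1" and xy: "x\<^sup>2 + y\<^sup>2 \<le> 1" and c: "\<bar>c\<bar> \<le> 1 - (x\<^sup>2 + y\<^sup>2)" and \<epsilon>: "\<epsilon> > 0"
  shows "sqrt ((1 - x)\<^sup>2 + y\<^sup>2) \<le> - (y * (c - (1 + B\<^sup>2) / (2 * B) * x * y) / sqrt (\<epsilon>\<^sup>2 + y\<^sup>2)) + 9 * (r - B * x) + \<epsilon>"
proof -
  define \<sigma> where "\<sigma> = sqrt (\<epsilon>\<^sup>2 + y\<^sup>2)"
  define \<kappa> where "\<kappa> = (1 + B\<^sup>2) / (2 * B)"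
  define v where "v = y\<^sup>2 / \<sigma>"
  have \<sigma>: "\<sigma> > 0" "\<bar>y\<bar> \<le> \<sigma>" "\<sigma> \<le> \<bar>y\<bar> + \<epsilon>"
  proof -
    show "\<sigma> > 0" using \<epsilon> by (simp add: \<sigma>_def add_pos_nonneg)
    show "\<bar>y\<bar> \<le> \<sigma>" unfolding \<sigma>_def by (rule real_le_rsqrt) simp
    show "\<sigma> \<le> \<bar>y\<bar> + \<epsilon>"
      using sqrt_add_le_add_sqrt[of "\<epsilon>\<^sup>2" "y\<^sup>2"] \<epsilon> by (simp add: \<sigma>_def)
  qed
  have \<kappa>: "1 \<le> \<kappa>" "\<kappa> \<le> 5/4"
  proof -
    have "0 \<le> (1 - B)\<^sup>2" by simp
    then show "1 \<le> \<kappa>" using B by (simp add: \<kappa>_def power2_eq_square field_simps)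
    have "0 \<le> (2 * B - 1) * (2 - B)" using B by (intro mult_nonneg_nonneg) auto
    then show "\<kappa> \<le> 5/4" using B by (simp add: \<kappa>_def power2_eq_square field_simps)
  qed
  have x: "\<bar>x\<bar> \<le> 1" "\<bar>y\<bar> \<le> 1"
    using xy abs_square_le_1[of x] abs_square_le_1[of y] zero_le_power2[of x] zero_le_power2[of y] by linarith+
  have v: "0 \<le> v" "\<bar>y\<bar> - \<epsilon> \<le> v" "v \<le> 1"
  proof -
    show "0 \<le> v" using \<sigma> by (simp add: v_def)
    have "v \<le> \<bar>y\<bar>"
    proof -
      have "y\<^sup>2 = \<bar>y\<bar> * \<bar>y\<bar>" by (simp add: power2_eq_square)
      then have "y\<^sup>2 \<le> \<bar>y\<bar> * \<sigma>" using \<sigma>(2) by (simp only: mult_left_mono abs_ge_zero)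
      then show ?thesis using \<sigma>(1) by (simp add: v_def divide_le_eq)
    qed
    then show "v \<le> 1" using x by simp
    have "(\<bar>y\<bar> - \<epsilon>) * \<sigma> \<le> y\<^sup>2"
    proof (cases "\<bar>y\<bar> \<le> \<epsilon>")
      case True
      then have "(\<bar>y\<bar> - \<epsilon>) * \<sigma> \<le> 0" using \<sigma> by (simp add: mult_nonpos_nonneg)
      then show ?thesis by (rule order_trans) simp
    next
      case False
      then have "(\<bar>y\<bar> - \<epsilon>) * \<sigma> \<le> (\<bar>y\<bar> - \<epsilon>) * (\<bar>y\<bar> + \<epsilon>)" using \<sigma> by (intro mult_left_mono) auto
      also have "\<dots> = y\<^sup>2 - \<epsilon>\<^sup>2" by (simp add: algebra_simps power2_eq_square)
      finally show ?thesis using zero_le_power2[of \<epsilon>] by linarith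
    qed
    then show "\<bar>y\<bar> - \<epsilon> \<le> v" using \<sigma>(1) by (simp add: v_def le_divide_eq)
  qed
  have c1: "y * c / \<sigma> \<le> 2 * (1 - x)"
  proof -
    have "y * c \<le> \<bar>y\<bar> * \<bar>c\<bar>" by (metis abs_ge_self abs_mult)
    also have "\<dots> \<le> \<sigma> * (2 * (1 - x))"
    proof (rule mult_mono)
      have "1 - x\<^sup>2 = (1 - x) * (1 + x)" by (simp add: algebra_simps power2_eq_square)
      also have "\<dots> \<le> (1 - x) * 2" using x by (intro mult_left_mono) auto
      finally show "\<bar>c\<bar> \<le> 2 * (1 - x)" using c zero_le_power2[of y] by linarith
    qed (use \<sigma> in auto)
    finally show ?thesis using \<sigma>(1) by (simp add: divide_le_eq mult.commute)
  qed
  \<comment> \<open>\<open>v\<close> is \<open>|y|\<close> up to \<open>\<epsilon>\<close>, and at most 1, so replacing \<open>x\<close> by 1 costs at most \<open>\<kappa> (1 - x)\<close>\<close>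
  have c2: "\<kappa> * x * v \<ge> v - 5/4 * (1 - x)"
  proof -
    have "\<kappa> * (1 - x) * v \<le> 5/4 * (1 - x) * 1"
      using \<kappa> x v by (intro mult_mono) auto
    moreover have "v \<le> \<kappa> * v" using \<kappa> v by (simp add: mult_right_mono[of 1 \<kappa> v, simplified])
    moreover have "\<kappa> * x * v = \<kappa> * v - \<kappa> * (1 - x) * v" by (simp add: algebra_simps)
    ultimately show ?thesis by linarith
  qed
  have c3: "1 - x \<le> 2 * (r - B * x)"
  proof -
    have "1/2 * (1 - x) \<le> B * (1 - x)" using B x by (intro mult_right_mono) auto
    then show ?thesis unfolding right_diff_distrib using B by linarith
  qed
  define R where "R = r - B * x"
  define A where "A = y * c / \<sigma>"
  define A' where "A' = \<kappa> * x * v"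
  have "y * (c - \<kappa> * x * y) / \<sigma> = A - A'"
    by (simp add: A_def A'_def v_def algebra_simps power2_eq_square diff_divide_distrib)
  moreover have "sqrt ((1 - x)\<^sup>2 + y\<^sup>2) \<le> - (A - A') + 9 * R + \<epsilon>"
  proof -
    have "sqrt ((1 - x)\<^sup>2 + y\<^sup>2) \<le> (1 - x) + \<bar>y\<bar>"
      using sqrt_add_le_add_sqrt[of "(1 - x)\<^sup>2" "y\<^sup>2"] x by simp
    moreover have "\<bar>y\<bar> \<le> v + \<epsilon>" using v by linarith
    moreover have "x \<le> 1" using x by linarith
    moreover have "A \<le> 2 - 2 * x" "v - 5/4 + 5/4 * x \<le> A'" "1 - x \<le> 2 * R"
      using c1 c2 c3 by (simp_all add: A_def A'_def R_def right_diff_distrib)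
    ultimately show ?thesis by argo
  qed
  ultimately show ?thesis
    unfolding \<sigma>_def[symmetric] \<kappa>_def[symmetric] R_def[symmetric] by (simp only:)
qed

lemma norm_v_rad: "norm a < 1 \<Longrightarrow> norm (v_rad a) = (if a = 0 then 0 else (1 - (norm a)\<^sup>2) / 2)"
  using one_minus_square_pos[of a] unfolding v_rad_def norm_mult norm_of_real norm_divide by auto

context disk_self_map
begin

definition hyp_deriv :: "complex \<Rightarrow> real" where
  "hyp_deriv a = norm (deriv F a) * (1 - (norm a)\<^sup>2) / (1 - (norm (F a))\<^sup>2)"

definition rad_ratio :: "complex \<Rightarrow> complex" where
  "rad_ratio a = deriv F a * v_rad a / v_rad (F a)"

lemma linear_distortion_eq: "linear_distortion F a = norm (1 - rad_ratio a)"
  by (simp add: linear_distortion_def rad_ratio_def)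

lemma hyp_deriv_bounds:
  assumes "norm a < 1" shows "0 \<le> hyp_deriv a" "hyp_deriv a \<le> 1"
  using one_minus_square_pos[OF assms] one_minus_square_pos[OF norm_lt_1[OF assms]] schwarz_pick'[OF assms]
  by (auto simp: hyp_deriv_def)

lemma norm_rad_ratio:
  assumes "norm a < 1"
  shows "norm (rad_ratio a) = (if a = 0 \<or> F a = 0 then 0 else hyp_deriv a)"
  using assms one_minus_square_pos[OF assms] one_minus_square_pos[OF norm_lt_1[OF assms]]
  by (auto simp: rad_ratio_def hyp_deriv_def norm_mult norm_divide norm_v_rad norm_lt_1)

lemma norm_rad_ratio_le_1: "norm a < 1 \<Longrightarrow> norm (rad_ratio a) \<le> 1"
  using hyp_deriv_bounds by (simp add: norm_rad_ratio)

lemma linear_distortion_le_2: "norm a < 1 \<Longrightarrow> linear_distortion F a \<le> 2"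
  unfolding linear_distortion_eq
  using norm_triangle_ineq4[of 1 "rad_ratio a"] norm_rad_ratio_le_1[of a] by simp

text \<open>
  The hyperbolic derivative is \<open>|q|\<close>, and \<open>1 - |q|\<^sup>2 \<le> 2 (1 - |q|) \<le> 2 |1 - q|\<close>. At the zeros of \<open>F\<close> the
  default value 1 of the distortion makes the inequality hold too.
\<close>
lemma contraction_defect_le:
  assumes a: "norm a < 1"
  shows "1 - (hyp_deriv a)\<^sup>2 \<le> 2 * linear_distortion F a"
proof (cases "a = 0 \<or> F a = 0")
  case True
  then have "linear_distortion F a = 1"
    using norm_rad_ratio[OF a] by (simp add: linear_distortion_eq)
  then show ?thesis using zero_le_power2[of "hyp_deriv a"] by linarith
next
  case False
  have "1 - (hyp_deriv a)\<^sup>2 = (1 - hyp_deriv a) * (1 + hyp_deriv a)"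
    by (simp add: algebra_simps power2_eq_square)
  also have "\<dots> \<le> (1 - hyp_deriv a) * 2"
    using hyp_deriv_bounds[OF a] by (intro mult_left_mono) auto
  also have "1 - hyp_deriv a \<le> linear_distortion F a"
    using norm_triangle_ineq2[of 1 "rad_ratio a"] norm_rad_ratio[OF a] False by (simp add: linear_distortion_eq)
  finally show ?thesis by simp
qed

lemma rad_ratio_radial:
  assumes \<zeta>: "norm \<zeta> = 1" and r: "0 < r" "r < 1" and nz: "F (of_real r * \<zeta>) \<noteq> 0"
  defines "f \<equiv> F (of_real r * \<zeta>)" and "g \<equiv> \<zeta> * deriv F (of_real r * \<zeta>)"
  shows "rad_ratio (of_real r * \<zeta>) = cnj f * g * of_real ((1 - r\<^sup>2) / (norm f * (1 - (norm f)\<^sup>2)))"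
proof -
  have 1: "norm (of_real r * \<zeta>) = r" using \<zeta> r by (simp add: norm_mult)
  have 2: "f * cnj f = of_real (norm f) * of_real (norm f)"
    using complex_norm_square[of f] by (simp add: power2_eq_square)
  have nz': "f \<noteq> 0" using nz by (simp add: f_def)
  have pos: "1 - (norm f)\<^sup>2 \<noteq> 0"
    using one_minus_square_pos[OF norm_lt_1[of "of_real r * \<zeta>"]] 1 r by (simp add: f_def)
  define T where "T = complex_of_real (1 - (norm f)\<^sup>2)"
  have T: "T \<noteq> 0" using pos by (simp only: T_def of_real_eq_0_iff not_False_eq_True)
  define S where "S = complex_of_real (1 - r\<^sup>2)"
  define N where "N = complex_of_real (norm f)"
  have N: "N \<noteq> 0" "f * cnj f = N * N" using nz' 2 by (simp_all add: N_def)
  have "rad_ratio (of_real r * \<zeta>) = deriv F (of_real r * \<zeta>) * (S / 2 * \<zeta>) / (T / 2 * (f / N))"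
    using r by (simp add: rad_ratio_def v_rad_def f_def[symmetric] 1 S_def T_def N_def)
  also have "\<dots> = cnj f * g * (S / (N * T))"
    using N T nz' unfolding g_def by (simp add: field_simps) 
  finally show ?thesis by (simp add: S_def T_def N_def)
qed

lemma radial_derivs:
  assumes \<zeta>: "norm \<zeta> = 1" and r: "\<bar>r\<bar> < 1"
  shows "((\<lambda>r. F (of_real r * \<zeta>)) has_vector_derivative \<zeta> * deriv F (of_real r * \<zeta>)) (at r)"
    and "((\<lambda>r. \<zeta> * deriv F (of_real r * \<zeta>)) has_vector_derivative \<zeta>\<^sup>2 * deriv (deriv F) (of_real r * \<zeta>)) (at r)"
proof -
  have 1: "of_real r * \<zeta> \<in> ball 0 1" using \<zeta> r by (simp add: norm_mult)
  show "((\<lambda>r. F (of_real r * \<zeta>)) has_vector_derivative \<zeta> * deriv F (of_real r * \<zeta>)) (at r)"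
    by (rule has_vector_derivative_radial[OF holomorphic_derivI[OF hol open_ball 1]])
  have "((\<lambda>r. deriv F (of_real r * \<zeta>)) has_vector_derivative \<zeta> * deriv (deriv F) (of_real r * \<zeta>)) (at r)"
    by (rule has_vector_derivative_radial[OF holomorphic_derivI[OF holomorphic_deriv[OF hol open_ball] open_ball 1]])
  from has_vector_derivative_mult_right[OF this, of \<zeta>]
  show "((\<lambda>r. \<zeta> * deriv F (of_real r * \<zeta>)) has_vector_derivative \<zeta>\<^sup>2 * deriv (deriv F) (of_real r * \<zeta>)) (at r)"
    by (simp add: power2_eq_square mult.assoc)
qed

text \<open>
  A smooth substitute for the loss of hyperbolic distance to 0 under \<open>F\<close>: the two differ by a bounded
  amount, but the distance itself is not differentiable at the zeros of \<open>F\<close>.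
\<close>
definition growth :: "complex \<Rightarrow> real \<Rightarrow> real" where
  "growth \<zeta> r = ln (1 - (norm (F (of_real r * \<zeta>)))\<^sup>2) - ln (1 - r\<^sup>2)"

text \<open>
  The rate is nonnegative because \<open>|q| \<le> 1\<close> and, by the Schwarz lemma, \<open>|F z| \<le> |z|\<close>.
\<close>
lemma growth_derivative:
  assumes \<zeta>: "norm \<zeta> = 1" and r: "0 \<le> r" "r < 1"
  defines "f \<equiv> F (of_real r * \<zeta>)" and "g \<equiv> \<zeta> * deriv F (of_real r * \<zeta>)"
  shows "(growth \<zeta> has_real_derivative 2 / (1 - r\<^sup>2) * (r - Re (cnj f * g) * (1 - r\<^sup>2) / (1 - (norm f)\<^sup>2))) (at r)"
    and "0 \<le> r - Re (cnj f * g) * (1 - r\<^sup>2) / (1 - (norm f)\<^sup>2)"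
proof -
  have nr: "norm (of_real r * \<zeta>) = r" using \<zeta> r by (simp add: norm_mult)
  have s: "1 - r\<^sup>2 > 0" using one_minus_square_pos[of "of_real r * \<zeta>"] nr r by simp
  have t: "1 - (norm f)\<^sup>2 > 0" using one_minus_square_pos[OF norm_lt_1[of "of_real r * \<zeta>"]] nr r by (simp add: f_def)
  have rd: "((\<lambda>r. F (of_real r * \<zeta>)) has_vector_derivative g) (at r)"
    unfolding g_def using \<zeta> r by (intro radial_derivs) auto
  define f1 where "f1 = (\<lambda>r. Re (F (of_real r * \<zeta>)))"
  define f2 where "f2 = (\<lambda>r. Im (F (of_real r * \<zeta>)))"
  have D: "(f1 has_real_derivative Re g) (at r)" "(f2 has_real_derivative Im g) (at r)"
    using has_real_derivative_Re_Im[OF rd] unfolding f1_def f2_def has_real_derivative_iff_has_vector_derivative .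
  have f12: "f1 r = Re f" "f2 r = Im f" by (simp_all add: f1_def f2_def f_def)
  have "((\<lambda>r. ln (1 - ((f1 r)\<^sup>2 + (f2 r)\<^sup>2)) - ln (1 - r\<^sup>2)) has_real_derivative
     (- 2 * Re (cnj f * g)) / (1 - (norm f)\<^sup>2) + 2 * r / (1 - r\<^sup>2)) (at r)"
  proof -
    have "((\<lambda>r. 1 - ((f1 r)\<^sup>2 + (f2 r)\<^sup>2)) has_real_derivative - 2 * Re (cnj f * g)) (at r)"
      by (auto intro!: derivative_eq_intros D simp: f12 algebra_simps)
    moreover have "((\<lambda>r. 1 - r\<^sup>2) has_real_derivative - 2 * r) (at r)"
      by (auto intro!: derivative_eq_intros)
    ultimately have "((\<lambda>r. ln (1 - ((f1 r)\<^sup>2 + (f2 r)\<^sup>2)) - ln (1 - r\<^sup>2)) has_real_derivative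
        1 / (1 - ((f1 r)\<^sup>2 + (f2 r)\<^sup>2)) * (- 2 * Re (cnj f * g)) - 1 / (1 - r\<^sup>2) * (- 2 * r)) (at r)"
      using s t by (intro DERIV_diff DERIV_chain2[OF DERIV_ln_divide]) (auto simp: f12 cmod_power2)
    then show ?thesis by (simp add: f12 cmod_power2)
  qed
  moreover have "(- 2 * Re (cnj f * g)) / (1 - (norm f)\<^sup>2) + 2 * r / (1 - r\<^sup>2)
      = 2 / (1 - r\<^sup>2) * (r - Re (cnj f * g) * (1 - r\<^sup>2) / (1 - (norm f)\<^sup>2))"
    using s t by (simp add: field_simps)
  ultimately show "(growth \<zeta> has_real_derivative 2 / (1 - r\<^sup>2) * (r - Re (cnj f * g) * (1 - r\<^sup>2) / (1 - (norm f)\<^sup>2))) (at r)"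
    unfolding growth_def[abs_def] cmod_power2 f1_def f2_def by simp
  have "Re (cnj f * g) * (1 - r\<^sup>2) \<le> norm f * norm (deriv F (of_real r * \<zeta>)) * (1 - r\<^sup>2)"
    using complex_Re_le_cmod[of "cnj f * g"] s \<zeta> by (intro mult_right_mono) (auto simp: norm_mult g_def)
  also have "\<dots> \<le> norm f * (1 - (norm f)\<^sup>2)"
    using schwarz_pick'[of "of_real r * \<zeta>"] nr r by (simp add: f_def mult.assoc mult_left_mono)
  also have "\<dots> \<le> r * (1 - (norm f)\<^sup>2)"
    using schwarz[of "of_real r * \<zeta>"] nr r t by (intro mult_right_mono) (auto simp: f_def)
  finally show "0 \<le> r - Re (cnj f * g) * (1 - r\<^sup>2) / (1 - (norm f)\<^sup>2)"
    using t by (simp add: field_simps)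
qed

lemma growth_mono:
  assumes "norm \<zeta> = 1" "0 \<le> r" "r \<le> t" "t < 1"
  shows "growth \<zeta> r \<le> growth \<zeta> t"
proof (rule DERIV_nonneg_imp_nondecreasing[OF \<open>r \<le> t\<close>])
  fix x assume x: "r \<le> x" "x \<le> t"
  then have "0 \<le> x" "x < 1" using assms by auto
  note G = growth_derivative[OF assms(1) this]
  have "0 < 1 - x\<^sup>2" using \<open>0 \<le> x\<close> \<open>x < 1\<close> by (simp add: abs_square_less_1)
  then show "\<exists>y. (growth \<zeta> has_real_derivative y) (at x) \<and> 0 \<le> y"
    using G by (intro exI conjI) (assumption, auto intro!: mult_nonneg_nonneg divide_nonneg_nonneg)
qed

text \<open>
  The radius lies in every Stolz angle of aperture greater than 1; aperture 2 is used.
\<close>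
lemma angular_deriv_radial:
  assumes \<zeta>: "norm \<zeta> = 1" and L: "has_angular_deriv F \<zeta> L"
  obtains \<omega> where "norm \<omega> = 1" "((\<lambda>t. F (of_real t * \<zeta>)) \<longlongrightarrow> \<omega>) (at_left 1)"
    "((\<lambda>t. (F (of_real t * \<zeta>) - \<omega>) / (of_real t * \<zeta> - \<zeta>)) \<longlongrightarrow> L) (at_left 1)"
proof -
  obtain \<omega> where \<omega>: "norm \<omega> = 1" and lim: "((\<lambda>z. (F z - \<omega>) / (z - \<zeta>)) \<longlongrightarrow> L) (at \<zeta> within stolz_angle \<zeta> 2)"
    using L unfolding has_angular_deriv_def by fastforce
  have "filterlim (\<lambda>t. of_real t * \<zeta>) (at \<zeta> within stolz_angle \<zeta> 2) (at_left (1::real))"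
  proof -
    have 1: "((\<lambda>t. of_real t * \<zeta>) \<longlongrightarrow> \<zeta>) (at_left (1::real))"
      by (auto intro!: tendsto_eq_intros)
    have "\<forall>\<^sub>F t in at_left (1::real). of_real t * \<zeta> \<in> stolz_angle \<zeta> 2 \<and> of_real t * \<zeta> \<noteq> \<zeta>"
      using eventually_at_left_real[OF zero_less_one]
    proof eventually_elim
      case (elim t)
      have "of_real t * \<zeta> - \<zeta> = - (of_real (1 - t) * \<zeta>)" by (simp add: algebra_simps)
      then have "norm (of_real t * \<zeta> - \<zeta>) = 1 - t" using elim \<zeta>
        by (simp only: norm_minus_cancel norm_mult norm_of_real) simp
      moreover have "norm (of_real t * \<zeta>) = t" using elim \<zeta> by (simp add: norm_mult)
      ultimately show ?case using elim by (auto simp: stolz_angle_def)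
    qed
    then show ?thesis
      using 1 by (simp add: filterlim_at)
  qed
  from filterlim_compose[OF lim this]
  have l: "((\<lambda>t. (F (of_real t * \<zeta>) - \<omega>) / (of_real t * \<zeta> - \<zeta>)) \<longlongrightarrow> L) (at_left 1)" .
  have "((\<lambda>t. (F (of_real t * \<zeta>) - \<omega>) / (of_real t * \<zeta> - \<zeta>) * (of_real t * \<zeta> - \<zeta>) + \<omega>) \<longlongrightarrow> L * (of_real 1 * \<zeta> - \<zeta>) + \<omega>) (at_left 1)"
    by (intro tendsto_intros l)
  then have "((\<lambda>t. (F (of_real t * \<zeta>) - \<omega>) / (of_real t * \<zeta> - \<zeta>) * (of_real t * \<zeta> - \<zeta>) + \<omega>) \<longlongrightarrow> \<omega>) (at_left 1)"
    by simp
  then have "((\<lambda>t. F (of_real t * \<zeta>)) \<longlongrightarrow> \<omega>) (at_left 1)"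
  proof (rule Lim_transform_eventually)
    show "\<forall>\<^sub>F t in at_left 1. (F (of_real t * \<zeta>) - \<omega>) / (of_real t * \<zeta> - \<zeta>) * (of_real t * \<zeta> - \<zeta>) + \<omega> = F (of_real t * \<zeta>)"
      using eventually_at_left_real[OF zero_less_one] by eventually_elim (use \<zeta> in auto)
  qed
  with \<omega> l show ?thesis using that by blast
qed

lemma has_angular_deriv_unique:
  assumes "norm \<zeta> = 1" "has_angular_deriv F \<zeta> L" "has_angular_deriv F \<zeta> L'"
  shows "L = L'"
proof -
  obtain \<omega> where "norm \<omega> = 1" and 1: "((\<lambda>t. F (of_real t * \<zeta>)) \<longlongrightarrow> \<omega>) (at_left 1)"
    "((\<lambda>t. (F (of_real t * \<zeta>) - \<omega>) / (of_real t * \<zeta> - \<zeta>)) \<longlongrightarrow> L) (at_left 1)"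
    by (rule angular_deriv_radial[OF assms(1,2)])
  obtain \<omega>' where "norm \<omega>' = 1" and 2: "((\<lambda>t. F (of_real t * \<zeta>)) \<longlongrightarrow> \<omega>') (at_left 1)"
    "((\<lambda>t. (F (of_real t * \<zeta>) - \<omega>') / (of_real t * \<zeta> - \<zeta>)) \<longlongrightarrow> L') (at_left 1)"
    by (rule angular_deriv_radial[OF assms(1,3)])
  have "\<omega> = \<omega>'" using tendsto_unique[OF _ 1(1) 2(1)] by simp
  then show ?thesis using tendsto_unique[OF _ 1(2)] 2(2) by simp
qed

text \<open>
  The growth increases along the radius, so it is at most its limit. That limit is bounded by
  \<open>|F z - \<omega>| / |z - \<zeta>|\<close>, because \<open>1 - |F z| \<le> |F z - \<omega>|\<close> and \<open>|F z| \<le> |z|\<close>.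
\<close>
lemma growth_le_angular_deriv:
  assumes \<zeta>: "norm \<zeta> = 1" and L: "has_angular_deriv F \<zeta> L" and r: "0 \<le> r" "r < 1"
  shows "exp (growth \<zeta> r) \<le> norm L"
proof -
  obtain \<omega> where \<omega>: "norm \<omega> = 1" and "((\<lambda>t. F (of_real t * \<zeta>)) \<longlongrightarrow> \<omega>) (at_left 1)"
    and lim: "((\<lambda>t. (F (of_real t * \<zeta>) - \<omega>) / (of_real t * \<zeta> - \<zeta>)) \<longlongrightarrow> L) (at_left 1)"
    by (rule angular_deriv_radial[OF \<zeta> L])
  have "\<forall>\<^sub>F t in at_left 1. exp (growth \<zeta> r) \<le> norm ((F (of_real t * \<zeta>) - \<omega>) / (of_real t * \<zeta> - \<zeta>))"
    using eventually_at_left_real[OF \<open>r < 1\<close>]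
  proof eventually_elim
    case (elim t)
    then have t: "0 < t" "t < 1" "r \<le> t" using r by auto
    have nt: "norm (of_real t * \<zeta>) = t" using t \<zeta> by (simp add: norm_mult)
    define B where "B = norm (F (of_real t * \<zeta>))"
    have B: "0 \<le> B" "B \<le> t" using schwarz[of "of_real t * \<zeta>"] nt t by (simp_all add: B_def)
    have pos: "1 - B\<^sup>2 > 0" "1 - t\<^sup>2 > 0"
      using B t by (auto simp: abs_square_less_1)
    have "exp (growth \<zeta> r) \<le> exp (growth \<zeta> t)"
      using growth_mono[OF \<zeta> r(1) t(3,2)] by simp
    also have "\<dots> = (1 - B\<^sup>2) / (1 - t\<^sup>2)"
      using pos by (simp add: growth_def B_def[symmetric] exp_diff)
    also have "\<dots> = ((1 - B) * (1 + B)) / ((1 - t) * (1 + t))"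
      by (simp add: algebra_simps power2_eq_square)
    also have "\<dots> \<le> ((1 - B) * (1 + t)) / ((1 - t) * (1 + t))"
      using B t by (intro divide_right_mono mult_left_mono) auto
    also have "\<dots> = (1 - B) / (1 - t)" using t by simp
    also have "\<dots> \<le> norm (F (of_real t * \<zeta>) - \<omega>) / (1 - t)"
      using norm_triangle_ineq2[of \<omega> "F (of_real t * \<zeta>)"] \<omega> t
      by (intro divide_right_mono) (auto simp: B_def norm_minus_commute)
    also have "1 - t = norm (of_real t * \<zeta> - \<zeta>)"
    proof -
      have "of_real t * \<zeta> - \<zeta> = - (of_real (1 - t) * \<zeta>)" by (simp add: algebra_simps)
      then show ?thesis using t \<zeta>
        by (simp only: norm_minus_cancel norm_mult norm_of_real) simp
    qed
    finally show ?case by (simp add: norm_divide)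
  qed
  then show ?thesis
    by (intro tendsto_lowerbound[OF tendsto_norm[OF lim]]) auto
qed

end

context disk_self_map
begin

text \<open>
  Expresses the distortion by \<open>x\<close> and \<open>y\<close>, and gives the differential equation of \<open>y\<close> with its bound on the
  forcing term.
\<close>
lemma radial_angle:
  assumes \<zeta>: "norm \<zeta> = 1" and r: "0 < r" "r < 1" and nz: "F (of_real r * \<zeta>) \<noteq> 0"
  defines "f \<equiv> \<lambda>r. F (of_real r * \<zeta>)" and "g \<equiv> \<lambda>r. \<zeta> * deriv F (of_real r * \<zeta>)"
  defines "B \<equiv> norm (f r)"
  defines "x \<equiv> Re (cnj (f r) * g r) * (1 - r\<^sup>2) / (B * (1 - B\<^sup>2))"
  defines "Y \<equiv> \<lambda>r. angle_defect r (Re (f r)) (Im (f r)) (Re (g r)) (Im (g r))"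
  shows "linear_distortion F (of_real r * \<zeta>) = sqrt ((1 - x)\<^sup>2 + (Y r)\<^sup>2)"
    and "x\<^sup>2 + (Y r)\<^sup>2 \<le> 1"
    and "\<exists>c. \<bar>c\<bar> \<le> 1 - (x\<^sup>2 + (Y r)\<^sup>2) \<and>
           (Y has_real_derivative 2 / (1 - r\<^sup>2) * (c - (1 + B\<^sup>2) / (2 * B) * x * Y r)) (at r)"
proof -
  define a where "a = of_real r * \<zeta>"
  have na: "norm a = r" "norm a < 1" "a \<noteq> 0" using \<zeta> r by (auto simp: a_def norm_mult)
  define s where "s = 1 - r\<^sup>2"
  define t where "t = 1 - B\<^sup>2"
  have st: "s > 0" "t > 0" "B > 0"
    using one_minus_square_pos[OF na(2)] one_minus_square_pos[OF norm_lt_1[OF na(2)]] na nz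
    by (simp_all add: s_def t_def B_def f_def a_def)
  define P where "P = cnj (f r) * g r"
  have B: "B = sqrt ((Re (f r))\<^sup>2 + (Im (f r))\<^sup>2)" "(Re (f r))\<^sup>2 + (Im (f r))\<^sup>2 = B\<^sup>2"
    by (simp_all add: B_def cmod_def)
  have Y: "Y r = Im P * s / (B * t)"
    unfolding Y_def angle_defect_def B(2) s_def t_def P_def using st by simp
  have x: "x = Re P * s / (B * t)"
    by (simp add: x_def P_def s_def t_def)
  have q: "rad_ratio a = P * of_real (s / (B * t))"
    using rad_ratio_radial[OF \<zeta> r nz] by (simp add: a_def P_def f_def g_def B_def s_def t_def)
  then have q': "rad_ratio a = Complex x (Y r)"
    by (simp add: complex_eq_iff x Y)
  show "linear_distortion F (of_real r * \<zeta>) = sqrt ((1 - x)\<^sup>2 + (Y r)\<^sup>2)"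
    using q' by (simp add: linear_distortion_eq a_def[symmetric] cmod_def)
  have n: "x\<^sup>2 + (Y r)\<^sup>2 = (norm (rad_ratio a))\<^sup>2"
    by (simp add: q' cmod_def)
  show "x\<^sup>2 + (Y r)\<^sup>2 \<le> 1"
    using norm_rad_ratio_le_1[OF na(2)] by (simp add: n abs_square_le_1)
  define H where "H = \<zeta>\<^sup>2 * deriv (deriv F) a"
  define c where "c = ((Re (f r) * Im H - Im (f r) * Re H) * s\<^sup>2 / (2 * t) - r * s * Im P / t
         + 2 * Re P * Im P * s\<^sup>2 / t\<^sup>2) / B"
  have rd: "(f has_vector_derivative g r) (at r)" "(g has_vector_derivative H) (at r)"
    using radial_derivs[OF \<zeta>, of r] r by (simp_all add: f_def g_def H_def a_def)
  note D = has_real_derivative_Re_Im[OF rd(1), folded has_real_derivative_iff_has_vector_derivative]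
    has_real_derivative_Re_Im[OF rd(2), folded has_real_derivative_iff_has_vector_derivative]
  have "(Y has_real_derivative 2 / s * (c - (1 + B\<^sup>2) / (2 * B) * x * Y r)) (at r)"
    unfolding Y_def c_def s_def t_def
    by (rule back_subst[of "\<lambda>D. (_ has_real_derivative D) (at r)",
        OF angle_defect_derivative[where Q = "B\<^sup>2" and B = B and p = "Re P" and q = "Im P", OF D]])
      (use B st Y x in \<open>auto simp: s_def t_def P_def Y_def\<close>)
  moreover have "\<bar>c\<bar> \<le> 1 - (x\<^sup>2 + (Y r)\<^sup>2)"
  proof -
    define h where "h = deriv F a * of_real (s / t)"
    define C0 where "C0 = (deriv (deriv F) a / 2 * of_real s - cnj a * deriv F a) * of_real (s / t) + h\<^sup>2 * cnj (f r)"
    have "F a = f r" by (simp add: f_def a_def)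
    have C0: "norm C0 \<le> 1 - (norm h)\<^sup>2"
      using second_order_schwarz_pick[OF hol, of a] norm_lt_1 na
      unfolding C0_def h_def s_def t_def B_def \<open>F a = f r\<close> by simp
    have nh: "norm h = norm (rad_ratio a)"
    proof -
      have "norm (rad_ratio a) = hyp_deriv a"
        using norm_rad_ratio[OF na(2)] na nz by (simp add: a_def)
      also have "\<dots> = norm h"
        using st unfolding h_def norm_mult norm_of_real
        by (simp add: hyp_deriv_def \<open>F a = f r\<close> na s_def t_def B_def)
      finally show ?thesis by simp
    qed
    have zz: "\<zeta>\<^sup>2 * cnj \<zeta> = \<zeta>"
      using \<zeta> complex_norm_square[of \<zeta>] by (simp add: power2_eq_square mult.assoc)
    have "cnj (f r) * \<zeta>\<^sup>2 * C0 = of_real (s\<^sup>2 / (2 * t)) * (cnj (f r) * H)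
        - of_real (r * s / t) * (cnj (f r) * (\<zeta>\<^sup>2 * cnj \<zeta>) * deriv F a) + (cnj (f r) * \<zeta> * h)\<^sup>2"
      using st by (simp add: C0_def H_def a_def field_simps power2_eq_square)
    also have "\<dots> = of_real (s\<^sup>2 / (2 * t)) * (cnj (f r) * H) - of_real (r * s / t) * P + of_real ((s / t)\<^sup>2) * P\<^sup>2"
      unfolding zz by (simp add: P_def g_def h_def a_def power_mult_distrib mult_ac power_divide)
    finally have e: "cnj (f r) * \<zeta>\<^sup>2 * C0 = of_real (s\<^sup>2 / (2 * t)) * (cnj (f r) * H) - of_real (r * s / t) * P + of_real ((s / t)\<^sup>2) * P\<^sup>2" .
    have "Im (cnj (f r) * \<zeta>\<^sup>2 * C0) = s\<^sup>2 / (2 * t) * (Re (f r) * Im H - Im (f r) * Re H) - r * s / t * Im P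
        + (s / t)\<^sup>2 * (2 * Re P * Im P)"
      unfolding e by (simp only: Im_complex_of_real Re_complex_of_real minus_complex.sel plus_complex.sel times_complex.sel
          power2_eq_square complex_cnj) simp
    also have "\<dots> = c * B"
      using st by (simp add: c_def power_divide mult_ac)
    finally have "\<bar>c\<bar> * B \<le> norm (cnj (f r) * \<zeta>\<^sup>2 * C0)"
      using abs_Im_le_cmod[of "cnj (f r) * \<zeta>\<^sup>2 * C0"] st by (simp add: abs_mult)
    also have "\<dots> = norm C0 * B" using \<zeta> by (simp add: norm_mult norm_power B_def)
    finally have "\<bar>c\<bar> \<le> norm C0" using st by simp
    then show ?thesis using C0 nh n by simp
  qed
  ultimately show "\<exists>c. \<bar>c\<bar> \<le> 1 - (x\<^sup>2 + (Y r)\<^sup>2) \<and>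
           (Y has_real_derivative 2 / (1 - r\<^sup>2) * (c - (1 + B\<^sup>2) / (2 * B) * x * Y r)) (at r)"
    unfolding s_def by blast
qed

end

lemma borel_measurable_on_disk:
  assumes "continuous_on (ball 0 1) (f :: complex \<Rightarrow> complex)"
  shows "(\<lambda>z. if z \<in> ball 0 1 then f z else 0) \<in> borel_measurable borel"
  using assms by (intro borel_measurable_continuous_on_if) auto

lemma measurable_v_rad[measurable]: "v_rad \<in> borel_measurable borel"
  unfolding v_rad_def[abs_def] by measurable

lemma measurable_linear_distortion:
  assumes "F holomorphic_on ball 0 1"
  shows "(\<lambda>z. if z \<in> ball 0 1 then linear_distortion F z else 0) \<in> borel_measurable borel"
proof -
  define f g where "f = (\<lambda>z. if z \<in> ball 0 1 then F z else 0)"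
    and "g = (\<lambda>z. if z \<in> ball 0 1 then deriv F z else 0)"
  have [measurable]: "f \<in> borel_measurable borel" "g \<in> borel_measurable borel"
    unfolding f_def g_def
    using holomorphic_on_imp_continuous_on[OF assms]
      holomorphic_on_imp_continuous_on[OF holomorphic_deriv[OF assms open_ball]]
    by (simp_all only: borel_measurable_on_disk)
  have "(\<lambda>z. if z \<in> ball 0 1 then norm (1 - g z * v_rad z / v_rad (f z)) else 0) \<in> borel_measurable borel"
    by measurable
  then show ?thesis
    unfolding linear_distortion_def
    by (rule measurable_cong[THEN iffD1, rotated]) (auto simp: f_def g_def)
qed

lemma log_ratio_derivative:
  fixes r :: real assumes "0 \<le> r" "r < 1"
  shows "((\<lambda>r. ln (1 + r) - ln (1 - r)) has_real_derivative 2 / (1 - r\<^sup>2)) (at r)"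
proof -
  have 1: "(1 + r) * (1 - r) = 1 - r\<^sup>2" by (simp add: algebra_simps power2_eq_square)
  have "((\<lambda>r. ln (1 + r) - ln (1 - r)) has_real_derivative 1 / (1 + r) * 1 - 1 / (1 - r) * (- 1)) (at r)"
    by (intro DERIV_diff DERIV_chain2[OF DERIV_ln_divide]) (use assms in \<open>auto intro!: derivative_eq_intros\<close>)
  moreover have "1 / (1 + r) * 1 - 1 / (1 - r) * (- 1) = 2 / ((1 + r) * (1 - r))"
    using assms by (simp add: field_simps)
  ultimately show ?thesis by (simp add: 1)
qed

text \<open>
  The fundamental theorem holds for the gauge integral of any derivative, so a pointwise bound by a
  derivative is enough.
\<close>
lemma nn_integral_le_antiderivative:
  fixes f G :: "real \<Rightarrow> real"
  assumes "a \<le> b" and f: "\<And>x. x \<in> {a..b} \<Longrightarrow> 0 \<le> f x"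
    and G: "\<And>x. x \<in> {a..b} \<Longrightarrow> \<exists>D. (G has_real_derivative D) (at x) \<and> f x \<le> D"
  shows "(\<integral>\<^sup>+x. ennreal (f x) * indicator {a..b} x \<partial>lborel) \<le> ennreal (G b - G a)"
proof -
  define D where "D x = (SOME D. (G has_real_derivative D) (at x) \<and> f x \<le> D)" for x
  have D: "(G has_real_derivative D x) (at x)" "f x \<le> D x" if "x \<in> {a..b}" for x
    using someI_ex[OF G[OF that]] by (auto simp: D_def)
  have "(D has_integral (G b - G a)) {a..b}"
    using D \<open>a \<le> b\<close> by (intro fundamental_theorem_of_calculus)
      (auto simp: has_real_derivative_iff_has_vector_derivative[symmetric] intro: has_field_derivative_at_within)
  then have "(\<integral>\<^sup>+x. ennreal (D x) * indicator {a..b} x \<partial>lborel) = ennreal (G b - G a)"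
    using D f by (intro nn_integral_has_integral_lebesgue') (auto intro: order_trans)
  moreover have "(\<integral>\<^sup>+x. ennreal (f x) * indicator {a..b} x \<partial>lborel) \<le> (\<integral>\<^sup>+x. ennreal (D x) * indicator {a..b} x \<partial>lborel)"
    using D by (intro nn_integral_mono) (auto simp: indicator_def intro: ennreal_leI)
  ultimately show ?thesis by simp
qed

context disk_self_map
begin

text \<open>
  Integrates the differential inequality from \<open>r\<^sub>1\<close> to \<open>R\<close>: the term with \<open>y\<close> contributes at most \<open>|y| \<le> 1\<close> at
  the left endpoint, and the term with \<open>r - B x\<close> contributes the increase of the growth. Then \<open>\<epsilon>\<close> tends
  to 0.
\<close>
lemma radial_integral_away_from_zeros:
  assumes \<zeta>: "norm \<zeta> = 1" and R: "0 < r1" "r1 \<le> R" "R < 1"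
    and half: "\<And>r. r1 \<le> r \<Longrightarrow> r < 1 \<Longrightarrow> 1 / 2 \<le> norm (F (of_real r * \<zeta>))"
  shows "(\<integral>\<^sup>+r. ennreal (linear_distortion F (of_real r * \<zeta>) * (2 / (1 - r\<^sup>2))) * indicator {r1..R} r \<partial>lborel)
    \<le> ennreal (1 + 9 * (growth \<zeta> R - growth \<zeta> r1))" (is "?I \<le> _")
proof -
  define f where "f = (\<lambda>r. F (of_real r * \<zeta>))"
  define g where "g = (\<lambda>r. \<zeta> * deriv F (of_real r * \<zeta>))"
  define Y where "Y = (\<lambda>r. angle_defect r (Re (f r)) (Im (f r)) (Re (g r)) (Im (g r)))"
  define A where "A = (\<lambda>r::real. ln (1 + r) - ln (1 - r))"
  have bound: "?I \<le> ennreal (1 + 9 * (growth \<zeta> R - growth \<zeta> r1) + \<epsilon> * (1 + A R - A r1))"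
    if \<epsilon>: "\<epsilon> > 0" for \<epsilon> :: real
  proof -
    define \<sigma> where "\<sigma> = (\<lambda>r. sqrt (\<epsilon>\<^sup>2 + (Y r)\<^sup>2))"
    define G where "G = (\<lambda>r. - \<sigma> r + 9 * growth \<zeta> r + \<epsilon> * A r)"
    have "?I \<le> ennreal (G R - G r1)"
    proof (rule nn_integral_le_antiderivative[OF R(2)])
      fix r assume r: "r \<in> {r1..R}"
      then have r': "0 < r" "r < 1" "0 \<le> r" using R by auto
      have s: "1 - r\<^sup>2 > 0" using r' by (simp add: abs_square_less_1)
      show "0 \<le> linear_distortion F (of_real r * \<zeta>) * (2 / (1 - r\<^sup>2))"
        using s by (simp add: linear_distortion_def)
      define B where "B = norm (f r)"
      have B: "1 / 2 \<le> B" "B \<le> r"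
        using half[of r] r R schwarz[of "of_real r * \<zeta>"] \<zeta> r' by (auto simp: B_def f_def norm_mult)
      then have nz: "F (of_real r * \<zeta>) \<noteq> 0" by (auto simp: B_def f_def)
      define x where "x = Re (cnj (f r) * g r) * (1 - r\<^sup>2) / (B * (1 - B\<^sup>2))"
      have RA: "linear_distortion F (of_real r * \<zeta>) = sqrt ((1 - x)\<^sup>2 + (Y r)\<^sup>2)"
        "x\<^sup>2 + (Y r)\<^sup>2 \<le> 1"
        "\<exists>c. \<bar>c\<bar> \<le> 1 - (x\<^sup>2 + (Y r)\<^sup>2) \<and>
           (Y has_real_derivative 2 / (1 - r\<^sup>2) * (c - (1 + B\<^sup>2) / (2 * B) * x * Y r)) (at r)"
        unfolding x_def B_def Y_def f_def g_def by (rule radial_angle[OF \<zeta> r'(1,2) nz])+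
      obtain c where c: "\<bar>c\<bar> \<le> 1 - (x\<^sup>2 + (Y r)\<^sup>2)"
        and Y: "(Y has_real_derivative 2 / (1 - r\<^sup>2) * (c - (1 + B\<^sup>2) / (2 * B) * x * Y r)) (at r)"
        using RA(3) by blast
      define y' where "y' = c - (1 + B\<^sup>2) / (2 * B) * x * Y r"
      have \<sigma>0: "\<epsilon>\<^sup>2 + (Y r)\<^sup>2 > 0" using \<epsilon> by (simp add: add_pos_nonneg)
      have "((\<lambda>r. \<epsilon>\<^sup>2 + (Y r)\<^sup>2) has_real_derivative 2 * Y r * (2 / (1 - r\<^sup>2) * y')) (at r)"
        by (auto intro!: derivative_eq_intros Y[folded y'_def])
      then have \<sigma>: "(\<sigma> has_real_derivative inverse (\<sigma> r) / 2 * (2 * Y r * (2 / (1 - r\<^sup>2) * y'))) (at r)"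
        unfolding \<sigma>_def by (intro DERIV_chain2[OF DERIV_real_sqrt] \<sigma>0)
      have Bx: "Re (cnj (f r) * g r) * (1 - r\<^sup>2) / (1 - (norm (f r))\<^sup>2) = B * x"
        using B by (auto simp: x_def B_def)
      have gr: "(growth \<zeta> has_real_derivative 2 / (1 - r\<^sup>2) * (r - B * x)) (at r)"
        unfolding Bx[symmetric] f_def g_def by (rule growth_derivative(1)[OF \<zeta> r'(3,2)])
      have "(G has_real_derivative - (inverse (\<sigma> r) / 2 * (2 * Y r * (2 / (1 - r\<^sup>2) * y')))
         + 9 * (2 / (1 - r\<^sup>2) * (r - B * x)) + \<epsilon> * (2 / (1 - r\<^sup>2))) (at r)"
        unfolding G_def A_def
        by (intro DERIV_add DERIV_minus DERIV_cmult \<sigma> gr log_ratio_derivative r')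
      moreover have "- (inverse (\<sigma> r) / 2 * (2 * Y r * (2 / (1 - r\<^sup>2) * y')))
         + 9 * (2 / (1 - r\<^sup>2) * (r - B * x)) + \<epsilon> * (2 / (1 - r\<^sup>2))
         = (- (Y r * y' / \<sigma> r) + 9 * (r - B * x) + \<epsilon>) * (2 / (1 - r\<^sup>2))"
      proof -
        define W where "W = 2 / (1 - r\<^sup>2)"
        define K where "K = Y r * y' / \<sigma> r"
        have "inverse (\<sigma> r) / 2 * (2 * Y r * (W * y')) = K * W"
          by (simp add: K_def inverse_eq_divide)
        then show ?thesis unfolding W_def[symmetric] K_def[symmetric] by (simp only:) (simp add: algebra_simps)
      qed
      moreover have "linear_distortion F (of_real r * \<zeta>) \<le> - (Y r * y' / \<sigma> r) + 9 * (r - B * x) + \<epsilon>"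
        using distortion_differential_inequality[OF B r'(2) RA(2) c \<epsilon>]
        unfolding RA(1) \<sigma>_def y'_def .
      then have "linear_distortion F (of_real r * \<zeta>) * (2 / (1 - r\<^sup>2))
          \<le> (- (Y r * y' / \<sigma> r) + 9 * (r - B * x) + \<epsilon>) * (2 / (1 - r\<^sup>2))"
        using s by (intro mult_right_mono) auto
      ultimately show "\<exists>D. (G has_real_derivative D) (at r) \<and> linear_distortion F (of_real r * \<zeta>) * (2 / (1 - r\<^sup>2)) \<le> D"
        by auto
    qed
    also have "G R - G r1 \<le> 1 + 9 * (growth \<zeta> R - growth \<zeta> r1) + \<epsilon> * (1 + A R - A r1)"
    proof -
      have nz: "F (of_real r1 * \<zeta>) \<noteq> 0" using half[of r1] R by auto
      have "\<exists>x. x\<^sup>2 + (Y r1)\<^sup>2 \<le> 1"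
        unfolding Y_def f_def g_def using R by (intro exI) (rule radial_angle(2)[OF \<zeta> R(1) _ nz], simp)
      then obtain x where "x\<^sup>2 + (Y r1)\<^sup>2 \<le> 1" by blast
      then have "(Y r1)\<^sup>2 \<le> 1" using zero_le_power2[of x] by linarith
      then have "\<bar>Y r1\<bar> \<le> 1" by (simp add: abs_square_le_1)
      then have "\<sigma> r1 \<le> \<epsilon> + 1"
        using sqrt_add_le_add_sqrt[of "\<epsilon>\<^sup>2" "(Y r1)\<^sup>2"] \<epsilon> by (simp add: \<sigma>_def)
      moreover have "0 \<le> \<sigma> R" by (simp add: \<sigma>_def)
      ultimately show ?thesis by (simp add: G_def algebra_simps)
    qed
    finally show ?thesis by (simp add: ennreal_leI)
  qed
  have lim: "((\<lambda>\<epsilon>. ennreal (1 + 9 * (growth \<zeta> R - growth \<zeta> r1) + \<epsilon> * (1 + A R - A r1))) \<longlongrightarrow>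
      ennreal (1 + 9 * (growth \<zeta> R - growth \<zeta> r1) + 0 * (1 + A R - A r1))) (at_right 0)"
    by (intro tendsto_intros tendsto_ennrealI)
  have "eventually (\<lambda>\<epsilon>. ?I \<le> ennreal (1 + 9 * (growth \<zeta> R - growth \<zeta> r1) + \<epsilon> * (1 + A R - A r1))) (at_right 0)"
    using eventually_at_right_less[of "0::real"] by eventually_elim (rule bound)
  from tendsto_lowerbound[OF lim this] show ?thesis by simp
qed

text \<open>
  The growth bound keeps \<open>|F z| \<ge> 1/2\<close> beyond the radius \<open>r\<^sub>1\<close> with \<open>1 - r\<^sub>1\<^sup>2 = 3 / (4 |L|)\<close>. Up to \<open>r\<^sub>1\<close> the
  distortion is at most 2, and the hyperbolic length of this piece is at most
  \<open>log (4 / (1 - r\<^sub>1\<^sup>2)) = log |L| + log (16/3)\<close>. Beyond \<open>r\<^sub>1\<close> the previous lemma applies.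
\<close>
lemma radial_integral_bound:
  assumes \<zeta>: "norm \<zeta> = 1" and L: "has_angular_deriv F \<zeta> L"
  shows "1 \<le> norm L"
    and "(\<integral>\<^sup>+r. ennreal (linear_distortion F (of_real r * \<zeta>) * (2 / (1 - r\<^sup>2))) * indicator {0<..<1} r \<partial>lborel)
      \<le> ennreal (1 + 2 * ln (16 / 3) + 11 * ln (norm L))"
proof -
  define M where "M = norm L"
  have grM: "exp (growth \<zeta> r) \<le> M" if "0 \<le> r" "r < 1" for r
    unfolding M_def by (rule growth_le_angular_deriv[OF \<zeta> L that])
  have "growth \<zeta> 0 = 0" by (simp add: growth_def fixes_0)
  then have M: "1 \<le> M" using grM[of 0] by simp
  then show "1 \<le> norm L" by (simp add: M_def)
  have gr_ln: "growth \<zeta> r \<le> ln M" if "0 \<le> r" "r < 1" for r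
    using grM[OF that] M by (simp add: ln_ge_iff)
  have gr0: "0 \<le> growth \<zeta> r" if "0 \<le> r" "r < 1" for r
    using growth_mono[OF \<zeta>, of 0 r] that \<open>growth \<zeta> 0 = 0\<close> by simp
  define r1 where "r1 = sqrt (1 - 3 / (4 * M))"
  have q: "0 < 3 / (4 * M)" "3 / (4 * M) < 1" using M by auto
  have r1: "0 < r1" "r1 < 1" "1 - r1\<^sup>2 = 3 / (4 * M)"
    using q by (auto simp: r1_def)
  have half: "1 / 2 \<le> norm (F (of_real r * \<zeta>))" if r: "r1 \<le> r" "r < 1" for r
  proof -
    define B where "B = norm (F (of_real r * \<zeta>))"
    have nr: "norm (of_real r * \<zeta>) = r" using r r1 \<zeta> by (simp add: norm_mult)
    have s: "1 - r\<^sup>2 > 0" "1 - B\<^sup>2 > 0"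
      using one_minus_square_pos[of "of_real r * \<zeta>"] one_minus_square_pos[OF norm_lt_1[of "of_real r * \<zeta>"]] nr r
      by (auto simp: B_def)
    have "1 - B\<^sup>2 = exp (growth \<zeta> r) * (1 - r\<^sup>2)"
      using s by (simp add: growth_def exp_diff B_def[symmetric])
    also have "\<dots> \<le> M * (1 - r1\<^sup>2)"
      using grM[of r] r r1(1,2) s M power_mono[of r1 r 2] by (intro mult_mono) auto
    also have "\<dots> = 3 / 4" using r1 M by simp
    finally have "(1 / 2)\<^sup>2 \<le> B\<^sup>2" by (simp add: power2_eq_square)
    then show ?thesis unfolding B_def by (rule power2_le_imp_le) simp
  qed
  let ?d = "\<lambda>r. ennreal (linear_distortion F (of_real r * \<zeta>) * (2 / (1 - r\<^sup>2)))"
  have pos: "0 < 1 - r\<^sup>2" if "0 \<le> r" "r < 1" for r :: real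
    using that by (simp add: abs_square_less_1)
  define A where "A = (\<lambda>r::real. ln (1 + r) - ln (1 - r))"
  have "(\<integral>\<^sup>+r. ?d r * indicator {0..r1} r \<partial>lborel) \<le> ennreal (2 * A r1 - 2 * A 0)"
  proof (rule nn_integral_le_antiderivative)
    fix r assume r: "r \<in> {0..r1}"
    then have r': "0 \<le> r" "r < 1" using r1 by auto
    show "0 \<le> linear_distortion F (of_real r * \<zeta>) * (2 / (1 - r\<^sup>2))"
      using pos[OF r'] by (simp add: linear_distortion_def)
    have "linear_distortion F (of_real r * \<zeta>) \<le> 2"
      using r' \<zeta> by (intro linear_distortion_le_2) (simp add: norm_mult)
    then have "linear_distortion F (of_real r * \<zeta>) * (2 / (1 - r\<^sup>2)) \<le> 2 * (2 / (1 - r\<^sup>2))"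
      using pos[OF r'] by (intro mult_right_mono) auto
    moreover have "((\<lambda>r. 2 * A r) has_real_derivative 2 * (2 / (1 - r\<^sup>2))) (at r)"
      unfolding A_def by (intro DERIV_cmult log_ratio_derivative r')
    ultimately show "\<exists>D. ((\<lambda>r. 2 * A r) has_real_derivative D) (at r) \<and>
        linear_distortion F (of_real r * \<zeta>) * (2 / (1 - r\<^sup>2)) \<le> D" by blast
  qed (use r1 in auto)
  also have "2 * A r1 - 2 * A 0 \<le> 2 * ln (16 / 3) + 2 * ln M"
  proof -
    have "A r1 = ln ((1 + r1) / (1 - r1))" using r1 by (simp add: A_def ln_div)
    also have "(1 + r1) / (1 - r1) = (1 + r1) * (1 + r1) / ((1 - r1) * (1 + r1))"
      using r1 by simp
    also have "(1 - r1) * (1 + r1) = 1 - r1\<^sup>2" by (simp add: algebra_simps power2_eq_square)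
    also have "ln ((1 + r1) * (1 + r1) / (1 - r1\<^sup>2)) \<le> ln (2 * 2 / (1 - r1\<^sup>2))"
    proof -
      have "(1 + r1) * (1 + r1) \<le> 2 * 2" using r1 by (intro mult_mono) auto
      then show ?thesis using r1 pos[of r1] by (intro ln_mono divide_right_mono divide_pos_pos) auto
    qed
    also have "2 * 2 / (1 - r1\<^sup>2) = 16 / 3 * M" unfolding r1(3) using M by simp
    also have "ln \<dots> = ln (16 / 3) + ln M" using M by (subst ln_mult_pos) auto
    finally show ?thesis by (simp add: A_def)
  qed
  finally have I1: "(\<integral>\<^sup>+r. ?d r * indicator {0..r1} r \<partial>lborel) \<le> ennreal (2 * ln (16 / 3) + 2 * ln M)"
    by (simp add: ennreal_leI)
  define X where "X n = 1 - (1 - r1) / (real n + 1)" for n :: nat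
  have X: "r1 \<le> X n" "X n < 1" for n
    using r1 mult_right_mono[of r1 1 "real n"] by (auto simp: X_def field_simps)
  define \<delta> where "\<delta> z = (if z \<in> ball 0 1 then linear_distortion F z else 0)" for z
  have [measurable]: "\<delta> \<in> borel_measurable borel"
    unfolding \<delta>_def[abs_def] by (rule measurable_linear_distortion[OF hol])
  let ?e = "\<lambda>r. ennreal (\<delta> (of_real r * \<zeta>) * (2 / (1 - r\<^sup>2)))"
  have \<delta>: "\<delta> (of_real r * \<zeta>) = linear_distortion F (of_real r * \<zeta>)" if "0 \<le> r" "r < 1" for r
    using that \<zeta> by (simp add: \<delta>_def norm_mult)
  have "(\<integral>\<^sup>+r. ?e r * indicator {r1..<1} r \<partial>lborel) = (SUP n. (\<integral>\<^sup>+r. ?e r * indicator {r1..X n} r \<partial>lborel))"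
  proof -
    have "(SUP n. ?e r * indicator {r1..X n} r) = ?e r * indicator {r1..<1} r" for r
    proof -
      have "(SUP n. indicator {r1..X n} r :: ennreal) = indicator {r1..<1} r"
      proof (cases "r \<in> {r1..<1}")
        case True
        obtain n where "(1 - r1) / (1 - r) < real n" using reals_Archimedean2 by blast
        then have "(1 - r1) / (1 - r) \<le> real n + 1" by simp
        then have "r \<le> X n" using True by (auto simp: X_def field_simps)
        then have "(1::ennreal) \<le> (SUP n. indicator {r1..X n} r)"
          using True by (intro SUP_upper2[of n]) auto
        moreover have "(SUP n. indicator {r1..X n} r) \<le> (1::ennreal)"
          by (intro SUP_least) (auto simp: indicator_def)
        ultimately have "(SUP n. indicator {r1..X n} r) = (1::ennreal)"
          by (rule antisym[rotated])
        then show ?thesis using True by (simp only:) simp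
      next
        case False
        then have "indicator {r1..X n} r = (0::ennreal)" for n using X(2)[of n] by (auto simp: indicator_def)
        then show ?thesis using False by simp
      qed
      then show ?thesis by (simp only: SUP_mult_left_ennreal[symmetric])
    qed
    then have "(\<integral>\<^sup>+r. ?e r * indicator {r1..<1} r \<partial>lborel) = (\<integral>\<^sup>+r. (SUP n. ?e r * indicator {r1..X n} r) \<partial>lborel)"
      by simp
    also have "\<dots> = (SUP n. (\<integral>\<^sup>+r. ?e r * indicator {r1..X n} r \<partial>lborel))"
    proof (rule nn_integral_monotone_convergence_SUP)
      have "X m \<le> X n" if "m \<le> n" for m n
        using r1 that unfolding X_def by (intro diff_left_mono divide_left_mono) auto
      then show "incseq (\<lambda>n r. ?e r * indicator {r1..X n} r)"
        by (intro monoI le_funI mult_left_mono) (auto simp: indicator_def intro: order_trans)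
    qed measurable
    finally show ?thesis .
  qed
  also have "\<dots> \<le> ennreal (1 + 9 * ln M)"
  proof (rule SUP_least)
    fix n
    have "(\<integral>\<^sup>+r. ?e r * indicator {r1..X n} r \<partial>lborel) = (\<integral>\<^sup>+r. ?d r * indicator {r1..X n} r \<partial>lborel)"
      using X(2)[of n] r1 by (intro nn_integral_cong) (auto simp: indicator_def \<delta>)
    also have "\<dots> \<le> ennreal (1 + 9 * (growth \<zeta> (X n) - growth \<zeta> r1))"
      by (rule radial_integral_away_from_zeros[OF \<zeta> r1(1) X half])
    also have "\<dots> \<le> ennreal (1 + 9 * ln M)"
      using gr_ln[of "X n"] gr0[of r1] X[of n] r1 by (intro ennreal_leI) auto
    finally show "(\<integral>\<^sup>+r. ?e r * indicator {r1..X n} r \<partial>lborel) \<le> ennreal (1 + 9 * ln M)" .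
  qed
  finally have I2: "(\<integral>\<^sup>+r. ?e r * indicator {r1..<1} r \<partial>lborel) \<le> ennreal (1 + 9 * ln M)" .
  have "(\<integral>\<^sup>+r. ?d r * indicator {0<..<1} r \<partial>lborel)
      \<le> (\<integral>\<^sup>+r. ?e r * indicator {0..r1} r + ?e r * indicator {r1..<1} r \<partial>lborel)"
    using r1 by (intro nn_integral_mono) (auto simp: indicator_def \<delta>)
  also have "\<dots> = (\<integral>\<^sup>+r. ?e r * indicator {0..r1} r \<partial>lborel) + (\<integral>\<^sup>+r. ?e r * indicator {r1..<1} r \<partial>lborel)"
    by (rule nn_integral_add) measurable
  also have "(\<integral>\<^sup>+r. ?e r * indicator {0..r1} r \<partial>lborel) = (\<integral>\<^sup>+r. ?d r * indicator {0..r1} r \<partial>lborel)"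
    using r1 by (intro nn_integral_cong) (auto simp: indicator_def \<delta>)
  also have "\<dots> + (\<integral>\<^sup>+r. ?e r * indicator {r1..<1} r \<partial>lborel) \<le> ennreal (2 * ln (16 / 3) + 2 * ln M) + ennreal (1 + 9 * ln M)"
    by (intro add_mono I1 I2)
  also have "\<dots> = ennreal (1 + 2 * ln (16 / 3) + 11 * ln M)"
    using M by (subst ennreal_plus[symmetric]) auto
  finally show "(\<integral>\<^sup>+r. ?d r * indicator {0<..<1} r \<partial>lborel)
      \<le> ennreal (1 + 2 * ln (16 / 3) + 11 * ln (norm L))"
    unfolding M_def .
qed

end

section \<open>Integrability of the linear distortion\<close>

text \<open>
  The density is the Green function of the disk with pole at 0.
\<close>
definition green_measure :: "complex measure" where
  "green_measure = density hyp_area (\<lambda>z. ennreal (ln (1 / norm z)))"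

lemma sets_green_measure [simp, measurable_cong]: "sets green_measure = sets borel"
  by (simp add: green_measure_def hyp_area_def)

lemma space_green_measure [simp]: "space green_measure = UNIV"
  by (simp add: green_measure_def hyp_area_def)

lemma nn_integral_green_measure:
  assumes [measurable]: "f \<in> borel_measurable borel"
  shows "(\<integral>\<^sup>+z. f z \<partial>green_measure) =
    (\<integral>\<^sup>+z. f z * ennreal (ln (1 / norm z) * (4 / (1 - (norm z)\<^sup>2)\<^sup>2)) * indicator (ball 0 1) z \<partial>lborel)"
proof -
  have [measurable]: "(\<lambda>z. indicator (ball (0::complex) 1) z * ennreal (4 / (1 - (norm z)\<^sup>2)\<^sup>2)) \<in> borel_measurable borel"
    by measurable
  have "(\<integral>\<^sup>+z. f z \<partial>green_measure) = (\<integral>\<^sup>+z. (indicator (ball 0 1) z * ennreal (4 / (1 - (norm z)\<^sup>2)\<^sup>2)) * (ennreal (ln (1 / norm z)) * f z) \<partial>lborel)"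
    unfolding green_measure_def hyp_area_def
    by (subst nn_integral_density, simp, simp)+ simp
  also have "\<dots> = (\<integral>\<^sup>+z. f z * ennreal (ln (1 / norm z) * (4 / (1 - (norm z)\<^sup>2)\<^sup>2)) * indicator (ball 0 1) z \<partial>lborel)"
  proof (rule nn_integral_cong)
    fix z :: complex
    have "ennreal (ln (1 / norm z) * (4 / (1 - (norm z)\<^sup>2)\<^sup>2)) = ennreal (ln (1 / norm z)) * ennreal (4 / (1 - (norm z)\<^sup>2)\<^sup>2)"
      by (rule ennreal_mult'') simp
    then show "(indicator (ball 0 1) z * ennreal (4 / (1 - (norm z)\<^sup>2)\<^sup>2)) * (ennreal (ln (1 / norm z)) * f z)
      = f z * ennreal (ln (1 / norm z) * (4 / (1 - (norm z)\<^sup>2)\<^sup>2)) * indicator (ball 0 1) z"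
      by (simp only: mult_ac)
  qed
  finally show ?thesis .
qed

lemma emeasure_green_measure:
  assumes A: "A \<in> sets borel"
  shows "emeasure green_measure A = (\<integral>\<^sup>+z\<in>A. ennreal (ln (1 / norm z)) \<partial>hyp_area)"
  unfolding green_measure_def using A by (subst emeasure_density) (auto simp: hyp_area_def)

lemma measurable_cis [measurable]: "cis \<in> borel_measurable borel"
  by (intro borel_measurable_continuous_onI continuous_intros)

lemma AE_circle_measure: "AE \<zeta> in circle_measure. norm \<zeta> = 1"
  unfolding circle_measure_def by (subst AE_distr_iff) auto

lemma nn_integral_circle_measure:
  assumes [measurable]: "g \<in> borel_measurable borel"
  shows "(\<integral>\<^sup>+\<zeta>. g \<zeta> \<partial>circle_measure) = (\<integral>\<^sup>+\<theta>. g (cis \<theta>) * indicator {0..<2 * pi} \<theta> \<partial>lborel) / ennreal (2 * pi)"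
proof -
  have "(\<integral>\<^sup>+\<zeta>. g \<zeta> \<partial>circle_measure) = (\<integral>\<^sup>+\<theta>. g (cis \<theta>) \<partial>uniform_measure lborel {0..<2 * pi})"
    unfolding circle_measure_def by (rule nn_integral_distr) auto
  also have "\<dots> = (\<integral>\<^sup>+\<theta>. g (cis \<theta>) * indicator {0..<2 * pi} \<theta> \<partial>lborel) / emeasure lborel {0..<2 * pi}"
    by (rule nn_integral_uniform_measure) auto
  finally show ?thesis by simp
qed

context disk_self_map
begin

text \<open>
  Extended by 0 beyond the disk, to be Borel measurable on the plane.
\<close>
definition \<delta> :: "complex \<Rightarrow> real" where
  "\<delta> z = (if z \<in> ball 0 1 then linear_distortion F z else 0)"

lemma measurable_\<delta> [measurable]: "\<delta> \<in> borel_measurable borel"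
  unfolding \<delta>_def[abs_def] by (rule measurable_linear_distortion[OF hol])

lemma \<delta>_nonneg: "0 \<le> \<delta> z"
  by (simp add: \<delta>_def linear_distortion_def)

definition radial_integral :: "complex \<Rightarrow> ennreal" where
  "radial_integral \<zeta> = (\<integral>\<^sup>+r. ennreal (\<delta> (of_real r * \<zeta>) * (2 / (1 - r\<^sup>2))) * indicator {0<..<1} r \<partial>lborel)"

lemma measurable_radial_integral [measurable]: "radial_integral \<in> borel_measurable borel"
  unfolding radial_integral_def[abs_def]
  by (rule lborel.borel_measurable_nn_integral) measurable

lemma radial_integral_le:
  assumes \<zeta>: "norm \<zeta> = 1"
  shows "radial_integral \<zeta> \<le> ennreal (1 + 2 * ln (16 / 3)) + 11 * e2ennreal (log_angular_deriv F \<zeta>)"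
proof (cases "\<exists>L. has_angular_deriv F \<zeta> L")
  case True
  then obtain L where L: "has_angular_deriv F \<zeta> L" by blast
  have "(THE L. has_angular_deriv F \<zeta> L) = L"
    using L has_angular_deriv_unique[OF \<zeta>] by blast
  then have "angular_deriv_modulus F \<zeta> = ennreal (norm L)"
    using L by (auto simp: angular_deriv_modulus_def)
  then have e: "e2ennreal (log_angular_deriv F \<zeta>) = ennreal (ln (norm L))"
    by (simp add: log_angular_deriv_def)
  have "radial_integral \<zeta> = (\<integral>\<^sup>+r. ennreal (linear_distortion F (of_real r * \<zeta>) * (2 / (1 - r\<^sup>2))) * indicator {0<..<1} r \<partial>lborel)"
    unfolding radial_integral_def using \<zeta>
    by (intro nn_integral_cong) (auto simp: indicator_def \<delta>_def norm_mult)
  also have "\<dots> \<le> ennreal (1 + 2 * ln (16 / 3) + 11 * ln (norm L))"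
    by (rule radial_integral_bound(2)[OF \<zeta> L])
  also have "\<dots> = ennreal (1 + 2 * ln (16 / 3)) + 11 * ennreal (ln (norm L))"
    using radial_integral_bound(1)[OF \<zeta> L] by (subst ennreal_plus) (auto simp: ennreal_mult)
  finally show ?thesis using e by simp
next
  case False
  then have "e2ennreal (log_angular_deriv F \<zeta>) = \<infinity>"
    by (simp add: log_angular_deriv_def angular_deriv_modulus_def)
  then show ?thesis by (simp add: ennreal_mult_top)
qed

text \<open>
  For integrands that are not known to be Borel, such as the logarithm of the angular derivative, the
  integral is monotone but not additive. So the pointwise bound is first solved for this logarithm, which
  leaves a Borel function on the smaller side.
\<close>
lemma radial_integral_integrable:
  assumes "finite_lyapunov_exponent F"
  shows "(\<integral>\<^sup>+\<zeta>. radial_integral \<zeta> \<partial>circle_measure) < \<infinity>"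
proof -
  define C where "C = ennreal (1 + 2 * ln (16 / 3))"
  have sc[measurable_cong, simp]: "sets circle_measure = sets borel" by (simp add: circle_measure_def)
  have "(\<integral>\<^sup>+\<zeta>. (radial_integral \<zeta> - C) / 11 \<partial>circle_measure)
      \<le> (\<integral>\<^sup>+\<zeta>. e2ennreal (log_angular_deriv F \<zeta>) \<partial>circle_measure)"
  proof (rule nn_integral_mono_AE, use AE_circle_measure in eventually_elim)
    fix \<zeta> :: complex assume "norm \<zeta> = 1"
    then have "radial_integral \<zeta> - C \<le> 11 * e2ennreal (log_angular_deriv F \<zeta>)"
      using radial_integral_le[of \<zeta>] by (simp add: C_def ennreal_minus_le_iff)
    then have "(radial_integral \<zeta> - C) / 11 \<le> (11 * e2ennreal (log_angular_deriv F \<zeta>)) / 11"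
      by (rule divide_right_mono_ennreal)
    also have "\<dots> = e2ennreal (log_angular_deriv F \<zeta>)"
      by (simp add: ennreal_times_divide[symmetric] mult.commute[of 11] ennreal_mult_divide_eq)
    finally show "(radial_integral \<zeta> - C) / 11 \<le> e2ennreal (log_angular_deriv F \<zeta>)" .
  qed
  also have "\<dots> < \<infinity>" using assms by (simp add: finite_lyapunov_exponent_def)
  also have "(\<integral>\<^sup>+\<zeta>. (radial_integral \<zeta> - C) / 11 \<partial>circle_measure) = (\<integral>\<^sup>+\<zeta>. radial_integral \<zeta> - C \<partial>circle_measure) / 11"
    by (rule nn_integral_divide) measurable
  finally have fin: "(\<integral>\<^sup>+\<zeta>. radial_integral \<zeta> - C \<partial>circle_measure) < \<infinity>"
    by (auto simp: ennreal_divide_eq_top_iff less_top[symmetric])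
  have "(\<integral>\<^sup>+\<zeta>. radial_integral \<zeta> \<partial>circle_measure) \<le> (\<integral>\<^sup>+\<zeta>. (radial_integral \<zeta> - C) + C \<partial>circle_measure)"
    by (intro nn_integral_mono) (metis add.commute ennreal_minus_le_iff order_refl C_def ennreal_neq_top)
  also have "\<dots> = (\<integral>\<^sup>+\<zeta>. radial_integral \<zeta> - C \<partial>circle_measure) + (\<integral>\<^sup>+\<zeta>. C \<partial>circle_measure)"
    by (rule nn_integral_add) measurable
  also have "(\<integral>\<^sup>+\<zeta>. C \<partial>circle_measure) = C"
    by (subst nn_integral_circle_measure) (auto simp: nn_integral_cmult_indicator ennreal_mult_divide_eq)
  also have "(\<integral>\<^sup>+\<zeta>. radial_integral \<zeta> - C \<partial>circle_measure) + C < \<infinity>"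
    using fin by (simp add: C_def)
  finally show ?thesis .
qed

text \<open>
  In polar coordinates the density of the Green measure is at most twice that of hyperbolic length on
  radii times the angle, because \<open>r log (1/r) \<le> 1 - r \<le> 1 - r\<^sup>2\<close>.
\<close>
theorem linear_distortion_integrable:
  assumes "finite_lyapunov_exponent F"
  shows "(\<integral>\<^sup>+z. ennreal (\<delta> z) \<partial>green_measure) < \<infinity>"
proof -
  define X where "X = (\<integral>\<^sup>+\<theta>. radial_integral (cis \<theta>) * indicator {0..<2 * pi} \<theta> \<partial>lborel)"
  have X: "X < \<infinity>"
    using radial_integral_integrable[OF assms] nn_integral_circle_measure[of radial_integral]
    by (auto simp: X_def ennreal_divide_eq_top_iff less_top[symmetric])
  let ?h = "\<lambda>z. ennreal (\<delta> z) * ennreal (ln (1 / norm z) * (4 / (1 - (norm z)\<^sup>2)\<^sup>2))"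
  have "(\<integral>\<^sup>+z. ennreal (\<delta> z) \<partial>green_measure) = (\<integral>\<^sup>+z. ?h z * indicator (ball 0 1) z \<partial>lborel)"
    by (rule nn_integral_green_measure) measurable
  also have "\<dots> \<le> (\<integral>\<^sup>+\<theta>. (\<integral>\<^sup>+r. ?h (of_real r * cis \<theta>) * ennreal r * indicator {0<..<1} r \<partial>lborel) * indicator {0<..<2 * pi} \<theta> \<partial>lborel)"
    by (rule nn_integral_disk_polar_le) measurable
  also have "\<dots> \<le> (\<integral>\<^sup>+\<theta>. 2 * (radial_integral (cis \<theta>) * indicator {0..<2 * pi} \<theta>) \<partial>lborel)"
  proof (rule nn_integral_mono)
    fix \<theta> :: real
    have "(\<integral>\<^sup>+r. ?h (of_real r * cis \<theta>) * ennreal r * indicator {0<..<1} r \<partial>lborel)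
      \<le> (\<integral>\<^sup>+r. 2 * (ennreal (\<delta> (of_real r * cis \<theta>) * (2 / (1 - r\<^sup>2))) * indicator {0<..<1} r) \<partial>lborel)"
    proof (rule nn_integral_mono)
      fix r :: real
      show "?h (of_real r * cis \<theta>) * ennreal r * indicator {0<..<1} r
        \<le> 2 * (ennreal (\<delta> (of_real r * cis \<theta>) * (2 / (1 - r\<^sup>2))) * indicator {0<..<1} r)"
      proof (cases "r \<in> {0<..<1}")
        case True
        then have r: "0 < r" "r < 1" by auto
        have s: "0 < 1 - r\<^sup>2" using r by (simp add: abs_square_less_1)
        have "ln (1 / r) \<le> 1 / r - 1" using r by (intro ln_le_minus_one) simp
        then have "ln (1 / r) * r \<le> (1 / r - 1) * r" using r by (intro mult_right_mono) auto
        also have "\<dots> = 1 - r" using r by (simp add: field_simps)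
        also have "\<dots> \<le> 1 - r\<^sup>2" using r by (simp add: power2_eq_square mult_left_le)
        finally have "ln (1 / r) * r * (4 / (1 - r\<^sup>2)\<^sup>2) \<le> (1 - r\<^sup>2) * (4 / (1 - r\<^sup>2)\<^sup>2)"
          by (intro mult_right_mono) auto
        also have "\<dots> = 2 * (2 / (1 - r\<^sup>2))"
        proof -
          have "S * (4 / S\<^sup>2) = 2 * (2 / S)" if "S > 0" for S :: real
            using that by (simp add: power2_eq_square)
          then show ?thesis using s by blast
        qed
        finally have "\<delta> (of_real r * cis \<theta>) * (ln (1 / r) * r * (4 / (1 - r\<^sup>2)\<^sup>2)) \<le> \<delta> (of_real r * cis \<theta>) * (2 * (2 / (1 - r\<^sup>2)))"
          by (intro mult_left_mono \<delta>_nonneg)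
        then have "ennreal (\<delta> (of_real r * cis \<theta>) * (ln (1 / r) * (4 / (1 - r\<^sup>2)\<^sup>2)) * r) \<le> ennreal (2 * (\<delta> (of_real r * cis \<theta>) * (2 / (1 - r\<^sup>2))))"
          by (intro ennreal_leI) (simp add: mult_ac)
        moreover have "ennreal (2 * (\<delta> (of_real r * cis \<theta>) * (2 / (1 - r\<^sup>2)))) = 2 * ennreal (\<delta> (of_real r * cis \<theta>) * (2 / (1 - r\<^sup>2)))"
          by (subst ennreal_mult') simp_all
        moreover have "ennreal (\<delta> (of_real r * cis \<theta>) * (ln (1 / r) * (4 / (1 - r\<^sup>2)\<^sup>2)) * r)
          = ?h (of_real r * cis \<theta>) * ennreal r"
        proof -
          have n: "norm (of_real r * cis \<theta>) = r" using r by (simp add: norm_mult)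
          show ?thesis
            unfolding n ennreal_mult'[OF \<delta>_nonneg, symmetric] using r by (intro ennreal_mult'') simp
        qed
        ultimately show ?thesis using True by (simp only: indicator_simps mult_1_right)
      qed simp
    qed
    also have "\<dots> = 2 * radial_integral (cis \<theta>)"
      unfolding radial_integral_def by (rule nn_integral_cmult) measurable
    finally show "(\<integral>\<^sup>+r. ?h (of_real r * cis \<theta>) * ennreal r * indicator {0<..<1} r \<partial>lborel) * indicator {0<..<2 * pi} \<theta>
      \<le> 2 * (radial_integral (cis \<theta>) * indicator {0..<2 * pi} \<theta>)"
      by (auto simp: indicator_def)
  qed
  also have "\<dots> = 2 * X"
    unfolding X_def by (rule nn_integral_cmult) measurable
  finally show ?thesis using X by (auto simp: less_top[symmetric] ennreal_mult_eq_top_iff top_unique)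
qed

end

section \<open>Littlewood's inequality\<close>

lemma norm_at_0_le_prod_zeros:
  assumes "finite W" "W \<subseteq> ball 0 1" "f holomorphic_on ball 0 1"
    "\<And>z. z \<in> ball 0 1 \<Longrightarrow> norm (f z) \<le> 1" "\<And>w. w \<in> W \<Longrightarrow> f w = 0"
  shows "norm (f 0) \<le> (\<Prod>w\<in>W. norm w)"
  using assms
proof (induction W arbitrary: f rule: finite_induct)
  case empty
  then show ?case by simp
next
  case (insert v W)
  obtain g where g: "g holomorphic_on ball 0 1"
    "\<And>z. z \<in> ball 0 1 \<Longrightarrow> f z * (1 - cnj v * z) = g z * (z - v)"
    "\<And>z. z \<in> ball 0 1 \<Longrightarrow> norm (g z) \<le> (1::real)"
    by (rule blaschke_quotient[OF insert.prems(2,3), of v]) (use insert.prems in auto)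
  have "norm (g 0) \<le> (\<Prod>w\<in>W. norm w)"
  proof (rule insert.IH)
    show "g w = 0" if "w \<in> W" for w
      using g(2)[of w] insert.prems(1,4) insert.hyps that by auto
  qed (use insert.prems g in auto)
  moreover have "norm (f 0) = norm v * norm (g 0)"
    using arg_cong[OF g(2)[of 0], of norm] by (simp add: norm_mult)
  ultimately show ?case using insert.hyps by (simp add: mult_left_mono)
qed

context disk_self_map
begin

text \<open>
  Littlewood's inequality for the counting function: a Moebius transformation of the target makes the
  points of \<open>W\<close> zeros of a function bounded by 1, whose modulus at 0 is \<open>|z|\<close>.
\<close>
lemma sum_log_preimages_le:
  assumes "finite W" "W \<subseteq> ball 0 1" and z: "norm z < 1" "z \<noteq> 0" and W: "\<And>w. w \<in> W \<Longrightarrow> F w = z"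
  shows "(\<Sum>w\<in>W. ln (1 / norm w)) \<le> ln (1 / norm z)"
proof -
  have ne: "1 - cnj z * F u \<noteq> 0" and le': "norm (F u - z) \<le> norm (1 - cnj z * F u)" if "u \<in> ball 0 1" for u
    using norm_denominator_ge[of z "F u"] norm_lt_1[of u] z(1) that by auto
  let ?f = "\<lambda>u. (F u - z) / (1 - cnj z * F u)"
  have "norm (?f 0) \<le> (\<Prod>w\<in>W. norm w)"
  proof (rule norm_at_0_le_prod_zeros)
    show "?f holomorphic_on ball 0 1"
      using ne hol by (intro holomorphic_intros) auto
    show "norm (?f u) \<le> 1" if "u \<in> ball 0 1" for u
      using ne[OF that] le'[OF that] by (simp add: norm_divide divide_le_eq_1)
  qed (use assms in auto)
  then have le: "norm z \<le> (\<Prod>w\<in>W. norm w)" by (simp add: fixes_0)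
  have nz: "norm w > 0" if "w \<in> W" for w using W[OF that] fixes_0 z by auto
  have "ln (norm z) \<le> ln (\<Prod>w\<in>W. norm w)"
    using le z(2) nz by (subst ln_le_cancel_iff) (auto intro!: prod_pos)
  also have "\<dots> = (\<Sum>w\<in>W. ln (norm w))"
    using nz \<open>finite W\<close> by (intro ln_prod) auto
  finally have 1: "ln (norm z) \<le> (\<Sum>w\<in>W. ln (norm w))" .
  have "(\<Sum>w\<in>W. ln (1 / norm w)) = - (\<Sum>w\<in>W. ln (norm w))"
    using nz by (subst sum_negf[symmetric], intro sum.cong) (auto simp: ln_div)
  moreover have "ln (1 / norm z) = - ln (norm z)" using z by (simp add: ln_div)
  ultimately show ?thesis using 1 by linarith
qed

text \<open>
  \<open>F\<close> and its derivative, extended by 0 beyond the disk to be Borel measurable on the plane.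
\<close>
definition F0 :: "complex \<Rightarrow> complex" where "F0 w = (if w \<in> ball 0 1 then F w else 0)"
definition dF0 :: "complex \<Rightarrow> complex" where "dF0 w = (if w \<in> ball 0 1 then deriv F w else 0)"

lemma measurable_F0 [measurable]: "F0 \<in> borel_measurable borel"
  unfolding F0_def[abs_def] by (intro borel_measurable_on_disk holomorphic_on_imp_continuous_on hol)

lemma measurable_dF0 [measurable]: "dF0 \<in> borel_measurable borel"
  unfolding dF0_def[abs_def]
  by (intro borel_measurable_on_disk holomorphic_on_imp_continuous_on holomorphic_deriv[OF hol open_ball])

lemma locally_injective_cover:
  "\<exists>U :: nat \<Rightarrow> complex set. (\<forall>n. open (U n) \<and> U n \<subseteq> ball 0 1 \<and> inj_on F (U n)) \<and>
     (\<Union>n. U n) = {w \<in> ball 0 1. deriv F w \<noteq> 0}"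
proof -
  define C where "C = {U. open U \<and> U \<subseteq> {w \<in> ball 0 1. deriv F w \<noteq> 0} \<and> inj_on F U}"
  have op: "open {w \<in> ball 0 1. deriv F w \<noteq> 0}"
  proof -
    have "open (ball 0 1 \<inter> deriv F -` (- {0}))"
      by (rule continuous_open_preimage[OF holomorphic_on_imp_continuous_on[OF holomorphic_deriv[OF hol open_ball]] open_ball]) auto
    moreover have "ball 0 1 \<inter> deriv F -` (- {0}) = {w \<in> ball 0 1. deriv F w \<noteq> 0}" by auto
    ultimately show ?thesis by simp
  qed
  have un: "\<Union>C = {w \<in> ball 0 1. deriv F w \<noteq> 0}"
  proof (intro equalityI subsetI)
    fix w assume w: "w \<in> {w \<in> ball 0 1. deriv F w \<noteq> 0}"
    have "F holomorphic_on {w \<in> ball 0 1. deriv F w \<noteq> 0}"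
      using hol by (rule holomorphic_on_subset) auto
    then obtain r where "r > 0" "ball w r \<subseteq> {w \<in> ball 0 1. deriv F w \<noteq> 0}" "inj_on F (ball w r)"
      by (rule has_complex_derivative_locally_injective[OF _ w op]) (use w in auto)
    then have "ball w r \<in> C" "w \<in> ball w r" by (auto simp: C_def)
    then show "w \<in> \<Union>C" by blast
  qed (auto simp: C_def)
  obtain C' where C': "C' \<subseteq> C" "countable C'" "\<Union>C' = \<Union>C"
    by (rule Lindelof[of C]) (auto simp: C_def)
  have "{} \<in> C" by (auto simp: C_def)
  define U where "U = from_nat_into (insert {} C')"
  have r: "range U = insert {} C'"
    unfolding U_def using C'(2) by (intro range_from_nat_into) auto
  have in_C: "U n \<in> C" for n
    using r C'(1) \<open>{} \<in> C\<close> by (metis insertE rangeI subsetD)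
  have "(\<Union>n. U n) = \<Union>C'" using r by (simp add: Union_insert)
  moreover have "open (U n) \<and> U n \<subseteq> ball 0 1 \<and> inj_on F (U n)" for n
    using in_C[of n] unfolding C_def by blast
  ultimately show ?thesis
    unfolding C'(3) un by blast
qed

text \<open>
  The disk without the critical points is cut into countably many Borel pieces on which \<open>F\<close> is injective.
  Changing variables on each piece turns the left side into the integral of \<open>h z\<close> times the sum of
  \<open>log (1/|w|)\<close> over the noncritical preimages \<open>w\<close> of \<open>z\<close>, each of which lies in exactly one piece.
\<close>
lemma littlewood_area:
  assumes h[measurable]: "h \<in> borel_measurable borel"
  shows "(\<integral>\<^sup>+w. h (F0 w) * ennreal (ln (1 / norm w)) * ennreal ((norm (dF0 w))\<^sup>2) * indicator (ball 0 1) w \<partial>lborel)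
    \<le> (\<integral>\<^sup>+z. h z * ennreal (ln (1 / norm z)) * indicator (ball 0 1) z \<partial>lborel)"
proof -
  obtain U :: "nat \<Rightarrow> complex set"
    where U': "\<forall>n. open (U n) \<and> U n \<subseteq> ball 0 1 \<and> inj_on F (U n)"
      and U_Un: "(\<Union>n. U n) = {w \<in> ball 0 1. deriv F w \<noteq> 0}"
    using locally_injective_cover by (elim exE conjE)
  have U: "open (U n)" "U n \<subseteq> ball 0 1" "inj_on F (U n)" for n
    using U'[rule_format, of n] by simp_all
  define S where "S = disjointed U"
  have S: "S n \<subseteq> U n" "disjoint_family S" "(\<Union>n. S n) = {w \<in> ball 0 1. deriv F w \<noteq> 0}" for n
    unfolding S_def U_Un[symmetric] by (auto simp: disjointed_subset disjoint_family_disjointed UN_disjointed_eq)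
  have [measurable]: "U n \<in> sets borel" for n using U(1) by simp
  then have "range U \<subseteq> sets borel" by blast
  then have S_meas[measurable]: "S n \<in> sets borel" for n
    unfolding S_def using sets.range_disjointed_sets[of U borel] by blast
  have hU: "F holomorphic_on U n" for n
    using hol U(2) by (rule holomorphic_on_subset)
  have ofU: "open (F ` U n)" for n
    by (rule open_mapping_thm3[OF hU U(1) U(3)])
  have "\<forall>n. \<exists>g. g holomorphic_on (F ` U n) \<and> (\<forall>w\<in>U n. g (F w) = w)"
    using holomorphic_has_inverse[OF hU U(1) U(3)] by metis
  then obtain G where G: "\<And>n. G n holomorphic_on (F ` U n)" "\<And>n w. w \<in> U n \<Longrightarrow> G n (F w) = w"
    by metis
  define G0 where "G0 n z = (if z \<in> F ` U n then G n z else 0)" for n z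
  have [measurable]: "G0 n \<in> borel_measurable borel" for n
    unfolding G0_def[abs_def] using ofU G(1)
    by (intro borel_measurable_continuous_on_if) (auto intro: holomorphic_on_imp_continuous_on)
  have [measurable]: "F ` U n \<in> sets borel" for n using ofU by simp
  define k where "k n z = h z * indicator (S n) (G0 n z) * ennreal (ln (1 / norm (G0 n z)))" for n z
  have [measurable]: "k n \<in> borel_measurable borel" for n
    unfolding k_def[abs_def] by measurable
  define t where "t w = h (F0 w) * ennreal (ln (1 / norm w)) * ennreal ((norm (dF0 w))\<^sup>2)" for w
  have [measurable]: "t \<in> borel_measurable borel" unfolding t_def[abs_def] by measurable
  have piece: "(\<integral>\<^sup>+w. t w * indicator (S n) w \<partial>lborel) = (\<integral>\<^sup>+z. k n z * indicator (F ` U n) z \<partial>lborel)" for n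
  proof -
    have "(\<integral>\<^sup>+w. t w * indicator (S n) w \<partial>lborel)
        = (\<integral>\<^sup>+w. k n (F w) * ennreal ((norm (deriv F w))\<^sup>2) * indicator (U n) w \<partial>lborel)"
    proof (rule nn_integral_cong)
      fix w
      show "t w * indicator (S n) w = k n (F w) * ennreal ((norm (deriv F w))\<^sup>2) * indicator (U n) w"
      proof (cases "w \<in> U n")
        case True
        then have "G0 n (F w) = w" "w \<in> ball 0 1" using G(2)[OF True] subsetD[OF U(2) True] True by (simp_all add: G0_def)
        then show ?thesis using True by (simp add: t_def k_def F0_def dF0_def mult_ac)
      next
        case False
        then show ?thesis using S(1) by (auto simp: indicator_def)
      qed
    qed
    also have "\<dots> = (\<integral>\<^sup>+z. k n z * indicator (F ` U n) z \<partial>lborel)"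
      by (rule nn_integral_injective_holomorphic[OF hU U(1) U(3)]) measurable
    finally show ?thesis .
  qed
  have "(\<integral>\<^sup>+w. t w * indicator (ball 0 1) w \<partial>lborel) = (\<integral>\<^sup>+w. (\<Sum>n. t w * indicator (S n) w) \<partial>lborel)"
  proof (rule nn_integral_cong)
    fix w
    have "(\<Sum>n. t w * indicator (S n) w) = t w * (\<Sum>n. indicator (S n) w)"
      by (rule ennreal_suminf_cmult)
    also have "(\<Sum>n. indicator (S n) w :: ennreal) = indicator (\<Union>n. S n) w"
      by (rule suminf_indicator[OF S(2)])
    finally show "t w * indicator (ball 0 1) w = (\<Sum>n. t w * indicator (S n) w)"
      unfolding S(3) by (auto simp: t_def dF0_def indicator_def)
  qed
  also have "\<dots> = (\<Sum>n. \<integral>\<^sup>+w. t w * indicator (S n) w \<partial>lborel)"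
    by (rule nn_integral_suminf) measurable
  also have "\<dots> = (\<integral>\<^sup>+z. (\<Sum>n. k n z * indicator (F ` U n) z) \<partial>lborel)"
    unfolding piece by (rule nn_integral_suminf[symmetric]) measurable
  also have "\<dots> \<le> (\<integral>\<^sup>+z. h z * ennreal (ln (1 / norm z)) * indicator (ball 0 1) z \<partial>lborel)"
  proof (rule nn_integral_mono_AE, use AE_lborel_singleton[of 0] in eventually_elim)
    fix z :: complex assume z: "z \<noteq> 0"
    show "(\<Sum>n. k n z * indicator (F ` U n) z) \<le> h z * ennreal (ln (1 / norm z)) * indicator (ball 0 1) z"
    proof (cases "z \<in> ball 0 1")
      case False
      have "z \<notin> F ` U n" for n
        using False norm_lt_1 U(2)[of n] by (auto simp: subset_iff)
      then show ?thesis by simp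
    next
      case True
      show ?thesis
      proof (rule suminf_le_const)
        fix N
        define I where "I = {n. n < N \<and> z \<in> F ` U n \<and> G n z \<in> S n}"
        have fin: "finite I" by (simp add: I_def)
        have Gz: "G n z \<in> ball 0 1" "F (G n z) = z" "G n z \<in> S n" if n: "n \<in> I" for n
        proof -
          obtain w where w: "w \<in> U n" "z = F w" using n by (auto simp: I_def)
          then show "G n z \<in> ball 0 1" "F (G n z) = z"
            using G(2)[OF w(1)] subsetD[OF U(2) w(1)] by simp_all
          show "G n z \<in> S n" using n by (simp add: I_def)
        qed
        \<comment> \<open>distinct pieces contribute distinct preimages of \<open>z\<close>\<close>
        have inj: "inj_on (\<lambda>n. G n z) I"
        proof (rule inj_onI)
          fix m n assume "m \<in> I" "n \<in> I" "G m z = G n z"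
          then show "m = n" using S(2) Gz(3) by (metis IntI disjoint_family_onD empty_iff UNIV_I)
        qed
        have pos: "0 \<le> ln (1 / norm (G n z))" if "n \<in> I" for n
        proof -
          have "G n z \<noteq> 0" using Gz(2)[OF that] z fixes_0 by auto
          then show ?thesis
            using Gz(1)[OF that] by (intro ln_ge_zero) (simp add: le_divide_eq)
        qed
        have "(\<Sum>n<N. k n z * indicator (F ` U n) z) = (\<Sum>n\<in>I. h z * ennreal (ln (1 / norm (G n z))))"
          by (rule sum.mono_neutral_cong_right) (auto simp: I_def k_def G0_def indicator_def)
        also have "\<dots> = h z * ennreal (\<Sum>n\<in>I. ln (1 / norm (G n z)))"
        proof -
          have "(\<Sum>n\<in>I. ennreal (ln (1 / norm (G n z)))) = ennreal (\<Sum>n\<in>I. ln (1 / norm (G n z)))"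
            using pos by (rule sum_ennreal)
          then show ?thesis by (simp only: sum_distrib_left[symmetric])
        qed
        also have "\<dots> \<le> h z * ennreal (ln (1 / norm z))"
        proof -
          have "(\<Sum>n\<in>I. ln (1 / norm (G n z))) = (\<Sum>w\<in>(\<lambda>n. G n z) ` I. ln (1 / norm w))"
            using inj by (simp add: sum.reindex)
          also have "\<dots> \<le> ln (1 / norm z)"
            using True z Gz fin by (intro sum_log_preimages_le) auto
          finally show ?thesis by (intro mult_left_mono ennreal_leI) auto
        qed
        finally show "(\<Sum>n<N. k n z * indicator (F ` U n) z) \<le> h z * ennreal (ln (1 / norm z)) * indicator (ball 0 1) z"
          using True by simp
      qed simp
    qed
  qed
  finally show ?thesis by (simp add: t_def)
qed

definition sq_hyp_deriv :: "complex \<Rightarrow> real" where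
  "sq_hyp_deriv w = ((norm (dF0 w)) * (1 - (norm w)\<^sup>2) / (1 - (norm (F0 w))\<^sup>2))\<^sup>2"

lemma measurable_sq_hyp_deriv [measurable]: "sq_hyp_deriv \<in> borel_measurable borel"
  unfolding sq_hyp_deriv_def[abs_def] by measurable

lemma sq_hyp_deriv_eq: "w \<in> ball 0 1 \<Longrightarrow> sq_hyp_deriv w = (hyp_deriv w)\<^sup>2"
  by (simp add: sq_hyp_deriv_def dF0_def F0_def hyp_deriv_def)

text \<open>
  The preceding lemma for \<open>h = g\<close> times the hyperbolic density, since \<open>sq_hyp_deriv\<close> is the
  factor by which \<open>F\<close> scales hyperbolic area.
\<close>
theorem littlewood_green:
  assumes [measurable]: "g \<in> borel_measurable borel"
  shows "(\<integral>\<^sup>+w. g (F0 w) * ennreal (sq_hyp_deriv w) \<partial>green_measure) \<le> (\<integral>\<^sup>+z. g z \<partial>green_measure)"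
proof -
  define h where "h z = g z * ennreal (4 / (1 - (norm z)\<^sup>2)\<^sup>2)" for z
  have [measurable]: "h \<in> borel_measurable borel" unfolding h_def[abs_def] by measurable
  have split: "ennreal (ln (1 / norm z) * (4 / (1 - (norm z)\<^sup>2)\<^sup>2)) = ennreal (ln (1 / norm z)) * ennreal (4 / (1 - (norm z)\<^sup>2)\<^sup>2)" for z :: complex
    by (rule ennreal_mult'') simp
  have "(\<integral>\<^sup>+w. g (F0 w) * ennreal (sq_hyp_deriv w) \<partial>green_measure)
      = (\<integral>\<^sup>+w. g (F0 w) * ennreal (sq_hyp_deriv w) * ennreal (ln (1 / norm w) * (4 / (1 - (norm w)\<^sup>2)\<^sup>2)) * indicator (ball 0 1) w \<partial>lborel)"
    by (rule nn_integral_green_measure) measurable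
  also have "\<dots> = (\<integral>\<^sup>+w. h (F0 w) * ennreal (ln (1 / norm w)) * ennreal ((norm (dF0 w))\<^sup>2) * indicator (ball 0 1) w \<partial>lborel)"
  proof (rule nn_integral_cong)
    fix w :: complex
    show "g (F0 w) * ennreal (sq_hyp_deriv w) * ennreal (ln (1 / norm w) * (4 / (1 - (norm w)\<^sup>2)\<^sup>2)) * indicator (ball 0 1) w
      = h (F0 w) * ennreal (ln (1 / norm w)) * ennreal ((norm (dF0 w))\<^sup>2) * indicator (ball 0 1) w"
    proof (cases "w \<in> ball 0 1")
      case True
      then have s: "1 - (norm w)\<^sup>2 > 0" using one_minus_square_pos by simp
      define s where "s = 1 - (norm w)\<^sup>2"
      define t where "t = 1 - (norm (F0 w))\<^sup>2"
      have "sq_hyp_deriv w * (4 / s\<^sup>2) = 4 / t\<^sup>2 * (norm (dF0 w))\<^sup>2"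
        using s by (simp add: sq_hyp_deriv_def s_def[symmetric] t_def[symmetric] power_divide power_mult_distrib)
      then have e: "ennreal (sq_hyp_deriv w) * ennreal (4 / s\<^sup>2) = ennreal (4 / t\<^sup>2) * ennreal ((norm (dF0 w))\<^sup>2)"
        by (simp add: ennreal_mult'[symmetric] sq_hyp_deriv_def)
      have "a * ennreal (sq_hyp_deriv w) * (l * ennreal (4 / s\<^sup>2)) * i = a * ennreal (4 / t\<^sup>2) * l * ennreal ((norm (dF0 w))\<^sup>2) * i" for a l i
      proof -
        have "a * ennreal (sq_hyp_deriv w) * (l * ennreal (4 / s\<^sup>2)) * i = a * l * i * (ennreal (sq_hyp_deriv w) * ennreal (4 / s\<^sup>2))"
          by (simp only: mult_ac)
        also have "\<dots> = a * ennreal (4 / t\<^sup>2) * l * ennreal ((norm (dF0 w))\<^sup>2) * i"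
          unfolding e by (simp only: mult_ac)
        finally show ?thesis .
      qed
      then show ?thesis
        unfolding split h_def s_def t_def .
    qed simp
  qed
  also have "\<dots> \<le> (\<integral>\<^sup>+z. h z * ennreal (ln (1 / norm z)) * indicator (ball 0 1) z \<partial>lborel)"
    by (rule littlewood_area) measurable
  also have "\<dots> = (\<integral>\<^sup>+z. g z * ennreal (ln (1 / norm z) * (4 / (1 - (norm z)\<^sup>2)\<^sup>2)) * indicator (ball 0 1) z \<partial>lborel)"
    unfolding split h_def by (simp only: mult_ac)
  also have "\<dots> = (\<integral>\<^sup>+z. g z \<partial>green_measure)"
    by (rule nn_integral_green_measure[symmetric]) measurable
  finally show ?thesis .
qed

end

section \<open>Distortion on the preimages of a wandering set\<close>

text \<open>
  Truncation at 1 makes it affordable to insert the factor \<open>H\<close>: the error is at most \<open>1 - H \<le> 2 d\<close>.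
\<close>
lemma min_one_add_le:
  fixes d R H :: real
  assumes "0 \<le> d" "0 \<le> R" "0 \<le> H" "H \<le> 1" "1 - H \<le> 2 * d"
  shows "min 1 (d + R) \<le> 3 * d + H * min 1 R"
proof -
  define K where "K = min 1 R"
  have "(1 - H) * K \<le> (1 - H) * 1" using assms by (intro mult_left_mono) (auto simp: K_def)
  then have "K \<le> (1 - H) + H * K" by (simp add: algebra_simps)
  moreover have "min 1 (d + R) \<le> d + K" using assms by (auto simp: K_def)
  ultimately have "min 1 (d + R) \<le> d + ((1 - H) + H * K)" by (meson add_left_mono order_trans)
  also have "\<dots> \<le> 3 * d + H * K" using assms(5) by simp
  finally show ?thesis by (simp only: K_def)
qed

context disk_self_map
begin

lemma F0_in_disk: "w \<in> ball 0 1 \<Longrightarrow> F0 w \<in> ball 0 1"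
  using norm_lt_1[of w] by (simp add: F0_def)

lemma funpow_F0: "w \<in> ball 0 1 \<Longrightarrow> (F0 ^^ n) w = (F ^^ n) w" "w \<in> ball 0 1 \<Longrightarrow> (F ^^ n) w \<in> ball 0 1"
proof -
  have "(F0 ^^ n) w = (F ^^ n) w \<and> (F ^^ n) w \<in> ball 0 1" if "w \<in> ball 0 1"
    using that by (induction n) (auto simp: F0_def norm_lt_1)
  then show "w \<in> ball 0 1 \<Longrightarrow> (F0 ^^ n) w = (F ^^ n) w" "w \<in> ball 0 1 \<Longrightarrow> (F ^^ n) w \<in> ball 0 1"
    by auto
qed

lemma measurable_funpow_F0 [measurable]: "(F0 ^^ n) \<in> borel_measurable borel"
proof (induction n)
  case (Suc n)
  then show ?case unfolding funpow.simps by (intro measurable_comp[OF Suc]) measurable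
qed (simp add: id_def)

definition preimage_disk :: "complex set \<Rightarrow> nat \<Rightarrow> complex set" where
  "preimage_disk A m = {w \<in> ball 0 1. (F0 ^^ m) w \<in> A}"

lemma preimage_disk_borel [measurable]:
  assumes [measurable]: "A \<in> sets borel"
  shows "preimage_disk A m \<in> sets borel"
proof -
  have "{w \<in> space borel. w \<in> ball 0 1 \<and> (F0 ^^ m) w \<in> A} \<in> sets borel" by measurable
  then show ?thesis by (simp add: preimage_disk_def)
qed

lemma preimage_disk_Suc: "w \<in> preimage_disk A (Suc m) \<longleftrightarrow> w \<in> ball 0 1 \<and> F0 w \<in> preimage_disk A m"
  unfolding preimage_disk_def by (auto simp: funpow_swap1 dest: F0_in_disk[simplified])

definition orbit_distortion :: "nat \<Rightarrow> complex \<Rightarrow> real" where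
  "orbit_distortion J w = (\<Sum>j<J. \<delta> ((F0 ^^ j) w))"

lemma measurable_orbit_distortion [measurable]: "orbit_distortion J \<in> borel_measurable borel"
  unfolding orbit_distortion_def[abs_def] by measurable

lemma orbit_distortion_nonneg: "0 \<le> orbit_distortion J w"
  unfolding orbit_distortion_def by (intro sum_nonneg \<delta>_nonneg)

lemma orbit_distortion_Suc: "orbit_distortion (Suc J) w = \<delta> w + orbit_distortion J (F0 w)"
  unfolding orbit_distortion_def by (subst sum.lessThan_Suc_shift) (simp add: funpow_swap1)

definition layer_distortion :: "complex set \<Rightarrow> nat \<Rightarrow> ennreal" where
  "layer_distortion A m = (\<integral>\<^sup>+w. ennreal (\<delta> w) * indicator (preimage_disk A m) w \<partial>green_measure)"

text \<open>
  The distortion of \<open>J + 1\<close> steps from \<open>w\<close> is \<open>\<delta> w\<close> plus that of \<open>J\<close> steps from \<open>F w\<close>. Replacing \<open>min 1\<close> of the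
  latter by its product with \<open>H\<close> costs another \<open>2 \<delta> w\<close>, and then \<open>littlewood_green\<close> moves the integral
  from the preimage of order \<open>m\<close> to that of order \<open>m - 1\<close>.
\<close>
lemma orbit_distortion_integral_le:
  assumes [measurable]: "A \<in> sets borel"
  shows "J \<le> m \<Longrightarrow> (\<integral>\<^sup>+w. ennreal (min 1 (orbit_distortion J w)) * indicator (preimage_disk A m) w \<partial>green_measure)
    \<le> 3 * (\<Sum>j<J. layer_distortion A (m - j))"
proof (induction J arbitrary: m)
  case 0
  then show ?case by (simp add: orbit_distortion_def)
next
  case (Suc J)
  then obtain m' where m: "m = Suc m'" "J \<le> m'" by (cases m) auto
  let ?g = "\<lambda>z. ennreal (min 1 (orbit_distortion J z)) * indicator (preimage_disk A m') z"
  have "(\<integral>\<^sup>+w. ennreal (min 1 (orbit_distortion (Suc J) w)) * indicator (preimage_disk A m) w \<partial>green_measure)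
     \<le> (\<integral>\<^sup>+w. 3 * (ennreal (\<delta> w) * indicator (preimage_disk A m) w) + ?g (F0 w) * ennreal (sq_hyp_deriv w) \<partial>green_measure)"
  proof (rule nn_integral_mono)
    fix w
    show "ennreal (min 1 (orbit_distortion (Suc J) w)) * indicator (preimage_disk A m) w
       \<le> 3 * (ennreal (\<delta> w) * indicator (preimage_disk A m) w) + ?g (F0 w) * ennreal (sq_hyp_deriv w)"
    proof (cases "w \<in> preimage_disk A m")
      case True
      then have w: "w \<in> ball 0 1" "F0 w \<in> preimage_disk A m'"
        unfolding m preimage_disk_Suc by auto
      then have nw: "norm w < 1" by simp
      have "0 \<le> sq_hyp_deriv w" "sq_hyp_deriv w \<le> 1"
        using hyp_deriv_bounds[OF nw] by (auto simp: sq_hyp_deriv_eq[OF w(1)] abs_square_le_1)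
      moreover have "1 - sq_hyp_deriv w \<le> 2 * \<delta> w"
        using contraction_defect_le[OF nw] w(1) by (simp add: sq_hyp_deriv_eq[OF w(1)] \<delta>_def)
      ultimately have "min 1 (orbit_distortion (Suc J) w) \<le> 3 * \<delta> w + sq_hyp_deriv w * min 1 (orbit_distortion J (F0 w))"
        unfolding orbit_distortion_Suc by (intro min_one_add_le \<delta>_nonneg orbit_distortion_nonneg)
      then have "ennreal (min 1 (orbit_distortion (Suc J) w)) \<le> ennreal (3 * \<delta> w + sq_hyp_deriv w * min 1 (orbit_distortion J (F0 w)))"
        by (rule ennreal_leI)
      also have "\<dots> = ennreal (3 * \<delta> w) + ennreal (sq_hyp_deriv w * min 1 (orbit_distortion J (F0 w)))"
        using \<open>0 \<le> sq_hyp_deriv w\<close> \<delta>_nonneg orbit_distortion_nonneg by (intro ennreal_plus) auto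
      also have "ennreal (3 * \<delta> w) = 3 * ennreal (\<delta> w)"
        by (subst ennreal_mult') simp_all
      also have "ennreal (sq_hyp_deriv w * min 1 (orbit_distortion J (F0 w))) = ennreal (min 1 (orbit_distortion J (F0 w))) * ennreal (sq_hyp_deriv w)"
        using \<open>0 \<le> sq_hyp_deriv w\<close> by (simp add: ennreal_mult' mult.commute)
      finally show ?thesis using True w by simp
    qed simp
  qed
  also have "\<dots> = 3 * layer_distortion A m + (\<integral>\<^sup>+w. ?g (F0 w) * ennreal (sq_hyp_deriv w) \<partial>green_measure)"
    unfolding layer_distortion_def by (subst nn_integral_add) (auto simp: nn_integral_cmult)
  also have "(\<integral>\<^sup>+w. ?g (F0 w) * ennreal (sq_hyp_deriv w) \<partial>green_measure) \<le> (\<integral>\<^sup>+z. ?g z \<partial>green_measure)"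
    by (rule littlewood_green) measurable
  also have "\<dots> \<le> 3 * (\<Sum>j<J. layer_distortion A (m' - j))"
    by (rule Suc.IH[OF m(2)])
  finally show ?case
    by (subst sum.lessThan_Suc_shift) (simp add: m distrib_left add_left_mono)
qed

text \<open>
  An orbit that leaves this set has modulus at most \<open>s\<close> ever after, so it never returns.
\<close>
definition wandering :: "real \<Rightarrow> complex set" where
  "wandering s = {z \<in> ball 0 1. norm (F0 z) \<le> s \<and> s < norm z}"

lemma wandering_borel [measurable]: "wandering s \<in> sets borel"
proof -
  have "{z \<in> space borel. z \<in> ball 0 1 \<and> norm (F0 z) \<le> s \<and> s < norm z} \<in> sets borel" by measurable
  then show ?thesis by (simp add: wandering_def)
qed

lemma norm_funpow_F0_le:
  assumes "w \<in> ball 0 1" shows "norm ((F0 ^^ n) w) \<le> norm w"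
proof (induction n)
  case (Suc n)
  have "(F0 ^^ n) w \<in> ball 0 1" using funpow_F0[OF assms] by simp
  then have "norm (F0 ((F0 ^^ n) w)) \<le> norm ((F0 ^^ n) w)" using schwarz by (simp add: F0_def)
  then show ?case using Suc by simp
qed simp

lemma preimage_wandering_disjoint: "disjoint_family (preimage_disk (wandering s))"
proof -
  have no: "w \<notin> preimage_disk (wandering s) n" if w: "w \<in> preimage_disk (wandering s) m" and "m < n" for w m n
  proof
    assume n: "w \<in> preimage_disk (wandering s) n"
    define u where "u = F0 ((F0 ^^ m) w)"
    have u: "norm u \<le> s" using w by (simp add: preimage_disk_def wandering_def u_def)
    have "u \<in> ball 0 1" unfolding u_def using w funpow_F0 F0_in_disk by (auto simp: preimage_disk_def simp del: mem_ball)
    obtain k where k: "n = k + Suc m" using \<open>m < n\<close> by (metis less_imp_Suc_add add.commute add_Suc)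
    have "(F0 ^^ n) w = (F0 ^^ k) u" unfolding k funpow_add u_def by simp
    then have "s < norm ((F0 ^^ k) u)" using n by (simp add: preimage_disk_def wandering_def)
    then show False using norm_funpow_F0_le[OF \<open>u \<in> ball 0 1\<close>, of k] u by linarith
  qed
  show ?thesis
    unfolding disjoint_family_on_def
  proof (intro ballI impI)
    fix m n :: nat assume "m \<noteq> n"
    then consider "m < n" | "n < m" by linarith
    then show "preimage_disk (wandering s) m \<inter> preimage_disk (wandering s) n = {}"
      by cases (use no[of _ m n] no[of _ n m] in blast)+
  qed
qed

lemma layer_distortion_summable:
  assumes "finite_lyapunov_exponent F"
  shows "(\<Sum>m. layer_distortion (wandering s) m) < \<infinity>"
proof -
  have "(\<Sum>m. layer_distortion (wandering s) m) = (\<integral>\<^sup>+w. (\<Sum>m. ennreal (\<delta> w) * indicator (preimage_disk (wandering s) m) w) \<partial>green_measure)"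
    unfolding layer_distortion_def by (rule nn_integral_suminf[symmetric]) measurable
  also have "\<dots> \<le> (\<integral>\<^sup>+w. ennreal (\<delta> w) \<partial>green_measure)"
  proof (rule nn_integral_mono)
    fix w
    have "(\<Sum>m. ennreal (\<delta> w) * indicator (preimage_disk (wandering s) m) w)
        = ennreal (\<delta> w) * indicator (\<Union>m. preimage_disk (wandering s) m) w"
      unfolding ennreal_suminf_cmult suminf_indicator[OF preimage_wandering_disjoint] ..
    also have "\<dots> \<le> ennreal (\<delta> w)" by (auto simp: indicator_def)
    finally show "(\<Sum>m. ennreal (\<delta> w) * indicator (preimage_disk (wandering s) m) w) \<le> ennreal (\<delta> w)" .
  qed
  also have "\<dots> < \<infinity>" by (rule linear_distortion_integrable[OF assms])
  finally show ?thesis .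
qed

definition tail_bound :: "real \<Rightarrow> nat \<Rightarrow> ennreal" where
  "tail_bound s N = 3 * (\<Sum>n. layer_distortion (wandering s) (n + Suc N))"

lemma tail_bound_tendsto_0:
  assumes "finite_lyapunov_exponent F"
  shows "tail_bound s \<longlonglongrightarrow> 0"
proof -
  let ?d = "layer_distortion (wandering s)"
  have fin: "(\<Sum>m. ?d m) \<noteq> top"
    using layer_distortion_summable[OF assms, of s] unfolding infinity_ennreal_def by (rule less_imp_neq)
  define e where "e n = enn2real (?d n)" for n
  have d: "?d n = ennreal (e n)" for n
  proof -
    have "?d n \<le> (\<Sum>m. ?d m)" using sum_le_suminf[of ?d "{n}"] by simp
    then have "?d n \<noteq> top" using fin by (rule neq_top_trans[rotated])
    then show ?thesis by (simp add: e_def ennreal_enn2real_if)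
  qed
  have e0: "0 \<le> e n" for n by (simp add: e_def)
  have sum: "summable e"
    using fin e0 by (intro summable_suminf_not_top) (simp_all add: d)
  have "(\<lambda>N. \<Sum>n. e (n + N)) \<longlonglongrightarrow> 0"
    by (rule suminf_exist_split2[OF sum])
  then have "(\<lambda>N. \<Sum>n. e (n + Suc N)) \<longlonglongrightarrow> 0"
    by (rule LIMSEQ_Suc)
  then have "(\<lambda>N. 3 * ennreal (\<Sum>n. e (n + Suc N))) \<longlonglongrightarrow> 3 * ennreal 0"
    by (intro ennreal_tendsto_cmult tendsto_ennrealI) auto
  moreover have "tail_bound s = (\<lambda>N. 3 * ennreal (\<Sum>n. e (n + Suc N)))"
  proof
    show "tail_bound s N = 3 * ennreal (\<Sum>n. e (n + Suc N))" for N
      unfolding tail_bound_def d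
      using suminf_ennreal2[of "\<lambda>n. e (n + Suc N)"] summable_ignore_initial_segment[OF sum, of "Suc N"] e0
      by (simp only:)
  qed
  ultimately show ?thesis by (simp only: ennreal_0 mult_zero_right)
qed

text \<open>
  The bound is uniform in \<open>m\<close>, which is what allows the passage to the limit that defines \<open>\<xi>\<close>.
\<close>
lemma green_measure_large_distortion_le:
  assumes "N \<le> m"
  shows "emeasure green_measure {w \<in> preimage_disk (wandering s) m. 1 \<le> orbit_distortion (m - N) w} \<le> tail_bound s N"
proof -
  let ?A = "wandering s"
  let ?B = "{w \<in> preimage_disk ?A m. 1 \<le> orbit_distortion (m - N) w}"
  have [measurable]: "?B \<in> sets borel"
  proof -
    have "preimage_disk ?A m \<inter> {w \<in> space borel. 1 \<le> orbit_distortion (m - N) w} \<in> sets borel" by measurable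
    then show ?thesis by (simp add: Int_def)
  qed
  have "emeasure green_measure ?B = (\<integral>\<^sup>+w. indicator ?B w \<partial>green_measure)"
    by (rule nn_integral_indicator[symmetric]) simp
  also have "\<dots> \<le> (\<integral>\<^sup>+w. ennreal (min 1 (orbit_distortion (m - N) w)) * indicator (preimage_disk ?A m) w \<partial>green_measure)"
    by (intro nn_integral_mono) (auto simp: indicator_def min_def)
  also have "\<dots> \<le> 3 * (\<Sum>j<m - N. layer_distortion ?A (m - j))"
    by (rule orbit_distortion_integral_le) auto
  also have "(\<Sum>j<m - N. layer_distortion ?A (m - j)) = (\<Sum>n<m - N. layer_distortion ?A (n + Suc N))"
    by (rule sum.reindex_bij_witness[where i = "\<lambda>n. m - Suc N - n" and j = "\<lambda>j. m - Suc N - j"]) (auto simp: Suc_diff_Suc)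
  also have "3 * (\<Sum>n<m - N. layer_distortion ?A (n + Suc N)) \<le> tail_bound s N"
    unfolding tail_bound_def by (intro mult_left_mono sum_le_suminf) auto
  finally show ?thesis .
qed

lemma orbit_distortion_shift_le: "orbit_distortion J ((F0 ^^ k) w) \<le> orbit_distortion (J + k) w"
proof -
  have "orbit_distortion J ((F0 ^^ k) w) = (\<Sum>j\<in>{k..<J + k}. \<delta> ((F0 ^^ j) w))"
    unfolding orbit_distortion_def
    by (rule sum.reindex_bij_witness[where i = "\<lambda>j. j - k" and j = "\<lambda>j. j + k"]) (auto simp: funpow_add)
  also have "\<dots> \<le> orbit_distortion (J + k) w"
    unfolding orbit_distortion_def by (rule sum_mono2) (auto simp: \<delta>_nonneg)
  finally show ?thesis .
qed

end

section \<open>Almost every inverse orbit has finite distortion\<close>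

locale inverse_orbit_system = disk_self_map +
  fixes \<xi> :: "(nat \<Rightarrow> complex) measure"
  assumes not_rotation: "\<not> is_rotation F"
    and finite_exponent: "finite_lyapunov_exponent F"
    and orbit_measure: "is_inverse_orbit_measure F \<xi>"
begin

lemma space_\<xi>: "space \<xi> = inverse_orbits F"
  and sets_\<xi>: "sets \<xi> = sets (restrict_space borel (inverse_orbits F))"
  and shift_measurable: "shift_map F \<in> measurable \<xi> \<xi>"
  and shift_invariant: "distr \<xi> \<xi> (shift_map F) = \<xi>"
  using orbit_measure by (simp_all add: is_inverse_orbit_measure_def)

lemma orbit_in_disk: "z \<in> inverse_orbits F \<Longrightarrow> z n \<in> ball 0 1"
  and orbit_step: "z \<in> inverse_orbits F \<Longrightarrow> F (z (Suc n)) = z n"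
  by (simp_all add: inverse_orbits_def)

lemma orbit_funpow: "z \<in> inverse_orbits F \<Longrightarrow> (F0 ^^ m) (z (m + n)) = z n"
proof (induction m)
  case (Suc m)
  have "F0 (z (Suc (m + n))) = z (m + n)"
    using orbit_in_disk[OF Suc.prems, of "Suc (m + n)"] orbit_step[OF Suc.prems, of "m + n"] by (simp add: F0_def)
  then show ?case
    using Suc by (simp only: funpow_Suc_right comp_apply add_Suc)
qed simp

lemma measurable_coordinate [measurable]: "(\<lambda>z. z n) \<in> borel_measurable \<xi>"
proof -
  have "(\<lambda>z :: nat \<Rightarrow> complex. z n) \<in> borel_measurable borel"
    by (intro borel_measurable_continuous_onI continuous_on_product_coordinates)
  then have "(\<lambda>z. z n) \<in> borel_measurable (restrict_space borel (inverse_orbits F))"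
    by (rule measurable_restrict_space1)
  then show ?thesis
    using measurable_cong_sets[OF sets_\<xi> refl] by blast
qed

definition cylinder :: "nat \<Rightarrow> complex set \<Rightarrow> (nat \<Rightarrow> complex) set" where
  "cylinder k B = {z \<in> space \<xi>. z k \<in> B}"

lemma cylinder_measurable [measurable]: "B \<in> sets borel \<Longrightarrow> cylinder k B \<in> sets \<xi>"
  using measurable_sets[OF measurable_coordinate, of B k]
  by (simp add: cylinder_def vimage_def Int_def conj_commute)

text \<open>
  The entry with number \<open>k + 1\<close> of the shifted orbit is the entry with number \<open>k\<close> of the orbit, and the
  shift preserves \<open>\<xi>\<close>. So all entries have the same distribution.
\<close>
lemma emeasure_cylinder:
  assumes [measurable]: "B \<in> sets borel"
  shows "emeasure \<xi> (cylinder k B) = emeasure \<xi> (cylinder 0 B)"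
proof (induction k)
  case (Suc k)
  have "emeasure \<xi> (cylinder (Suc k) B) = emeasure (distr \<xi> \<xi> (shift_map F)) (cylinder (Suc k) B)"
    by (simp add: shift_invariant)
  also have "\<dots> = emeasure \<xi> (shift_map F -` cylinder (Suc k) B \<inter> space \<xi>)"
    by (rule emeasure_distr[OF shift_measurable]) measurable
  also have "shift_map F -` cylinder (Suc k) B \<inter> space \<xi> = cylinder k B"
    using measurable_space[OF shift_measurable]
    by (auto simp: cylinder_def shift_map_def orbit_step space_\<xi>)
  finally show ?case using Suc by simp
qed simp

lemma emeasure_cylinder_limit:
  assumes A: "A \<in> sets borel" "compact (closure A)" "closure A \<subseteq> ball 0 1"
  shows "(\<lambda>n. ennreal (1 / (2 * pi)) * emeasure green_measure (preimage_disk A n))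
    \<longlonglongrightarrow> emeasure \<xi> (cylinder 0 A)"
proof -
  have "{z \<in> ball 0 1. (F ^^ n) z \<in> A} = preimage_disk A n" for n
    using funpow_F0(1) by (auto simp: preimage_disk_def)
  moreover have "(\<integral>\<^sup>+z\<in>preimage_disk A n. ennreal (ln (1 / norm z)) \<partial>hyp_area) = emeasure green_measure (preimage_disk A n)" for n
    using A(1) by (intro emeasure_green_measure[symmetric] preimage_disk_borel)
  moreover have "(\<lambda>n. ennreal (1 / (2 * pi)) *
              (\<integral>\<^sup>+z\<in>{z \<in> ball 0 1. (F ^^ n) z \<in> A}. ennreal (ln (1 / norm z)) \<partial>hyp_area))
          \<longlonglongrightarrow> emeasure \<xi> {z \<in> inverse_orbits F. z 0 \<in> A}"
    using orbit_measure A by (simp add: is_inverse_orbit_measure_def)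
  ultimately show ?thesis by (simp add: cylinder_def space_\<xi>)
qed

text \<open>
  The limit that defines \<open>\<xi>\<close> is only given for sets whose closure lies in the disk, so \<open>B\<close> is exhausted by
  its intersections with smaller disks. The factor \<open>1 / (2 \<pi>)\<close> is dropped.
\<close>
lemma emeasure_cylinder_le:
  assumes B[measurable]: "B \<in> sets borel" and "B \<subseteq> ball 0 1"
    and le: "\<And>n. emeasure green_measure (preimage_disk B n) \<le> c"
  shows "emeasure \<xi> (cylinder k B) \<le> c"
proof -
  define R where "R r = 1 - 1 / (real r + 2)" for r :: nat
  define C where "C r = B \<inter> cball 0 (R r)" for r
  have [measurable]: "C r \<in> sets borel" for r unfolding C_def by measurable
  have "emeasure \<xi> (cylinder 0 (C r)) \<le> c" for r
  proof (rule LIMSEQ_le_const2[OF emeasure_cylinder_limit])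
    show "C r \<in> sets borel" by measurable
    have cl: "closure (C r) \<subseteq> cball 0 (R r)" by (rule closure_minimal) (auto simp: C_def)
    moreover have "R r < 1" by (simp add: R_def)
    ultimately show "closure (C r) \<subseteq> ball 0 1" by fastforce
    show "compact (closure (C r))"
      using bounded_subset[OF bounded_cball cl] by (simp add: compact_eq_bounded_closed)
    have "ennreal (1 / (2 * pi)) * emeasure green_measure (preimage_disk (C r) n) \<le> 1 * c" for n
    proof (rule mult_mono)
      show "ennreal (1 / (2 * pi)) \<le> 1" using pi_gt3 by simp
      have "emeasure green_measure (preimage_disk (C r) n) \<le> emeasure green_measure (preimage_disk B n)"
        by (rule emeasure_mono) (auto simp: preimage_disk_def C_def preimage_disk_borel[OF B, unfolded preimage_disk_def])
      also have "\<dots> \<le> c" by (rule le)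
      finally show "emeasure green_measure (preimage_disk (C r) n) \<le> c" .
    qed auto
    then show "\<exists>N. \<forall>n\<ge>N. ennreal (1 / (2 * pi)) * emeasure green_measure (preimage_disk (C r) n) \<le> c" by simp
  qed
  moreover have "(SUP r. emeasure \<xi> (cylinder 0 (C r))) = emeasure \<xi> (\<Union>r. cylinder 0 (C r))"
  proof (rule SUP_emeasure_incseq)
    have "R r \<le> R r'" if "r \<le> r'" for r r' using that by (simp add: R_def frac_le)
    then show "incseq (\<lambda>r. cylinder 0 (C r))"
      by (auto simp: incseq_def cylinder_def C_def intro: order_trans)
  qed auto
  moreover have "(\<Union>r. cylinder 0 (C r)) = cylinder 0 B"
  proof -
    have "\<exists>r. b \<in> C r" if "b \<in> B" for b
    proof -
      have b: "norm b < 1" using that assms(2) by auto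
      obtain r where "1 / (1 - norm b) < real r" using reals_Archimedean2 by blast
      then have "1 / (1 - norm b) \<le> real r + 2" by simp
      then have "norm b \<le> R r" using b by (simp add: R_def field_simps)
      then show ?thesis using that by (auto simp: C_def)
    qed
    then show ?thesis by (auto simp: cylinder_def C_def)
  qed
  ultimately show ?thesis
    unfolding emeasure_cylinder[OF B, of k] by (metis SUP_least)
qed

text \<open>
  The orbits in \<open>wandering s\<close> at time \<open>-k\<close> whose distortion between the times \<open>-k-M\<close> and \<open>-k-N\<close> is at
  least 1 (see \<open>large_tail_eq\<close>), written as a condition on the single entry at time \<open>-k-M\<close>.
\<close>
definition large_tail :: "real \<Rightarrow> nat \<Rightarrow> nat \<Rightarrow> nat \<Rightarrow> (nat \<Rightarrow> complex) set" where
  "large_tail s k N M = cylinder (k + M) {w \<in> preimage_disk (wandering s) M. 1 \<le> orbit_distortion (M - N) w}"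

lemma distortion_level_set_borel [measurable]: "{w \<in> preimage_disk (wandering s) M. 1 \<le> orbit_distortion J w} \<in> sets borel"
proof -
  have "preimage_disk (wandering s) M \<inter> {w \<in> space borel. 1 \<le> orbit_distortion J w} \<in> sets borel" by measurable
  then show ?thesis by (simp add: Int_def)
qed

text \<open>
  The preimage of order \<open>n\<close> of the defining set is contained in the set of the same kind with \<open>M + n\<close> in
  place of \<open>M\<close> and the same \<open>N\<close>.
\<close>
lemma emeasure_large_tail:
  assumes "N \<le> M"
  shows "emeasure \<xi> (large_tail s k N M) \<le> tail_bound s N"
  unfolding large_tail_def
proof (rule emeasure_cylinder_le)
  fix n
  let ?B = "{w \<in> preimage_disk (wandering s) M. 1 \<le> orbit_distortion (M - N) w}"
  have "preimage_disk ?B n \<subseteq> {w \<in> preimage_disk (wandering s) (M + n). 1 \<le> orbit_distortion (M + n - N) w}"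
  proof
    fix w assume w: "w \<in> preimage_disk ?B n"
    have "M + n - N = M - N + n" using assms by simp
    then have "1 \<le> orbit_distortion (M + n - N) w"
      using w orbit_distortion_shift_le[of "M - N" n w] by (simp add: preimage_disk_def)
    then show "w \<in> {w \<in> preimage_disk (wandering s) (M + n). 1 \<le> orbit_distortion (M + n - N) w}"
      using w by (auto simp: preimage_disk_def funpow_add)
  qed
  then have "emeasure green_measure (preimage_disk ?B n)
      \<le> emeasure green_measure {w \<in> preimage_disk (wandering s) (M + n). 1 \<le> orbit_distortion (M + n - N) w}"
    by (rule emeasure_mono) (simp add: distortion_level_set_borel)
  also have "\<dots> \<le> tail_bound s N"
    using assms by (intro green_measure_large_distortion_le) simp
  finally show "emeasure green_measure (preimage_disk ?B n) \<le> tail_bound s N" .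
qed (auto simp: preimage_disk_def distortion_level_set_borel[unfolded preimage_disk_def])

lemma large_tail_eq:
  assumes "N \<le> M"
  shows "large_tail s k N M = {z \<in> space \<xi>. z k \<in> wandering s \<and> 1 \<le> (\<Sum>n\<in>{N<..M}. \<delta> (z (k + n)))}"
proof -
  have "z (k + M) \<in> {w \<in> preimage_disk (wandering s) M. 1 \<le> orbit_distortion (M - N) w} \<longleftrightarrow>
      z k \<in> wandering s \<and> 1 \<le> (\<Sum>n\<in>{N<..M}. \<delta> (z (k + n)))" if z: "z \<in> space \<xi>" for z
  proof -
    have "orbit_distortion (M - N) (z (k + M)) = (\<Sum>n\<in>{N<..M}. \<delta> (z (k + n)))"
      unfolding orbit_distortion_def
    proof (rule sum.reindex_bij_witness[where i = "\<lambda>n. M - n" and j = "\<lambda>j. M - j"])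
      fix j assume "j \<in> {..<M - N}"
      then have "k + M = j + (k + (M - j))" by simp
      then show "\<delta> (z (k + (M - j))) = \<delta> ((F0 ^^ j) (z (k + M)))"
        using orbit_funpow[of z j "k + (M - j)"] z by (simp add: space_\<xi>)
    qed auto
    moreover have "(F0 ^^ M) (z (k + M)) = z k"
      using orbit_funpow[of z M k] z by (simp add: space_\<xi> add.commute)
    ultimately show ?thesis
      using orbit_in_disk[of z "k + M"] z by (auto simp: preimage_disk_def space_\<xi>)
  qed
  then show ?thesis by (auto simp: large_tail_def cylinder_def)
qed

text \<open>
  A measurable set that contains the orbits of infinite distortion in \<open>wandering s\<close> at time \<open>-k\<close>; for
  each \<open>N\<close> the union is increasing.
\<close>
definition divergent :: "real \<Rightarrow> nat \<Rightarrow> (nat \<Rightarrow> complex) set" where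
  "divergent s k = (\<Inter>N. \<Union>M. large_tail s k N (N + M))"

lemma large_tail_measurable [measurable]: "large_tail s k N M \<in> sets \<xi>"
  unfolding large_tail_def by measurable

lemma divergent_null: "divergent s k \<in> null_sets \<xi>"
proof
  show "divergent s k \<in> sets \<xi>" unfolding divergent_def by measurable
  have "emeasure \<xi> (divergent s k) \<le> tail_bound s N" for N
  proof -
    have "emeasure \<xi> (divergent s k) \<le> emeasure \<xi> (\<Union>M. large_tail s k N (N + M))"
      by (rule emeasure_mono) (auto simp: divergent_def)
    also have "\<dots> = (SUP M. emeasure \<xi> (large_tail s k N (N + M)))"
    proof (rule SUP_emeasure_incseq[symmetric])
      show "incseq (\<lambda>M. large_tail s k N (N + M))"
      proof (rule monoI, rule subsetI)
        fix M M' z assume "M \<le> M'" and z: "z \<in> large_tail s k N (N + M)"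
        have "(\<Sum>n\<in>{N<..N + M}. \<delta> (z (k + n))) \<le> (\<Sum>n\<in>{N<..N + M'}. \<delta> (z (k + n)))"
          using \<open>M \<le> M'\<close> by (intro sum_mono2) (auto simp: \<delta>_nonneg)
        then show "z \<in> large_tail s k N (N + M')"
          using z by (auto simp: large_tail_eq)
      qed
    qed auto
    also have "\<dots> \<le> tail_bound s N"
      by (intro SUP_least emeasure_large_tail) simp
    finally show ?thesis .
  qed
  then have "emeasure \<xi> (divergent s k) \<le> 0"
    by (intro LIMSEQ_le_const[OF tail_bound_tendsto_0[OF finite_exponent]]) auto
  then show "emeasure \<xi> (divergent s k) = 0" by simp
qed

text \<open>
  A tail whose partial sums are all below 1 would converge.
\<close>
lemma not_summable_imp_divergent:
  assumes z: "z \<in> space \<xi>" "z k \<in> wandering s" and "\<not> summable (\<lambda>n. \<delta> (z n))"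
  shows "z \<in> divergent s k"
proof -
  have ns: "\<not> summable (\<lambda>n. \<delta> (z (k + (n + Suc N))))" for N
    using assms(3) summable_iff_shift[of "\<lambda>n. \<delta> (z n)" "k + Suc N"] by (simp add: add_ac)
  have "\<exists>M. z \<in> large_tail s k N (N + M)" for N
  proof (rule ccontr)
    assume "\<nexists>M. z \<in> large_tail s k N (N + M)"
    then have lt: "(\<Sum>n\<in>{N<..N + M}. \<delta> (z (k + n))) < 1" for M
      using z by (auto simp: large_tail_eq not_le)
    have "(\<Sum>n<M. \<delta> (z (k + (n + Suc N)))) \<le> 1" for M
    proof -
      have "(\<Sum>n<M. \<delta> (z (k + (n + Suc N)))) = (\<Sum>n\<in>{N<..N + M}. \<delta> (z (k + n)))"
        by (rule sum.reindex_bij_witness[where i = "\<lambda>n. n - Suc N" and j = "\<lambda>n. n + Suc N"]) auto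
      then show ?thesis using lt[of M] by simp
    qed
    then have "summable (\<lambda>n. \<delta> (z (k + (n + Suc N))))"
      by (intro summableI_nonneg_bounded[where x = 1] \<delta>_nonneg)
    then show False using ns by blast
  qed
  then show ?thesis by (auto simp: divergent_def)
qed

text \<open>
  The equality case of the Schwarz lemma; this is where rotations are excluded.
\<close>
lemma norm_F_less:
  assumes "norm z < 1" "z \<noteq> 0" shows "norm (F z) < norm z"
proof (rule ccontr)
  assume "\<not> norm (F z) < norm z"
  then have "norm (F z) = norm z" using schwarz[OF assms(1)] by simp
  then obtain c where "\<forall>z. norm z < 1 \<longrightarrow> F z = c * z" "norm c = 1"
    using Schwarz_Lemma(3)[OF hol fixes_0 norm_lt_1, of z] assms by blast
  then show False using not_rotation by (auto simp: is_rotation_def)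
qed

lemma orbit_eventually_nonzero:
  assumes z: "z \<in> inverse_orbits F"
  obtains k where "\<And>n. k \<le> n \<Longrightarrow> z n \<noteq> 0"
proof -
  obtain k where k: "z k \<noteq> 0" using z by (auto simp: inverse_orbits_def fun_eq_iff)
  have "z n \<noteq> 0" if "k \<le> n" for n
    using that
  proof (induction n rule: dec_induct)
    case (step n)
    then show ?case using orbit_step[OF z, of n] fixes_0 by auto
  qed (rule k)
  then show ?thesis by (rule that)
qed

definition exceptional :: "(nat \<Rightarrow> complex) set" where
  "exceptional = (\<Union>s\<in>\<rat>. \<Union>k. divergent s k)"

lemma exceptional_null: "exceptional \<in> null_sets \<xi>"
  unfolding exceptional_def by (intro null_sets_UN' countable_rat null_sets_UN divergent_null)

lemma summable_outside_exceptional: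
  assumes z: "z \<in> space \<xi>" "z \<notin> exceptional"
  shows "summable (\<lambda>n. \<delta> (z n))"
proof (rule ccontr)
  assume ns: "\<not> summable (\<lambda>n. \<delta> (z n))"
  have orb: "z \<in> inverse_orbits F" using z by (simp add: space_\<xi>)
  obtain k where k: "z k \<noteq> 0" using orbit_eventually_nonzero[OF orb] by blast
  have zk: "z k \<in> ball 0 1" by (rule orbit_in_disk[OF orb])
  then have "norm (F (z k)) < norm (z k)" using norm_F_less k by simp
  then obtain s where s: "s \<in> \<rat>" "norm (F (z k)) < s" "s < norm (z k)"
    using Rats_dense_in_real by blast
  then have "z k \<in> wandering s" using zk by (simp add: wandering_def F0_def)
  then have "z \<in> divergent s k" by (rule not_summable_imp_divergent[OF z(1) _ ns])
  then show False using z(2) s(1) by (auto simp: exceptional_def)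
qed

lemma cumulative_distortion_finite:
  assumes z: "z \<in> inverse_orbits F" and "summable (\<lambda>n. \<delta> (z n))"
  shows "cumulative_distortion F z < \<infinity>"
proof -
  have "cumulative_distortion F z = (\<Sum>n. ennreal (\<delta> (z (Suc n))))"
    unfolding cumulative_distortion_def using orbit_in_disk[OF z] by (simp add: \<delta>_def)
  also have "\<dots> = ennreal (\<Sum>n. \<delta> (z (Suc n)))"
    using assms(2) by (intro suminf_ennreal2 \<delta>_nonneg) (simp only: summable_Suc_iff[of "\<lambda>n. \<delta> (z n)"])
  finally show ?thesis by simp
qed

lemma holomorphic_funpow: "(F ^^ m) holomorphic_on ball 0 1"
proof (induction m)
  case (Suc m)
  have "(F \<circ> (F ^^ m)) holomorphic_on ball 0 1"
    using funpow_F0(2) by (intro holomorphic_on_compose_gen[OF Suc hol]) auto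
  then show ?case by (simp only: funpow.simps)
qed (simp add: id_def)

text \<open>
  By the chain rule the ratio for \<open>F\<^sup>m\<^sup>+\<^sup>1\<close> is a product \<open>q p\<close> of the ratio \<open>q\<close> of the last step and the ratio
  \<open>p\<close> of the first \<open>m\<close> steps, and \<open>|1 - q p| \<le> |1 - q| + |q| |1 - p|\<close> with \<open>|q| \<le> 1\<close>. The entries have to be
  nonzero for the radial vectors to cancel.
\<close>
lemma linear_distortion_funpow_le:
  assumes z: "z \<in> inverse_orbits F" and nz: "\<And>i. n \<le> i \<Longrightarrow> z i \<noteq> 0"
  shows "linear_distortion (F ^^ m) (z (m + n)) \<le> (\<Sum>j<m. \<delta> (z (Suc (n + j))))"
  using nz
proof (induction m arbitrary: n)
  case 0
  have "v_rad (z n) \<noteq> 0"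
    using norm_v_rad[of "z n"] orbit_in_disk[OF z, of n] 0 one_minus_square_pos[of "z n"] by auto
  then show ?case by (simp add: linear_distortion_def id_def)
next
  case (Suc m)
  define a where "a = z (Suc m + n)"
  have a: "a \<in> ball 0 1" unfolding a_def by (rule orbit_in_disk[OF z])
  have Fa: "(F ^^ m) a = z (Suc n)"
    using orbit_funpow[OF z, of m "Suc n"] funpow_F0(1)[OF a, of m] by (simp add: a_def)
  have "((F \<circ> (F ^^ m)) has_field_derivative deriv F ((F ^^ m) a) * deriv (F ^^ m) a) (at a)"
    using a orbit_in_disk[OF z, of "Suc n"]
    by (intro DERIV_chain holomorphic_derivI[OF hol open_ball] holomorphic_derivI[OF holomorphic_funpow open_ball]) (auto simp: Fa)
  then have d: "deriv (F ^^ Suc m) a = deriv F (z (Suc n)) * deriv (F ^^ m) a"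
    using DERIV_imp_deriv by (fastforce simp: Fa)
  have v: "v_rad (z (Suc n)) \<noteq> 0"
    using norm_v_rad[of "z (Suc n)"] orbit_in_disk[OF z, of "Suc n"] Suc.prems[of "Suc n"]
      one_minus_square_pos[of "z (Suc n)"] by auto
  define q where "q = rad_ratio (z (Suc n))"
  define p where "p = deriv (F ^^ m) a * v_rad a / v_rad (z (Suc n))"
  have "deriv (F ^^ Suc m) a * v_rad a / v_rad ((F ^^ Suc m) a) = q * p"
    using v by (simp add: d[simplified] Fa orbit_step[OF z] q_def p_def rad_ratio_def)
  then have "linear_distortion (F ^^ Suc m) a = norm ((1 - q) + q * (1 - p))"
    by (simp only: linear_distortion_def) (simp add: algebra_simps)
  also have "\<dots> \<le> norm (1 - q) + norm q * norm (1 - p)"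
    by (rule order_trans[OF norm_triangle_ineq]) (simp add: norm_mult)
  also have "\<dots> \<le> norm (1 - q) + 1 * norm (1 - p)"
    using norm_rad_ratio_le_1[of "z (Suc n)"] orbit_in_disk[OF z, of "Suc n"]
    by (intro add_left_mono mult_right_mono) (auto simp: q_def)
  also have "norm (1 - q) = \<delta> (z (Suc n))"
    using orbit_in_disk[OF z, of "Suc n"] by (simp add: q_def \<delta>_def linear_distortion_eq)
  also have "norm (1 - p) = linear_distortion (F ^^ m) (z (m + Suc n))"
    unfolding linear_distortion_def p_def using Fa by (simp add: a_def)
  also have "\<dots> \<le> (\<Sum>j<m. \<delta> (z (Suc (Suc n + j))))"
    by (rule Suc.IH) (use Suc.prems in auto)
  finally show ?case
    by (subst sum.lessThan_Suc_shift) (simp add: a_def o_def)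
qed

lemma summable_imp_linear:
  assumes z: "z \<in> inverse_orbits F" and sum: "summable (\<lambda>n. \<delta> (z n))"
  shows "z \<in> linear_inverse_orbits F"
proof -
  have "((\<lambda>(m, n). linear_distortion (F ^^ m) (z (m + n))) \<longlongrightarrow> 0) (sequentially \<times>\<^sub>F sequentially)"
  proof (rule tendstoI)
    fix e :: real assume "e > 0"
    obtain k where k: "\<And>n. k \<le> n \<Longrightarrow> z n \<noteq> 0" using orbit_eventually_nonzero[OF z] by blast
    have "eventually (\<lambda>N. norm (\<Sum>j. \<delta> (z (j + N))) < e) sequentially"
      using tendstoD[OF suminf_exist_split2[OF sum] \<open>e > 0\<close>] by (simp add: dist_norm)
    then obtain N where N: "\<And>n. n \<ge> N \<Longrightarrow> norm (\<Sum>j. \<delta> (z (j + n))) < e"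
      by (auto simp: eventually_sequentially)
    have small: "linear_distortion (F ^^ m) (z (m + n)) < e" if "n \<ge> max N k" for m n
    proof -
      have "linear_distortion (F ^^ m) (z (m + n)) \<le> (\<Sum>j<m. \<delta> (z (Suc (n + j))))"
        using that k by (intro linear_distortion_funpow_le[OF z]) auto
      also have "\<dots> = (\<Sum>j<m. \<delta> (z (j + Suc n)))" by (simp add: add.commute)
      also have "\<dots> \<le> (\<Sum>j. \<delta> (z (j + Suc n)))"
        using summable_ignore_initial_segment[OF sum, of "Suc n"] by (intro sum_le_suminf) (auto simp: \<delta>_nonneg)
      also have "\<dots> \<le> norm (\<Sum>j. \<delta> (z (j + Suc n)))" by simp
      also have "\<dots> < e" using that by (intro N) auto
      finally show ?thesis .
    qed
    show "\<forall>\<^sub>F x in sequentially \<times>\<^sub>F sequentially. dist (case x of (m, n) \<Rightarrow> linear_distortion (F ^^ m) (z (m + n))) 0 < e"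
      unfolding eventually_prod_sequentially
    proof (intro exI allI impI)
      fix m n assume "max N k \<le> m" "max N k \<le> n"
      have "0 \<le> linear_distortion (F ^^ n) (z (n + m))" by (simp add: linear_distortion_def)
      then show "dist (case (n, m) of (m, n) \<Rightarrow> linear_distortion (F ^^ m) (z (m + n))) 0 < e"
        using small[OF \<open>max N k \<le> m\<close>, of n] by simp
    qed
  qed
  then show ?thesis using z by (simp add: linear_inverse_orbits_def)
qed

text \<open>
  A subset of a null set is itself in \<^term>\<open>null_sets \<xi>\<close> only if it is measurable.
\<close>
lemma linear_inverse_orbits_measurable: "linear_inverse_orbits F \<in> sets \<xi>"
proof -
  define D where "D m w = (if w \<in> ball 0 1 then linear_distortion (F ^^ m) w else 0)" for m w
  have [measurable]: "D m \<in> borel_measurable borel" for m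
    unfolding D_def[abs_def] by (rule measurable_linear_distortion[OF holomorphic_funpow])
  have D: "D m (z n) = linear_distortion (F ^^ m) (z n)" if "z \<in> inverse_orbits F" for m n z
    using orbit_in_disk[OF that] by (simp add: D_def)
  have "linear_inverse_orbits F = {z \<in> space \<xi>. \<forall>i::nat. \<exists>N. \<forall>n\<ge>N. \<forall>m\<ge>N. D m (z (m + n)) < inverse (real (Suc i))}"
  proof -
    have "((\<lambda>(m, n). linear_distortion (F ^^ m) (z (m + n))) \<longlongrightarrow> 0) (sequentially \<times>\<^sub>F sequentially) \<longleftrightarrow>
        (\<forall>i::nat. \<exists>N. \<forall>n\<ge>N. \<forall>m\<ge>N. D m (z (m + n)) < inverse (real (Suc i)))" (is "?L \<longleftrightarrow> ?R")
      if z: "z \<in> inverse_orbits F" for z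
    proof -
      have ev: "(\<forall>\<^sub>F x in sequentially \<times>\<^sub>F sequentially. dist (case x of (m, n) \<Rightarrow> linear_distortion (F ^^ m) (z (m + n))) 0 < e)
        \<longleftrightarrow> (\<exists>N. \<forall>n\<ge>N. \<forall>m\<ge>N. D m (z (m + n)) < e)" for e
        unfolding eventually_prod_sequentially D[OF z] by (simp add: linear_distortion_def)
      show ?thesis
      proof
        assume ?L
        then show ?R unfolding tendsto_iff ev by simp
      next
        assume R: ?R
        show ?L unfolding tendsto_iff ev
        proof (intro allI impI)
          fix e :: real assume "e > 0"
          then obtain i where "inverse (real (Suc i)) < e" using reals_Archimedean by blast
          then show "\<exists>N. \<forall>n\<ge>N. \<forall>m\<ge>N. D m (z (m + n)) < e" using R by (meson order_less_trans)
        qed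
      qed
    qed
    then show ?thesis by (auto simp: linear_inverse_orbits_def space_\<xi>)
  qed
  also have "\<dots> \<in> sets \<xi>" by measurable
  finally show ?thesis .
qed

theorem almost_every_orbit_linear:
  "(AE z in \<xi>. cumulative_distortion F z < \<infinity>)" "inverse_orbits F - linear_inverse_orbits F \<in> null_sets \<xi>"
proof -
  have "{z \<in> space \<xi>. \<not> cumulative_distortion F z < \<infinity>} \<subseteq> exceptional"
    using cumulative_distortion_finite summable_outside_exceptional by (auto simp: space_\<xi>)
  then show "AE z in \<xi>. cumulative_distortion F z < \<infinity>"
    by (rule AE_I'[OF exceptional_null])
  have "inverse_orbits F - linear_inverse_orbits F \<subseteq> exceptional"
    using summable_imp_linear summable_outside_exceptional by (auto simp: space_\<xi>)
  moreover have "inverse_orbits F - linear_inverse_orbits F \<in> sets \<xi>"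
    using linear_inverse_orbits_measurable by (simp add: space_\<xi>[symmetric] sets.compl_sets)
  ultimately show "inverse_orbits F - linear_inverse_orbits F \<in> null_sets \<xi>"
    using exceptional_null null_sets_subset by blast
qed

end

theorem theorem12p1:
  fixes F :: "complex \<Rightarrow> complex" and \<xi> :: "(nat \<Rightarrow> complex) measure"
  assumes "inner_function F"
    and "F 0 = 0"
    and "\<not> is_rotation F"
    and "finite_lyapunov_exponent F"
    and "is_inverse_orbit_measure F \<xi>"
  shows "(AE z in \<xi>. cumulative_distortion F z < \<infinity>) \<and>
         inverse_orbits F - linear_inverse_orbits F \<in> null_sets \<xi>"
proof -
  interpret inverse_orbit_system F \<xi>
    using assms by unfold_locales (auto simp: inner_function_def image_subset_iff)
  show ?thesis using almost_every_orbit_linear by simp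
qed

end
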